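(* Consider $n$ agents $\dot p_i=v_i$, $\dot v_i=S_1p_i+S_2v_i+\Gamma_i$, $i\in\mathcal N=\{1,\dots,n\}$, with $p_i,v_i\in\mathbb R^N$ and known matrices $S_1,S_2\in\mathbb R^{N\times N}$, interconnected by the directed graph $\mathcal G$ with follower set $\mathfrak F$ and leader set $\mathfrak L$, where $\Gamma_i\equiv0$ for $i\in\mathfrak L$. Suppose that the graph assumption, the bounded-blackout assumption and the common-sampling assumption (all stated in the context) hold, and that all eigenvalues of $$S:=\begin{bmatrix}0_N&I_N\\S_1&S_2\end{bmatrix}$$ are pure imaginary and semi-simple. Put $\hat v_i\equiv v_i$ for $i\in\mathfrak L$. For $i\in\mathfrak F$ let $$\psi_i=\begin{bmatrix}\psi_{i,1}\\\psi_{i,2}\end{bmatrix}=\frac1{\kappa_i}\sum_{j=1}^n a_{ij}\,e^{S(t-t_{k_{ij}^{\mathrm m}(t)})}\begin{bmatrix}p_j(t_{k_{ij}^{\mathrm m}(t)})\\\hat v_j(t_{k_{ij}^{\mathrm m}(t)})\end{bmatrix}\in\mathbb R^{2N},\qquad \dot{\hat v}_i=S_1p_i+S_2\hat v_i+\sigma_i,$$ and let the input be $$\Gamma_i=-(k_{d_i}I_N+S_2)(v_i-\hat v_i)-k_{p_i}(p_i-\psi_{i,1})+2\sigma_i,$$ $$\dot\sigma_i=S_1(v_i-\hat v_i)+S_2\sigma_i-k_{d_i}\sigma_i-k_{p_i}(\hat v_i-\psi_{i,2}),$$ where the gains $k_{p_i},k_{d_i}>0$ are such that the roots of $x^2+k_{d_i}x+k_{p_i}=0$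 are real. Then, for arbitrary initial conditions, all signals are uniformly bounded, and $\boldsymbol v_F(t)+(\mathcal L_1^{-1}\mathcal L_2\otimes I_N)\boldsymbol v_L(t)\to0$ and $\mathbf p_F(t)+(\mathcal L_1^{-1}\mathcal L_2\otimes I_N)\mathbf p_L(t)\to0$ as $t\to+\infty$. The same conclusions hold if, with the same $\hat v_i$ equation and $\psi_i$, the following (velocity-free) algorithm is used instead for each $i\in\mathfrak F$, with $k_{\phi_i}>0$ such that the matrix $-k_{\phi_i}I_N+S_2$ is stable (all eigenvalues have negative real parts): $$\Gamma_i=-(k_{d_i}I_N+S_2)\big(k_{\phi_i}(\phi_i+p_i)-\hat v_i\big)-k_{p_i}(p_i-\psi_{i,1})+2\sigma_i,$$ $$\dot\sigma_i=-(k_{d_i}I_N-S_2)\sigma_i+S_1\big(k_{\phi_i}(\phi_i+p_i)-\hat v_i\big)-k_{p_i}(\hat v_i-\psi_{i,2}),$$ $$\dot\phi_i=-(k_{\phi_i}I_N-S_2)(p_i+\phi_i)+\frac1{k_{\phi_i}}(\Gamma_i+S_1p_i).$$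
   Context: Graph. $\mathcal G=(\mathcal N,\mathcal E,\mathcal A)$ is a weighted directed graph on $\mathcal N=\{1,\dots,n\}$ with adjacency matrix $\mathcal A=[a_{ij}]\in\mathbb R^{n\times n}$: $a_{ii}=0$, $a_{ij}>0$ if $(j,i)\in\mathcal E$ (agent $i$ can receive information from agent $j$), and $a_{ij}=0$ otherwise. The Laplacian $\mathcal L=[l_{ij}]$ has $l_{ii}=\sum_j a_{ij}$ and $l_{ij}=-a_{ij}$ for $i\ne j$. There are $m<n$ followers $\mathfrak F=\{1,\dots,m\}$ and $n-m$ leaders $\mathfrak L=\{m+1,\dots,n\}$: a leader $i$ has $(j,i)\notin\mathcal E$ for all $j$; a follower $i$ has $(j,i)\in\mathcal E$ for at least one $j$. Hence $\mathcal L=\begin{bmatrix}\mathcal L_1&\mathcal L_2\\0&0\end{bmatrix}$ with $\mathcal L_1\in\mathbb R^{m\times m}$, $\mathcal L_2\in\mathbb R^{m\times(n-m)}$. For $i\in\mathfrak F$, $\kappa_i:=\sum_{j=1}^n a_{ij}>0$. Under the graph assumption below, $\mathcal L_1$ is invertible. $\otimes$ is the Kronecker product; $\mathbf x_F$, $\mathbf x_L$ are the column stacks of $x_i$ over $i\in\mathfrak F$, respectively $i\in\mathfrak L$. $0_N$ and $I_N$ are the $N\times N$ zero and identity matrices. Graph assumption: for each $i\in\mathfrak F$ there is at least one $j\in\mathfrak L$ with a directed path from $j$ to $i$ in $\mathcal G$. Communication. For each $(j,i)\in\mathcal E$ there is a strictly increasing unbounded sequence of indices $\mathscr S_{ij}\subseteq\{0,1,2,\dots\}$;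 agent $j$ sends data to agent $i$ at the instants $t_{k}$, $k\in\mathscr S_{ij}$ (written $t_{k_{ij}}$, $k_{ij}\in\mathscr S_{ij}$), and the data sent at $t_{k}$ is received at $t_{k}+\tau_{k}$, with delay $\tau_{k}\in[0,+\infty]$ that may depend on the edge ($\tau_k=+\infty$ meaning that the data is lost). The transmitted data consist of $p_j(t_k)$, $\hat v_j(t_k)$ and the index $k$. $k_{ij}^{\mathrm m}(t)$ is the largest index $k\in\mathscr S_{ij}$ such that the data sent by $j$ at $t_k$ has been delivered to $i$ by time $t$, i.e. $t_k+\tau_k\le t$; before the first delivery one takes $k_{ij}^{\mathrm m}(t)=0$, $t_{k_{ij}^{\mathrm m}(t)}=0$. Bounded-blackout assumption: there is $T^*>0$ such that for each $(j,i)\in\mathcal E$ there is a strictly increasing infinite subsequence $\{k_{ij}^{(1)},k_{ij}^{(2)},\dots\}\subseteq\mathscr S_{ij}$ with $t_{k_{ij}^{(l+1)}}+\tau_{k_{ij}^{(l+1)}}-t_{k_{ij}^{(l)}}\le T^*$ for all $l\ge1$. Common-sampling assumption: $t_{k_{ij}}=k_{ij}T$ for all $(j,i)\in\mathcal E$, $k_{ij}\in\mathscr S_{ij}$, where $T>0$ is a sampling period known to all agents. All systems evolve on $t\ge0$; differential equations with right-hand sides discontinuous in time are understood in the Carathéodory sense. "Uniformly bounded" means bounded on $[0,\infty)$ along the given solution. "All signals" means all the states and inputs of the closed-loop system: $p_i,v_i$ for $i\in\mathcal N$ and $\hat v_i,\sigma_i,\psi_i,\Gamma_i$ (and $\phi_i$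 when used) for $i\in\mathfrak F$. *)

theory Defs
  imports "HOL-Analysis.Analysis" "HOL-Computational_Algebra.Polynomial"
begin

subsection \<open>Matrices and stacked vectors\<close>

text \<open>Dimensions are index types. A sum type \<open>'m + 'n\<close> indexes a vector with two blocks, a product
  type \<open>'m \<times> 'n\<close> indexes a column stack of vectors of dimension \<open>'n\<close> over the agents \<open>'m\<close>.\<close>

definition block_vec :: "real ^ 'm::finite \<Rightarrow> real ^ 'n::finite \<Rightarrow> real ^ ('m + 'n)" where
  "block_vec x y = (\<chi> r. case r of Inl i \<Rightarrow> x $ i | Inr i \<Rightarrow> y $ i)"

definition upper :: "real ^ ('m::finite + 'n::finite) \<Rightarrow> real ^ 'm" where
  "upper x = (\<chi> i. x $ Inl i)"

definition lower :: "real ^ ('m::finite + 'n::finite) \<Rightarrow> real ^ 'n" where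
  "lower x = (\<chi> i. x $ Inr i)"

definition sys_matrix :: "real ^ 'd ^ 'd \<Rightarrow> real ^ 'd ^ 'd \<Rightarrow> real ^ ('d::finite + 'd) ^ ('d + 'd)" where
  "sys_matrix S1 S2 =
    (\<chi> r. case r of Inl i \<Rightarrow> block_vec (0 :: real ^ 'd) (mat 1 $ i)
                | Inr i \<Rightarrow> block_vec (S1 $ i) (S2 $ i))"

definition kronecker ::
  "real ^ 'n::finite ^ 'm::finite \<Rightarrow> real ^ 'q::finite ^ 'p::finite \<Rightarrow> real ^ ('n \<times> 'q) ^ ('m \<times> 'p)" where
  "kronecker A B = (\<chi> r c. A $ fst r $ fst c * B $ snd r $ snd c)"

definition stack :: "('m::finite \<Rightarrow> real ^ 'n::finite) \<Rightarrow> real ^ ('m \<times> 'n)" where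
  "stack x = (\<chi> r. x (fst r) $ snd r)"

text \<open>The library has no exponential for this matrix type: its product is \<open>(**)\<close>.\<close>

definition matrix_pow :: "real ^ 'n ^ 'n \<Rightarrow> nat \<Rightarrow> real ^ 'n ^ 'n::finite" where
  "matrix_pow A k = (((**) A) ^^ k) (mat 1)"

definition matrix_exp :: "real ^ 'n ^ 'n \<Rightarrow> real ^ 'n ^ 'n::finite" where
  "matrix_exp A = (\<Sum>k. matrix_pow A k /\<^sub>R fact k)"

lemma summable_matrix_exp: "summable (\<lambda>k. matrix_pow (A :: real ^ 'n ^ 'n::finite) k /\<^sub>R fact k)"
proof -
  have "bilinear ((**) :: real ^ 'n ^ 'n \<Rightarrow> real ^ 'n ^ 'n \<Rightarrow> real ^ 'n ^ 'n)"
    unfolding bilinear_def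
    by (auto intro!: linearI simp: vec_eq_iff matrix_matrix_mult_def sum.distrib sum_distrib_left
        algebra_simps)
  then obtain K where K: "K > 0" "\<And>(B :: real ^ 'n ^ 'n) (C :: real ^ 'n ^ 'n). norm (B ** C) \<le> K * norm B * norm C"
    using bilinear_bounded_pos by metis
  have bound: "norm (matrix_pow A k) \<le> norm (mat 1 :: real ^ 'n ^ 'n) * (K * norm A) ^ k" for k
  proof (induction k)
    case (Suc k)
    have "norm (matrix_pow A (Suc k)) \<le> K * norm A * norm (matrix_pow A k)"
      using K(2)[of A "matrix_pow A k"] by (simp add: matrix_pow_def)
    also have "\<dots> \<le> K * norm A * (norm (mat 1 :: real ^ 'n ^ 'n) * (K * norm A) ^ k)"
      using K(1) Suc by (intro mult_left_mono) auto
    finally show ?case by (simp add: algebra_simps)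
  qed (simp add: matrix_pow_def)
  show ?thesis
  proof (rule summable_comparison_test')
    show "summable (\<lambda>k. norm (mat 1 :: real ^ 'n ^ 'n) * ((K * norm A) ^ k /\<^sub>R fact k))"
      by (intro summable_mult summable_exp_generic)
    show "norm (matrix_pow A k /\<^sub>R fact k)
        \<le> norm (mat 1 :: real ^ 'n ^ 'n) * ((K * norm A) ^ k /\<^sub>R fact k)" if "k \<ge> 0" for k
      using mult_left_mono[OF bound[of k], of "inverse (fact k)"] by (simp add: mult_ac)
  qed
qed

subsection \<open>Eigenvalues\<close>

text \<open>Eigenvalues of a real matrix are the complex ones.\<close>

definition eigenspace :: "real ^ 'n ^ 'n \<Rightarrow> complex \<Rightarrow> (complex ^ 'n::finite) set" where
  "eigenspace A z = {w. map_matrix complex_of_real A *v w = z *s w}"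

definition is_eigenvalue :: "real ^ 'n ^ 'n::finite \<Rightarrow> complex \<Rightarrow> bool" where
  "is_eigenvalue A z \<longleftrightarrow> (\<exists>w \<in> eigenspace A z. w \<noteq> 0)"

definition charpoly :: "real ^ 'n ^ 'n::finite \<Rightarrow> complex poly" where
  "charpoly A = det (mat [:0, 1:] - map_matrix (\<lambda>a. [:complex_of_real a:]) A)"

text \<open>Algebraic multiplicity equals geometric multiplicity (dimension over the complex numbers).\<close>

definition semisimple_eigenvalue :: "real ^ 'n ^ 'n::finite \<Rightarrow> complex \<Rightarrow> bool" where
  "semisimple_eigenvalue A z \<longleftrightarrow>
    is_eigenvalue A z \<and> order z (charpoly A) = vec.dim (eigenspace A z)"

definition stable_matrix :: "real ^ 'n ^ 'n::finite \<Rightarrow> bool" where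
  "stable_matrix A \<longleftrightarrow> (\<forall>z. is_eigenvalue A z \<longrightarrow> Re z < 0)"

subsection \<open>Graph\<close>

text \<open>Agents form the type \<open>'f + 'l\<close>: followers \<open>Inl _\<close>, leaders \<open>Inr _\<close>. A pair \<open>(j, i) \<in> E\<close> means
  that \<open>i\<close> receives information from \<open>j\<close>, and its weight is \<open>A $ i $ j\<close>.\<close>

definition weighted_digraph :: "'n::finite rel \<Rightarrow> real ^ 'n ^ 'n \<Rightarrow> bool" where
  "weighted_digraph E A \<longleftrightarrow>
    (\<forall>i. A $ i $ i = 0) \<and> (\<forall>i j. if (j, i) \<in> E then A $ i $ j > 0 else A $ i $ j = 0)"

definition leader_follower_graph ::
  "('f::finite + 'l::finite) rel \<Rightarrow> real ^ ('f + 'l) ^ ('f + 'l) \<Rightarrow> bool" where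
  "leader_follower_graph E A \<longleftrightarrow>
    weighted_digraph E A \<and> (\<forall>l j. (j, Inr l) \<notin> E) \<and> (\<forall>f. \<exists>j. (j, Inl f) \<in> E)"

definition laplacian :: "real ^ 'n ^ 'n \<Rightarrow> real ^ 'n ^ 'n::finite" where
  "laplacian A = (\<chi> i j. if i = j then (\<Sum>k\<in>UNIV. A $ i $ k) else - A $ i $ j)"

definition lap1 :: "real ^ ('f::finite + 'l::finite) ^ ('f + 'l) \<Rightarrow> real ^ 'f ^ 'f" where
  "lap1 A = (\<chi> i j. laplacian A $ Inl i $ Inl j)"

definition lap2 :: "real ^ ('f::finite + 'l::finite) ^ ('f + 'l) \<Rightarrow> real ^ 'l ^ 'f" where
  "lap2 A = (\<chi> i j. laplacian A $ Inl i $ Inr j)"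

subsection \<open>Communication\<close>

text \<open>For an edge \<open>(j, i)\<close>, \<open>K i j\<close> is the set of indices of the transmissions from \<open>j\<close> to \<open>i\<close>,
  \<open>ts i j k\<close> the sending instant of transmission \<open>k\<close> and \<open>\<tau> i j k\<close> its delay (\<open>\<infinity>\<close> if lost).\<close>

definition bounded_blackout ::
  "'n rel \<Rightarrow> ('n \<Rightarrow> 'n \<Rightarrow> nat set) \<Rightarrow> ('n \<Rightarrow> 'n \<Rightarrow> nat \<Rightarrow> real) \<Rightarrow> ('n \<Rightarrow> 'n \<Rightarrow> nat \<Rightarrow> ereal) \<Rightarrow> bool" where
  "bounded_blackout E K ts \<tau> \<longleftrightarrow>
    (\<exists>Tstar::real. Tstar > 0 \<and> (\<forall>i j. (j, i) \<in> E \<longrightarrow>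
      (\<exists>\<kappa>::nat \<Rightarrow> nat. strict_mono \<kappa> \<and> range \<kappa> \<subseteq> K i j \<and>
        (\<forall>l. ereal (ts i j (\<kappa> (Suc l))) + \<tau> i j (\<kappa> (Suc l)) - ereal (ts i j (\<kappa> l)) \<le> ereal Tstar))))"

definition delivered ::
  "nat set \<Rightarrow> (nat \<Rightarrow> real) \<Rightarrow> (nat \<Rightarrow> ereal) \<Rightarrow> real \<Rightarrow> nat set" where
  "delivered Kij tsij \<tau>ij t = {k \<in> Kij. ereal (tsij k) + \<tau>ij k \<le> ereal t}"

text \<open>The sending instant of the delivered data with the largest index, and \<open>0\<close> before the first
  delivery. The delivered indices form a finite set when \<open>tsij k = k * T\<close> with \<open>T > 0\<close> and the
  delays are nonnegative.\<close>

definition last_instant ::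
  "nat set \<Rightarrow> (nat \<Rightarrow> real) \<Rightarrow> (nat \<Rightarrow> ereal) \<Rightarrow> real \<Rightarrow> real" where
  "last_instant Kij tsij \<tau>ij t =
    (if delivered Kij tsij \<tau>ij t = {} then 0 else tsij (Max (delivered Kij tsij \<tau>ij t)))"

text \<open>The argument \<open>r i j t\<close> of \<open>psi\<close> is the last instant for the edge \<open>(j, i)\<close> at time \<open>t\<close>.\<close>

definition psi ::
  "real ^ 'n ^ 'n \<Rightarrow> real ^ ('d + 'd) ^ ('d + 'd) \<Rightarrow> ('n \<Rightarrow> 'n \<Rightarrow> real \<Rightarrow> real) \<Rightarrow>
   ('n \<Rightarrow> real \<Rightarrow> real ^ 'd) \<Rightarrow> ('n \<Rightarrow> real \<Rightarrow> real ^ 'd) \<Rightarrow> 'n::finite \<Rightarrow> real \<Rightarrow> real ^ ('d::finite + 'd)" where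
  "psi A S r p vh i t =
    (1 / (\<Sum>j\<in>UNIV. A $ i $ j)) *\<^sub>R
      (\<Sum>j\<in>UNIV. A $ i $ j *\<^sub>R
        (matrix_exp ((t - r i j t) *\<^sub>R S) *v block_vec (p j (r i j t)) (vh j (r i j t))))"

subsection \<open>Dynamics\<close>

text \<open>Caratheodory solution on \<open>[0, \<infinity>)\<close> of the equation whose right-hand side, along \<open>x\<close>, is the
  function \<open>f\<close> of time: the integral equation with Lebesgue integrals.\<close>

definition caratheodory :: "(real \<Rightarrow> 'a::euclidean_space) \<Rightarrow> (real \<Rightarrow> 'a) \<Rightarrow> bool" where
  "caratheodory x f \<longleftrightarrow>
    (\<forall>t\<ge>0. f absolutely_integrable_on {0..t} \<and> x t = x 0 + integral {0..t} f)"

definition velocity_algorithm ::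
  "real ^ 'd::finite ^ 'd \<Rightarrow> real ^ 'd ^ 'd \<Rightarrow> real \<Rightarrow> real \<Rightarrow> (real \<Rightarrow> real ^ ('d + 'd)) \<Rightarrow>
   (real \<Rightarrow> real ^ 'd) \<Rightarrow> (real \<Rightarrow> real ^ 'd) \<Rightarrow> (real \<Rightarrow> real ^ 'd) \<Rightarrow>
   (real \<Rightarrow> real ^ 'd) \<Rightarrow> (real \<Rightarrow> real ^ 'd) \<Rightarrow> bool" where
  "velocity_algorithm S1 S2 kp kd \<psi> p v vh \<sigma> \<Gamma> \<longleftrightarrow>
    (\<forall>t\<ge>0. \<Gamma> t = - ((kd *\<^sub>R mat 1 + S2) *v (v t - vh t)) - kp *\<^sub>R (p t - upper (\<psi> t)) + 2 *\<^sub>R \<sigma> t) \<and>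
    caratheodory \<sigma>
      (\<lambda>t. S1 *v (v t - vh t) + S2 *v \<sigma> t - kd *\<^sub>R \<sigma> t - kp *\<^sub>R (vh t - lower (\<psi> t)))"

definition velocity_free_algorithm ::
  "real ^ 'd::finite ^ 'd \<Rightarrow> real ^ 'd ^ 'd \<Rightarrow> real \<Rightarrow> real \<Rightarrow> real \<Rightarrow> (real \<Rightarrow> real ^ ('d + 'd)) \<Rightarrow>
   (real \<Rightarrow> real ^ 'd) \<Rightarrow> (real \<Rightarrow> real ^ 'd) \<Rightarrow> (real \<Rightarrow> real ^ 'd) \<Rightarrow>
   (real \<Rightarrow> real ^ 'd) \<Rightarrow> (real \<Rightarrow> real ^ 'd) \<Rightarrow> bool" where
  "velocity_free_algorithm S1 S2 kp kd k\<phi> \<psi> p vh \<sigma> \<phi> \<Gamma> \<longleftrightarrow>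
    (\<forall>t\<ge>0. \<Gamma> t = - ((kd *\<^sub>R mat 1 + S2) *v (k\<phi> *\<^sub>R (\<phi> t + p t) - vh t))
                  - kp *\<^sub>R (p t - upper (\<psi> t)) + 2 *\<^sub>R \<sigma> t) \<and>
    caratheodory \<sigma>
      (\<lambda>t. - ((kd *\<^sub>R mat 1 - S2) *v \<sigma> t) + S1 *v (k\<phi> *\<^sub>R (\<phi> t + p t) - vh t)
           - kp *\<^sub>R (vh t - lower (\<psi> t))) \<and>
    caratheodory \<phi>
      (\<lambda>t. - ((k\<phi> *\<^sub>R mat 1 - S2) *v (p t + \<phi> t)) + (1 / k\<phi>) *\<^sub>R (\<Gamma> t + S1 *v p t))"

definition uniformly_bounded :: "(real \<Rightarrow> 'a::real_normed_vector) \<Rightarrow> bool" where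
  "uniformly_bounded x \<longleftrightarrow> bounded (x ` {0..})"

definition containment_error ::
  "real ^ ('f::finite + 'l::finite) ^ ('f + 'l) \<Rightarrow> ('f + 'l \<Rightarrow> real \<Rightarrow> real ^ 'd::finite) \<Rightarrow>
   real \<Rightarrow> real ^ ('f \<times> 'd)" where
  "containment_error A x t =
    stack (\<lambda>i. x (Inl i) t)
    + kronecker (matrix_inv (lap1 A) ** lap2 A) (mat 1 :: real ^ 'd ^ 'd) *v stack (\<lambda>i. x (Inr i) t)"

end

theory Submission
  imports Defs "HOL-Computational_Algebra.Fundamental_Theorem_Algebra"
begin

text \<open>
  Put \<open>\<xi>\<^sub>i = (p\<^sub>i, vh\<^sub>i)\<close>, \<open>\<mu>\<^sub>i = (v\<^sub>i - vh\<^sub>i, \<sigma>\<^sub>i)\<close> and \<open>S = sys_matrix S1 S2\<close>. Both algorithms are designed so that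
  \<open>\<xi>\<^sub>i' = S \<xi>\<^sub>i + \<mu>\<^sub>i\<close> and \<open>\<mu>\<^sub>i' = S \<mu>\<^sub>i - kd \<mu>\<^sub>i - kp (\<xi>\<^sub>i - \<psi>\<^sub>i) + \<delta>\<^sub>i\<close>, where \<open>\<delta> = 0\<close> for the first algorithm, and
  for the velocity-free one \<open>\<delta>\<close> is linear in the observer error \<open>\<eta> = v - k\<phi> (\<phi> + p)\<close>, which satisfies the
  stable equation \<open>\<eta>' = (S2 - k\<phi>) \<eta>\<close>. In the coordinates \<open>z\<^sub>i = exp (- t S) \<xi>\<^sub>i\<close> the leaders are constant
  and \<open>\<psi>\<^sub>i\<close> becomes a weighted average of delayed values of the \<open>z\<^sub>j\<close>. Since \<open>x\<^sup>2 + kd x + kp\<close> has real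
  roots, each follower is a cascade of two scalar relaxations towards that average. Relative to the
  harmonic extension of the leader values, averaging contracts a weighted maximum norm by a factor
  \<open>\<rho> < 1\<close>; relaxations preserve such bounds, and the delayed instants tend to infinity, so the errors
  tend to zero. The semisimple imaginary spectrum makes \<open>exp (t S)\<close> bounded for all real \<open>t\<close>, which
  transports the conclusions back. All right-hand sides are continuous off the delivery times, which
  are finitely many in bounded intervals, so Caratheodory solutions are classical there.
\<close>

text \<open>The delays differ between edges, vary with time and may let data arrive out of order, so
  no fixed matrix governs the averages. What survives every admissible delay is a bound on the
  maximum over the past, hence the maximum norm. This is also where the real roots matter: a
  first-order relaxation with positive real rate yields a convex combination of its initial norm and
  the bound on its input, so it passes such a bound on with gain one, whereas an oscillating
  second-order response may overshoot. The plain maximum norm would not do: a follower without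
  leaders among its in-neighbours averages with total weight 1 over followers and loses nothing.
  Weights taken from the distance to the leaders make the loss visible at every follower in a single
  step. The two spectral assumptions are exploited without normal forms. Stability is used by
  peeling off one eigenvalue factor at a time, each a scalar relaxation. Semisimplicity enters
  through a dimension count which shows that the eigenvectors span the space.\<close>

section \<open>Componentwise derivatives and bilinearity of the matrix products\<close>

lemma has_vector_derivative_vec_lambda:
  fixes f :: "real \<Rightarrow> 'a::real_normed_vector ^ 'n::finite"
  assumes "\<And>i. ((\<lambda>t. f t $ i) has_vector_derivative g $ i) (at t within S)"
  shows "(f has_vector_derivative g) (at t within S)"
  using assms
  unfolding has_vector_derivative_def has_derivative_within
  by (auto intro!: vec_tendstoI bounded_linear_scaleR_left)

lemma bounded_bilinear_matrix_matrix_mult: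
  "bounded_bilinear ((**) :: real ^ 'n::finite ^ 'm::finite \<Rightarrow> real ^ 'k::finite ^ 'n \<Rightarrow> _)"
  unfolding bilinear_conv_bounded_bilinear[symmetric] bilinear_def
  by (auto intro!: linearI simp: vec_eq_iff matrix_matrix_mult_def sum.distrib sum_distrib_left
      algebra_simps)

lemma bounded_bilinear_matrix_vector_mult:
  "bounded_bilinear ((*v) :: real ^ 'n::finite ^ 'm::finite \<Rightarrow> real ^ 'n \<Rightarrow> _)"
  unfolding bilinear_conv_bounded_bilinear[symmetric] bilinear_def
  by (auto intro!: linearI simp: vec_eq_iff matrix_vector_mult_def sum.distrib sum_distrib_left
      algebra_simps)

lemmas matrix_algebra =
  bounded_bilinear.scaleR_left[OF bounded_bilinear_matrix_vector_mult]
  bounded_bilinear.scaleR_right[OF bounded_bilinear_matrix_vector_mult]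
  bounded_bilinear.minus_left[OF bounded_bilinear_matrix_vector_mult]
  bounded_bilinear.minus_right[OF bounded_bilinear_matrix_vector_mult]
  bounded_bilinear.add_left[OF bounded_bilinear_matrix_vector_mult]
  bounded_bilinear.add_right[OF bounded_bilinear_matrix_vector_mult]
  bounded_bilinear.diff_left[OF bounded_bilinear_matrix_vector_mult]
  bounded_bilinear.diff_right[OF bounded_bilinear_matrix_vector_mult]

subsection \<open>The matrix exponential\<close>

lemma matrix_pow_0: "matrix_pow A 0 = mat 1"
  by (simp add: matrix_pow_def)

lemma matrix_pow_Suc: "matrix_pow A (Suc k) = A ** matrix_pow A k"
  by (simp add: matrix_pow_def)

lemma matrix_pow_Suc_right: "matrix_pow A (Suc k) = matrix_pow A k ** A"
proof (induction k)
  case (Suc k)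
  then show ?case
    by (metis matrix_pow_Suc matrix_mul_assoc)
qed (simp add: matrix_pow_def)

lemma matrix_pow_scaleR: "matrix_pow (t *\<^sub>R A) k = t ^ k *\<^sub>R matrix_pow A k"
proof (induction k)
  case (Suc k)
  then show ?case
    by (simp add: matrix_pow_Suc bounded_bilinear.scaleR_left[OF bounded_bilinear_matrix_matrix_mult]
        bounded_bilinear.scaleR_right[OF bounded_bilinear_matrix_matrix_mult])
qed (simp add: matrix_pow_def)

text \<open>Each entry of the exponential is a scalar power series in \<open>t\<close>, so scalar
  termwise differentiation gives the derivative of \<open>matrix_exp\<close>.\<close>

lemma summable_matrix_exp_entry: "summable (\<lambda>k. matrix_pow A k $ i $ j / fact k * t ^ k)"
proof -
  have "summable (\<lambda>k. (matrix_pow (t *\<^sub>R A) k /\<^sub>R fact k) $ i $ j)"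
    by (intro bounded_linear.summable[OF bounded_linear_vec_nth] summable_matrix_exp)
  then show ?thesis
    by (simp add: matrix_pow_scaleR field_simps)
qed

lemma matrix_exp_entry:
  "matrix_exp (t *\<^sub>R A) $ i $ j = (\<Sum>k. matrix_pow A k $ i $ j / fact k * t ^ k)"
proof -
  have "matrix_exp (t *\<^sub>R A) $ i $ j = (\<Sum>k. (matrix_pow (t *\<^sub>R A) k /\<^sub>R fact k) $ i $ j)"
    unfolding matrix_exp_def
    by (simp only: bounded_linear.suminf[OF bounded_linear_vec_nth] summable_matrix_exp
        bounded_linear.summable[OF bounded_linear_vec_nth])
  then show ?thesis
    by (simp add: matrix_pow_scaleR field_simps)
qed

lemma matrix_exp_0: "matrix_exp 0 = (mat 1 :: real^'n^'n::finite)"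
proof -
  have "matrix_exp ((0::real) *\<^sub>R (0::real^'n^'n)) $ i $ j = (mat 1 :: real^'n^'n) $ i $ j" for i j
    unfolding matrix_exp_entry
    using powser_zero[of "\<lambda>k. matrix_pow (0::real^'n^'n) k $ i $ j / fact k"] by (simp only: matrix_pow_0) simp
  then show ?thesis
    by (simp add: vec_eq_iff)
qed

lemma matrix_exp_entry_derivative:
  "((\<lambda>t. matrix_exp (t *\<^sub>R A) $ i $ j) has_real_derivative
     (\<Sum>k. matrix_pow A (Suc k) $ i $ j / fact k * t ^ k)) (at t)"
proof -
  let ?c = "\<lambda>k. matrix_pow A k $ i $ j / fact k"
  have "((\<lambda>t. \<Sum>k. ?c k * t ^ k) has_field_derivative (\<Sum>k. diffs ?c k * t ^ k)) (at t)"
    by (rule termdiffs_strong_converges_everywhere) (rule summable_matrix_exp_entry)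
  moreover have "diffs ?c k = matrix_pow A (Suc k) $ i $ j / fact k" for k
    by (simp add: diffs_def divide_simps) (simp add: algebra_simps)?
  ultimately show ?thesis
    by (simp add: matrix_exp_entry)
qed

text \<open>The differentiated series is resummed with the extra factor \<open>A\<close> split off
  on the left; \<open>matrix_exp_entry_right\<close> splits it off on the right. Comparing the two
  yields \<open>matrix_exp_commute\<close>.\<close>

lemma matrix_exp_entry_left:
  "(\<Sum>k. matrix_pow A (Suc k) $ i $ j / fact k * t ^ k) = (A ** matrix_exp (t *\<^sub>R A)) $ i $ j"
proof -
  have "(\<Sum>k. matrix_pow A (Suc k) $ i $ j / fact k * t ^ k)
      = (\<Sum>k. \<Sum>l\<in>UNIV. A $ i $ l * (matrix_pow A k $ l $ j / fact k * t ^ k))"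
    by (simp add: matrix_pow_Suc matrix_matrix_mult_def sum_distrib_left sum_divide_distrib mult_ac)
  also have "\<dots> = (\<Sum>l\<in>UNIV. \<Sum>k. A $ i $ l * (matrix_pow A k $ l $ j / fact k * t ^ k))"
    by (intro suminf_sum summable_mult summable_matrix_exp_entry)
  also have "\<dots> = (A ** matrix_exp (t *\<^sub>R A)) $ i $ j"
    by (simp only: matrix_matrix_mult_def matrix_exp_entry suminf_mult[OF summable_matrix_exp_entry]
        vec_lambda_beta)
  finally show ?thesis .
qed

lemma matrix_exp_entry_right:
  "(\<Sum>k. matrix_pow A (Suc k) $ i $ j / fact k * t ^ k) = (matrix_exp (t *\<^sub>R A) ** A) $ i $ j"
proof -
  have "(\<Sum>k. matrix_pow A (Suc k) $ i $ j / fact k * t ^ k)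
      = (\<Sum>k. \<Sum>l\<in>UNIV. A $ l $ j * (matrix_pow A k $ i $ l / fact k * t ^ k))"
    by (simp add: matrix_pow_Suc_right matrix_matrix_mult_def sum_distrib_left sum_divide_distrib mult_ac)
  also have "\<dots> = (\<Sum>l\<in>UNIV. \<Sum>k. A $ l $ j * (matrix_pow A k $ i $ l / fact k * t ^ k))"
    by (intro suminf_sum summable_mult summable_matrix_exp_entry)
  also have "\<dots> = (matrix_exp (t *\<^sub>R A) ** A) $ i $ j"
    by (simp only: matrix_matrix_mult_def matrix_exp_entry suminf_mult[OF summable_matrix_exp_entry]
        vec_lambda_beta mult.commute[of "A $ _ $ j" "suminf _"])
  finally show ?thesis .
qed

lemma matrix_exp_has_vector_derivative:
  "((\<lambda>t. matrix_exp (t *\<^sub>R A)) has_vector_derivative matrix_exp (t *\<^sub>R A) ** A) (at t)"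
  by (intro has_vector_derivative_vec_lambda)
    (simp only: matrix_exp_entry_derivative flip: has_real_derivative_iff_has_vector_derivative
      matrix_exp_entry_right)

lemma matrix_exp_commute: "A ** matrix_exp (t *\<^sub>R A) = matrix_exp (t *\<^sub>R A) ** A"
  by (simp add: vec_eq_iff flip: matrix_exp_entry_left matrix_exp_entry_right)

lemma matrix_exp_has_vector_derivative_neg:
  "((\<lambda>t. matrix_exp (- t *\<^sub>R A)) has_vector_derivative - (matrix_exp (- t *\<^sub>R A) ** A)) (at t)"
  using vector_diff_chain_at[of uminus "- 1" t "\<lambda>t. matrix_exp (t *\<^sub>R A)", OF _ matrix_exp_has_vector_derivative]
  by (simp add: o_def has_vector_derivative_minus[OF has_vector_derivative_id, simplified])

text \<open>Variation of constants: passing to \<open>matrix_exp (- t *\<^sub>R A) *v x t\<close>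
  removes the drift \<open>A *v x t\<close> and leaves only the forcing.\<close>

lemma matrix_exp_mult_has_vector_derivative:
  assumes "(x has_vector_derivative x') (at t within U)"
  shows "((\<lambda>t. matrix_exp (- t *\<^sub>R A) *v x t) has_vector_derivative
           matrix_exp (- t *\<^sub>R A) *v (x' - A *v x t)) (at t within U)"
  using bounded_bilinear.has_vector_derivative[OF bounded_bilinear_matrix_vector_mult
      has_vector_derivative_at_within[OF matrix_exp_has_vector_derivative_neg] assms, of A]
  by (simp add: matrix_algebra matrix_vector_mul_assoc)

text \<open>The integrating factor makes the derivative vanish. The inverse law and the addition law
  of the exponential are then obtained from uniqueness, both sides being solutions of the same
  equation, instead of by multiplying series.\<close>

lemma linear_ode_unique:
  assumes "\<And>t. (x has_vector_derivative A *v x t) (at t)"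
  shows "matrix_exp (- t *\<^sub>R A) *v x t = x 0"
proof -
  have "((\<lambda>t. matrix_exp (- t *\<^sub>R A) *v x t) has_vector_derivative 0) (at t within UNIV)" for t
    using matrix_exp_mult_has_vector_derivative[OF assms, of A t] by simp
  then obtain c where c: "matrix_exp (- t *\<^sub>R A) *v x t = c" for t
    using has_vector_derivative_zero_constant[of UNIV "\<lambda>t. matrix_exp (- t *\<^sub>R A) *v x t"] by auto
  then show ?thesis
    using c[of 0] by (simp add: matrix_exp_0)
qed

lemma matrix_exp_vector_derivative:
  "((\<lambda>t. matrix_exp (t *\<^sub>R A) *v w) has_vector_derivative A *v (matrix_exp (t *\<^sub>R A) *v w)) (at t)"
  using bounded_linear.has_vector_derivative[OF
      bounded_bilinear.bounded_linear_left[OF bounded_bilinear_matrix_vector_mult]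
      matrix_exp_has_vector_derivative]
  by (simp add: matrix_vector_mul_assoc matrix_exp_commute)

lemma matrix_exp_inverse: "matrix_exp (- t *\<^sub>R A) *v (matrix_exp (t *\<^sub>R A) *v w) = w"
  using linear_ode_unique[OF matrix_exp_vector_derivative, of t A w] by (simp add: matrix_exp_0)

lemma matrix_exp_inverse': "matrix_exp (t *\<^sub>R A) *v (matrix_exp (- t *\<^sub>R A) *v w) = w"
  using matrix_exp_inverse[of "- t" A w] by simp

lemma linear_ode_solution:
  assumes "\<And>t. (x has_vector_derivative A *v x t) (at t)"
  shows "x t = matrix_exp (t *\<^sub>R A) *v x 0"
  using linear_ode_unique[OF assms, of t] matrix_exp_inverse'[of t A "x t"] by simp

lemma matrix_exp_diff:
  "matrix_exp ((t - r) *\<^sub>R A) *v w = matrix_exp (t *\<^sub>R A) *v (matrix_exp (- r *\<^sub>R A) *v w)"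
proof -
  have "((\<lambda>t. matrix_exp ((t - r) *\<^sub>R A) *v w) has_vector_derivative
          A *v (matrix_exp ((t - r) *\<^sub>R A) *v w)) (at t)" for t
    using vector_diff_chain_at[where f = "\<lambda>t. t - r" and x = t and f' = 1,
        OF _ matrix_exp_vector_derivative[of A w]]
    by (simp add: o_def has_vector_derivative_diff_const has_vector_derivative_id)
  from linear_ode_solution[OF this] show ?thesis
    by simp
qed

lemma continuous_matrix_exp: "continuous_on U (\<lambda>t. matrix_exp (t *\<^sub>R A))"
  by (intro continuous_at_imp_continuous_on ballI
      has_vector_derivative_continuous[OF matrix_exp_has_vector_derivative])

subsection \<open>Differential equations off a locally finite set\<close>

definition locally_finite_times :: "real set \<Rightarrow> bool" where
  "locally_finite_times C \<longleftrightarrow> (\<forall>t. finite (C \<inter> {0..t}))"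

text \<open>Classical counterpart of \<open>caratheodory\<close>: \<open>C\<close> collects the
  possible jumps of the right-hand side, while continuity across \<open>C\<close> carries the
  information of the integral equation. Since \<open>f\<close> is a function of time alone, already
  evaluated along the solution, solutions can be added, scaled and mapped linearly. Time 0 is left
  out because the derivative is two-sided.\<close>

definition solves_off :: "real set \<Rightarrow> (real \<Rightarrow> 'a::banach) \<Rightarrow> (real \<Rightarrow> 'a) \<Rightarrow> bool" where
  "solves_off C x f \<longleftrightarrow>
    continuous_on {0..} x \<and> (\<forall>t>0. t \<notin> C \<longrightarrow> (x has_vector_derivative f t) (at t))"

lemma solves_off_cong:
  assumes "solves_off C x f" "\<And>t. t > 0 \<Longrightarrow> f t = g t"
  shows "solves_off C x g"
  using assms by (simp add: solves_off_def)

lemma solves_off_continuous: "solves_off C x f \<Longrightarrow> continuous_on {0..} x"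
  by (simp add: solves_off_def)

lemma solves_off_derivative:
  "solves_off C x f \<Longrightarrow> t > 0 \<Longrightarrow> t \<notin> C \<Longrightarrow> (x has_vector_derivative f t) (at t)"
  by (simp add: solves_off_def)

lemma solves_off_linear:
  assumes "solves_off C x f" "bounded_linear g"
  shows "solves_off C (\<lambda>t. g (x t)) (\<lambda>t. g (f t))"
  using assms unfolding solves_off_def
  by (auto intro: bounded_linear.has_vector_derivative bounded_linear.continuous_on)

lemma solves_off_add:
  assumes "solves_off C x f" "solves_off C y g"
  shows "solves_off C (\<lambda>t. x t + y t) (\<lambda>t. f t + g t)"
  using assms unfolding solves_off_def
  by (auto intro: has_vector_derivative_add continuous_on_add)

lemma solves_off_diff:
  assumes "solves_off C x f" "solves_off C y g"
  shows "solves_off C (\<lambda>t. x t - y t) (\<lambda>t. f t - g t)"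
  using assms unfolding solves_off_def
  by (auto intro: has_vector_derivative_diff continuous_on_diff)

lemma solves_off_scaleR:
  assumes "solves_off C x f"
  shows "solves_off C (\<lambda>t. c *\<^sub>R x t) (\<lambda>t. c *\<^sub>R f t)"
  using solves_off_linear[OF assms bounded_linear_scaleR_right] .

text \<open>The fundamental theorem of calculus tolerates finitely many exceptional points for a
  continuous primitive, and only finitely many points of \<open>C\<close> lie below
  \<open>t\<close>.\<close>

lemma solves_off_has_integral:
  assumes "solves_off C x f" "locally_finite_times C" "0 \<le> s" "s \<le> t"
  shows "(f has_integral x t - x s) {s..t}"
proof (rule fundamental_theorem_of_calculus_interior_strong)
  show "finite (C \<inter> {0..t})"
    using assms(2) by (simp add: locally_finite_times_def)
  show "continuous_on {s..t} x"
    using solves_off_continuous[OF assms(1)] by (rule continuous_on_subset) (use assms(3) in auto)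
qed (use assms in \<open>auto intro!: solves_off_derivative[OF assms(1)]\<close>)

text \<open>Multiplying by \<open>exp (l * r)\<close> turns the equation into an integral of
  \<open>u\<close> against a positive kernel. The resulting bound is a convex combination of
  \<open>norm (y s)\<close> and \<open>M\<close>, which is what later keeps the contraction factor
  intact.\<close>

lemma relaxation_bound:
  fixes y u :: "real \<Rightarrow> 'a::banach"
  assumes y: "solves_off C y (\<lambda>t. - l *\<^sub>R (y t - u t))" and C: "locally_finite_times C"
    and l: "l > 0" and st: "0 \<le> s" "s \<le> t" and u: "\<And>r. s \<le> r \<Longrightarrow> r \<le> t \<Longrightarrow> norm (u r) \<le> M"
  shows "norm (y t) \<le> exp (- l * (t - s)) * norm (y s) + (1 - exp (- l * (t - s))) * M"
proof -
  let ?f = "\<lambda>r. (l * exp (l * r)) *\<^sub>R u r"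
  have "solves_off C (\<lambda>r. exp (l * r) *\<^sub>R y r) ?f"
    unfolding solves_off_def
  proof (intro conjI allI impI)
    show "continuous_on {0..} (\<lambda>r. exp (l * r) *\<^sub>R y r)"
      by (intro continuous_intros solves_off_continuous[OF y])
    fix r :: real assume r: "r > 0" "r \<notin> C"
    have "((\<lambda>r. exp (l * r)) has_real_derivative l * exp (l * r)) (at r)"
      by (auto intro!: derivative_eq_intros)
    from has_vector_derivative_scaleR[OF this solves_off_derivative[OF y r]]
    show "((\<lambda>r. exp (l * r) *\<^sub>R y r) has_vector_derivative ?f r) (at r)"
      by (simp add: algebra_simps)
  qed
  from solves_off_has_integral[OF this C st]
  have I: "(?f has_integral exp (l * t) *\<^sub>R y t - exp (l * s) *\<^sub>R y s) {s..t}" .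
  \<comment> \<open>The same kernel against the constant \<open>M\<close>: its mass is exactly what
    remains after the weight of the initial value, so the two weights add up to 1.\<close>
  have J: "((\<lambda>r. l * exp (l * r) * M) has_integral exp (l * t) * M - exp (l * s) * M) {s..t}"
    by (rule fundamental_theorem_of_calculus[OF st(2)])
      (auto intro!: derivative_eq_intros simp flip: has_real_derivative_iff_has_vector_derivative)
  have "norm (integral {s..t} ?f) \<le> integral {s..t} (\<lambda>r. l * exp (l * r) * M)"
    using l u by (intro integral_norm_bound_integral has_integral_integrable[OF I]
        has_integral_integrable[OF J]) (auto intro!: mult_left_mono)
  then have "norm (exp (l * t) *\<^sub>R y t - exp (l * s) *\<^sub>R y s) \<le> exp (l * t) * M - exp (l * s) * M"
    unfolding integral_unique[OF I] integral_unique[OF J] .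
  with norm_triangle_ineq2[of "exp (l * t) *\<^sub>R y t" "exp (l * s) *\<^sub>R y s"]
  have "exp (l * t) * norm (y t) \<le> exp (l * s) * norm (y s) + (exp (l * t) - exp (l * s)) * M"
    by (simp add: algebra_simps)
  also have "exp (l * s) = exp (l * t) * exp (- l * (t - s))"
    by (simp add: algebra_simps flip: exp_add)
  finally have "exp (l * t) * norm (y t)
      \<le> exp (l * t) * (exp (- l * (t - s)) * norm (y s) + (1 - exp (- l * (t - s))) * M)"
    by (simp only: algebra_simps)
  then show ?thesis
    by simp
qed

lemma relaxation_invariant:
  fixes y u :: "real \<Rightarrow> 'a::banach"
  assumes "solves_off C y (\<lambda>t. - l *\<^sub>R (y t - u t))" "locally_finite_times C"
    "l > 0" "0 \<le> t" "\<And>r. 0 \<le> r \<Longrightarrow> r \<le> t \<Longrightarrow> norm (u r) \<le> M" "norm (y 0) \<le> M"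
  shows "norm (y t) \<le> M"
proof -
  have "norm (y t) \<le> exp (- l * (t - 0)) * norm (y 0) + (1 - exp (- l * (t - 0))) * M"
    using assms by (intro relaxation_bound[OF assms(1,2,3)]) auto
  also have "\<dots> \<le> exp (- l * (t - 0)) * M + (1 - exp (- l * (t - 0))) * M"
    using assms by (intro add_right_mono mult_left_mono) auto
  finally show ?thesis
    by (simp add: algebra_simps)
qed

text \<open>The gap between \<open>M\<close> and \<open>M'\<close> absorbs the exponentially
  decaying contribution of the value at the time from which \<open>u\<close> is bounded.\<close>

lemma relaxation_eventually:
  fixes y u :: "real \<Rightarrow> 'a::banach"
  assumes y: "solves_off C y (\<lambda>t. - l *\<^sub>R (y t - u t))" and C: "locally_finite_times C"
    and l: "l > 0" and u: "\<forall>\<^sub>F t in at_top. norm (u t) \<le> M" and "M < M'"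
  shows "\<forall>\<^sub>F t in at_top. norm (y t) \<le> M'"
proof -
  obtain s where s: "s \<ge> 0" "\<And>r. r \<ge> s \<Longrightarrow> norm (u r) \<le> M"
    using u unfolding eventually_at_top_linorder by (metis linorder_linear order_trans)
  have "((\<lambda>t. exp (- l * (t - s)) * norm (y s) + (1 - exp (- l * (t - s))) * M)
      \<longlongrightarrow> 0 * norm (y s) + (1 - 0) * M) at_top"
  proof (intro tendsto_intros)
    have "filterlim (\<lambda>t. - l * (t - s)) at_bot at_top"
      by (rule filterlim_tendsto_neg_mult_at_bot[OF tendsto_const])
        (use l filterlim_tendsto_add_at_top[OF tendsto_const filterlim_ident, of "- s"] in auto)
    then show "((\<lambda>t. exp (- l * (t - s))) \<longlongrightarrow> 0) at_top"
      "((\<lambda>t. exp (- l * (t - s))) \<longlongrightarrow> 0) at_top"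
      using filterlim_compose[OF exp_at_bot] by auto
  qed
  then have "\<forall>\<^sub>F t in at_top. exp (- l * (t - s)) * norm (y s) + (1 - exp (- l * (t - s))) * M < M'"
    using \<open>M < M'\<close> by (intro order_tendstoD(2)) auto
  then show ?thesis
    using eventually_ge_at_top[of s]
  proof eventually_elim
    case (elim t)
    then show ?case
      using relaxation_bound[OF y C l s(1), of t M] s(2) by force
  qed
qed

lemma relaxation_tendsto_0:
  fixes y u :: "real \<Rightarrow> 'a::banach"
  assumes y: "solves_off C y (\<lambda>t. - l *\<^sub>R (y t - u t))" and C: "locally_finite_times C"
    and l: "l > 0" and u: "(u \<longlongrightarrow> 0) at_top"
  shows "(y \<longlongrightarrow> 0) at_top"
  unfolding tendsto_iff dist_norm
proof (intro allI impI)
  fix e :: real assume e: "e > 0"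
  have "\<forall>\<^sub>F t in at_top. norm (u t) < e / 3"
    using tendstoD[OF u, of "e / 3"] e by simp
  then have "\<forall>\<^sub>F t in at_top. norm (u t) \<le> e / 3"
    by eventually_elim simp
  then have "\<forall>\<^sub>F t in at_top. norm (y t) \<le> e / 2"
    by (rule relaxation_eventually[OF y C l]) (use e in simp)
  then show "\<forall>\<^sub>F t in at_top. norm (y t - 0) < e"
    by eventually_elim (use e in simp)
qed

lemma caratheodory_continuous:
  assumes "caratheodory x f"
  shows "continuous_on {0..} x"
proof -
  have "continuous_on {0..b} x" for b
  proof (cases "b \<ge> 0")
    case True
    then have "f integrable_on {0..b}"
      using assms by (auto simp: caratheodory_def absolutely_integrable_on_def)
    then have "continuous_on {0..b} (\<lambda>t. x 0 + integral {0..t} f)"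
      by (intro continuous_intros indefinite_integral_continuous_1)
    then show ?thesis
      by (rule continuous_on_eq) (use assms in \<open>metis caratheodory_def atLeastAtMost_iff\<close>)
  qed simp
  then have "continuous (at t within {0..}) x" if "t \<ge> 0" for t
  proof -
    have "at t within {0..} = at t within {0..t + 1}"
      by (rule at_within_nhd[of _ "{t - 1 <..< t + 1}"]) auto
    then show ?thesis
      using \<open>continuous_on {0..t + 1} x\<close> that by (simp add: continuous_on_eq_continuous_within)
  qed
  then show ?thesis
    by (simp add: continuous_on_eq_continuous_within)
qed

text \<open>At a point of continuity of the integrand the indefinite integral is differentiable. The
  integral equation is available only for nonnegative times, so the comparison is made on an open
  interval to the right of 0.\<close>

lemma caratheodory_solves_off:
  assumes x: "caratheodory x f" and f: "\<And>t. t > 0 \<Longrightarrow> t \<notin> C \<Longrightarrow> isCont f t"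
  shows "solves_off C x f"
  unfolding solves_off_def
proof (intro conjI allI impI)
  show "continuous_on {0..} x"
    by (rule caratheodory_continuous[OF x])
  fix t :: real assume t: "t > 0" "t \<notin> C"
  have "f integrable_on {0..t + 1}"
    using x t by (auto simp: caratheodory_def absolutely_integrable_on_def)
  from integral_has_vector_derivative_continuous_at[OF this, of t "{}"]
  have "((\<lambda>u. integral {0..u} f) has_vector_derivative f t) (at t within {0..t + 1})"
    using f[OF t] t by (simp add: continuous_at_imp_continuous_at_within)
  then have "((\<lambda>u. integral {0..u} f) has_vector_derivative f t) (at t within {0<..<t + 1})"
    by (rule has_vector_derivative_within_subset) auto
  then have "((\<lambda>u. x 0 + integral {0..u} f) has_vector_derivative f t) (at t within {0<..<t + 1})"
    using has_vector_derivative_add[OF has_vector_derivative_const] by fastforce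
  then have "(x has_vector_derivative f t) (at t within {0<..<t + 1})"
  proof (rule has_vector_derivative_transform[rotated 2])
    fix s assume "s \<in> {0<..<t + 1}"
    then have "s \<ge> 0"
      by simp
    then show "x s = x 0 + integral {0..s} f"
      using x unfolding caratheodory_def by blast
  qed (use t in simp)
  then show "(x has_vector_derivative f t) (at t)"
    using t by (simp add: at_within_open[of t "{0<..<t + 1}"])
qed

text \<open>The tail lies in the unit ball, the initial segment in a compact image.\<close>

lemma continuous_tendsto_0_bounded:
  fixes x :: "real \<Rightarrow> 'a::real_normed_vector"
  assumes "continuous_on {0..} x" "(x \<longlongrightarrow> 0) at_top"
  shows "uniformly_bounded x"
proof -
  obtain b where b: "\<And>t. t \<ge> b \<Longrightarrow> norm (x t) < 1"
    using tendstoD[OF assms(2), of 1] by (auto simp: eventually_at_top_linorder)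
  have "compact (x ` {0..max 0 b})"
    by (intro compact_continuous_image continuous_on_subset[OF assms(1)]) auto
  then have "bounded (x ` {0..max 0 b} \<union> ball 0 1)"
    by (simp add: compact_imp_bounded)
  then show ?thesis
    unfolding uniformly_bounded_def
  proof (rule bounded_subset)
    show "x ` {0..} \<subseteq> x ` {0..max 0 b} \<union> ball 0 1"
    proof
      fix w assume "w \<in> x ` {0..}"
      then obtain t where t: "t \<ge> 0" "w = x t"
        by auto
      then show "w \<in> x ` {0..max 0 b} \<union> ball 0 1"
        using b[of t] by (cases "t \<le> b") auto
    qed
  qed
qed

subsection \<open>Cascaded relaxations coupled through delays\<close>

text \<open>The follower errors in abstract form: \<open>x\<close> is the deviation from the limit,
  \<open>y\<close> the intermediate state of the cascade, \<open>W\<close> the weights between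
  followers and \<open>d\<close> a vanishing perturbation. \<open>\<theta>\<close> weights the
  maximum norm, and the inequality with \<open>\<rho>\<close> says that \<open>W\<close> contracts
  it. Nothing is required of \<open>r i j\<close> where \<open>W i j = 0\<close>.\<close>

locale delayed_contraction =
  fixes C :: "real set" and x y d :: "'f::finite \<Rightarrow> real \<Rightarrow> 'a::banach"
    and W :: "'f \<Rightarrow> 'f \<Rightarrow> real" and r :: "'f \<Rightarrow> 'f \<Rightarrow> real \<Rightarrow> real"
    and \<theta> l1 l2 :: "'f \<Rightarrow> real" and \<rho> :: real
  assumes C: "locally_finite_times C"
    and W: "W i j \<ge> 0"
    and \<theta>: "\<theta> i > 0" "(\<Sum>j\<in>UNIV. W i j * \<theta> j) \<le> \<rho> * \<theta> i"
    and \<rho>: "\<rho> < 1"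
    and l: "l1 i > 0" "l2 i > 0"
    and y: "solves_off C (y i)
          (\<lambda>t. - l2 i *\<^sub>R (y i t - ((\<Sum>j\<in>UNIV. W i j *\<^sub>R x j (r i j t)) + d i t)))"
    and x: "solves_off C (x i) (\<lambda>t. - l1 i *\<^sub>R (x i t - y i t))"
    and r: "W i j \<noteq> 0 \<Longrightarrow> t \<ge> 0 \<Longrightarrow> r i j t \<in> {0..t}"
    and r_lim: "W i j \<noteq> 0 \<Longrightarrow> filterlim (r i j) at_top at_top"
    and d: "(d i \<longlongrightarrow> 0) at_top" "uniformly_bounded (d i)"
begin

abbreviation u :: "'f \<Rightarrow> real \<Rightarrow> 'a" where
  "u i t \<equiv> (\<Sum>j\<in>UNIV. W i j *\<^sub>R x j (r i j t)) + d i t"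

lemma coupling_bound:
  assumes "\<And>j. W i j \<noteq> 0 \<Longrightarrow> norm (x j (r i j t)) \<le> M * \<theta> j" "norm (d i t) \<le> \<epsilon>" "0 \<le> M"
  shows "norm (u i t) \<le> \<rho> * M * \<theta> i + \<epsilon>"
proof -
  have "norm (\<Sum>j\<in>UNIV. W i j *\<^sub>R x j (r i j t)) \<le> (\<Sum>j\<in>UNIV. W i j * (M * \<theta> j))"
  proof (rule sum_norm_le)
    show "norm (W i j *\<^sub>R x j (r i j t)) \<le> W i j * (M * \<theta> j)" for j
      using assms(1)[of j] W[of i j] by (cases "W i j = 0") (auto intro!: mult_left_mono)
  qed
  also have "\<dots> = M * (\<Sum>j\<in>UNIV. W i j * \<theta> j)"
    by (simp add: sum_distrib_left mult_ac)
  also have "\<dots> \<le> M * (\<rho> * \<theta> i)"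
    by (intro mult_left_mono \<theta> assms)
  finally show ?thesis
    using norm_triangle_ineq[of "\<Sum>j\<in>UNIV. W i j *\<^sub>R x j (r i j t)" "d i t"] assms(2)
    by (simp add: mult_ac)
qed

text \<open>Let \<open>N\<close> be the weighted maximum of \<open>x\<close> over the history
  \<open>{0..t}\<close>, which contains all delayed instants. The average is then at most
  \<open>\<rho> * N + D'\<close> in weighted norm, and two relaxations preserve this bound together
  with that on the initial values, so \<open>N \<le> max m (\<rho> * N + D')\<close>. As
  \<open>\<rho> < 1\<close>, this bounds \<open>N\<close> independently of \<open>t\<close>.\<close>

lemma state_bounded: "\<exists>B>0. \<forall>i. \<forall>t\<ge>0. norm (x i t) \<le> B * \<theta> i"
proof -
  have "\<exists>D. \<forall>t\<ge>0. norm (d i t) \<le> D" for i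
    using d(2)[of i] unfolding uniformly_bounded_def bounded_iff by auto
  then obtain D where D: "\<And>i t. t \<ge> 0 \<Longrightarrow> norm (d i t) \<le> D i"
    by metis
  define D' where "D' = (\<Sum>i\<in>UNIV. D i / \<theta> i)"
  have D0: "0 \<le> D i" for i
    using D[of 0 i] norm_ge_zero[of "d i 0"] by linarith
  have D': "D i \<le> D' * \<theta> i" for i
  proof -
    have "D i / \<theta> i \<le> D'"
      unfolding D'_def using D0 \<theta>(1) by (intro member_le_sum) (auto intro: divide_nonneg_pos)
    then show ?thesis
      using \<theta>(1)[of i] by (simp add: field_simps)
  qed
  define m where "m = (\<Sum>i\<in>UNIV. (norm (x i 0) + norm (y i 0)) / \<theta> i)"
  have m: "norm (x i 0) \<le> m * \<theta> i" "norm (y i 0) \<le> m * \<theta> i" for i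
  proof -
    have "(norm (x i 0) + norm (y i 0)) / \<theta> i \<le> m"
      unfolding m_def using \<theta>(1) by (intro member_le_sum) (auto intro: divide_nonneg_pos add_nonneg_nonneg)
    then have "norm (x i 0) + norm (y i 0) \<le> m * \<theta> i"
      using \<theta>(1)[of i] by (simp add: field_simps)
    then show "norm (x i 0) \<le> m * \<theta> i" "norm (y i 0) \<le> m * \<theta> i"
      using norm_ge_zero[of "x i 0"] norm_ge_zero[of "y i 0"] by linarith+
  qed
  have m0: "m \<ge> 0"
    unfolding m_def using \<theta>(1) by (intro sum_nonneg divide_nonneg_pos) auto
  have D'0: "D' \<ge> 0"
    unfolding D'_def using \<theta>(1) D0 by (intro sum_nonneg divide_nonneg_pos) auto
  \<comment> \<open>Covers both outcomes of the final dichotomy, \<open>N \<le> m\<close> and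
    \<open>N \<le> D' / (1 - \<rho>)\<close>; the summand 1 makes it positive.\<close>
  define B where "B = m + D' / (1 - \<rho>) + 1"
  have "norm (x i t) \<le> B * \<theta> i" if t: "t \<ge> 0" for i t
  proof -
    have "\<exists>s\<in>{0..t}. \<forall>s'\<in>{0..t}. norm (x j s') / \<theta> j \<le> norm (x j s) / \<theta> j" for j
      using t \<theta>(1)[of j] by (intro continuous_attains_sup continuous_intros
        continuous_on_subset[OF solves_off_continuous[OF x[of j]]]) (auto simp: less_imp_neq)
    then obtain s where s: "\<And>j. s j \<in> {0..t}"
      "\<And>j s'. s' \<in> {0..t} \<Longrightarrow> norm (x j s') / \<theta> j \<le> norm (x j (s j)) / \<theta> j"
      by metis
    define N where "N = Max (range (\<lambda>j. norm (x j (s j)) / \<theta> j))"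
    have N: "norm (x j s') \<le> N * \<theta> j" if "s' \<in> {0..t}" for j s'
    proof -
      have "norm (x j s') / \<theta> j \<le> N"
        using s(2)[OF that, of j] unfolding N_def by (rule order_trans) (auto intro: Max_ge)
      then show ?thesis
        using \<theta>(1)[of j] by (simp add: field_simps)
    qed
    have "N \<in> range (\<lambda>j. norm (x j (s j)) / \<theta> j)"
      unfolding N_def by (rule Max_in) auto
    then obtain k where k: "N = norm (x k (s k)) / \<theta> k"
      by auto
    have N0: "N \<ge> 0"
      unfolding k using \<theta>(1)[of k] by simp
    define Q where "Q = max m (\<rho> * N + D')"
    have u: "norm (u j s') \<le> Q * \<theta> j" if "s' \<in> {0..t}" for j s'
    proof -
      have "norm (u j s') \<le> \<rho> * N * \<theta> j + D j"
      proof (rule coupling_bound)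
        show "norm (x j' (r j j' s')) \<le> N * \<theta> j'" if "W j j' \<noteq> 0" for j'
          using r[OF that, of s'] \<open>s' \<in> {0..t}\<close> by (intro N) auto
      qed (use that D N0 in auto)
      also have "\<dots> \<le> (\<rho> * N + D') * \<theta> j"
        using D'[of j] by (simp add: algebra_simps)
      also have "\<dots> \<le> Q * \<theta> j"
        unfolding Q_def using \<theta>(1)[of j] by (intro mult_right_mono) auto
      finally show ?thesis .
    qed
    have init: "norm (x j 0) \<le> Q * \<theta> j" "norm (y j 0) \<le> Q * \<theta> j" for j
    proof -
      have "m * \<theta> j \<le> Q * \<theta> j"
        unfolding Q_def using \<theta>(1)[of j] by (intro mult_right_mono) auto
      with m[of j] show "norm (x j 0) \<le> Q * \<theta> j" "norm (y j 0) \<le> Q * \<theta> j"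
        by linarith+
    qed
    have y': "norm (y j s') \<le> Q * \<theta> j" if "s' \<in> {0..t}" for j s'
      by (rule relaxation_invariant[OF y C l(2) _ u init(2)]) (use that in auto)
    have "norm (x j s') \<le> Q * \<theta> j" if "s' \<in> {0..t}" for j s'
      by (rule relaxation_invariant[OF x C l(1) _ y' init(1)]) (use that in auto)
    \<comment> \<open>Evaluating the new bound at the point where the maximum \<open>N\<close> is
      attained closes the loop.\<close>
    from this[OF s(1), of k] have "N \<le> Q"
      unfolding k using \<theta>(1)[of k] by (simp add: field_simps)
    then have "N \<le> m \<or> (1 - \<rho>) * N \<le> D'"
      by (auto simp: Q_def algebra_simps max_def split: if_splits)
    then have "N \<le> B"
    proof
      assume "(1 - \<rho>) * N \<le> D'"
      then have "N \<le> D' / (1 - \<rho>)"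
        using \<rho> by (simp add: field_simps)
      then show ?thesis
        using m0 by (simp add: B_def)
    next
      assume "N \<le> m"
      moreover have "D' / (1 - \<rho>) \<ge> 0"
        using D'0 \<rho> by simp
      ultimately show ?thesis
        by (simp add: B_def)
    qed
    then have "N * \<theta> i \<le> B * \<theta> i"
      using \<theta>(1)[of i] by simp
    then show ?thesis
      using N[of t i] t by auto
  qed
  moreover have "B > 0"
  proof -
    have "D' / (1 - \<rho>) \<ge> 0"
      using D'0 \<rho> by simp
    then show ?thesis
      using m0 by (simp add: B_def)
  qed
  ultimately show ?thesis
    by blast
qed

text \<open>Since the delayed instants tend to infinity, an eventual bound on \<open>x\<close> is
  eventually inherited by its delayed values. The factor \<open>(1 + \<rho>) / 2\<close>, midway
  between \<open>\<rho>\<close> and 1, leaves room for the three losses incurred on the way back to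
  \<open>x\<close>.\<close>

lemma contraction_step:
  assumes ev: "\<And>i. \<forall>\<^sub>F t in at_top. norm (x i t) \<le> M * \<theta> i" and M: "M > 0"
  shows "\<forall>\<^sub>F t in at_top. norm (y i t) \<le> (1 + \<rho>) / 2 * M * \<theta> i"
    "\<forall>\<^sub>F t in at_top. norm (x i t) \<le> (1 + \<rho>) / 2 * M * \<theta> i"
proof -
  \<comment> \<open>One third of the available slack: one share for the perturbation
    \<open>d\<close>, one for the relaxation of \<open>y\<close>, one for that of
    \<open>x\<close>.\<close>
  define \<delta> where "\<delta> i = (1 - \<rho>) / 6 * M * \<theta> i" for i
  have \<delta>: "\<delta> i > 0" for i
    unfolding \<delta>_def using \<rho> M \<theta>(1) by simp
  have sum: "\<rho> * M * \<theta> i + 3 * \<delta> i = (1 + \<rho>) / 2 * M * \<theta> i" for i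
    unfolding \<delta>_def by (simp add: field_simps)
  have "\<forall>\<^sub>F t in at_top. norm (u i t) \<le> \<rho> * M * \<theta> i + \<delta> i" for i
  proof -
    have "\<forall>\<^sub>F t in at_top. W i j \<noteq> 0 \<longrightarrow> norm (x j (r i j t)) \<le> M * \<theta> j" for j
    proof (cases "W i j = 0")
      case False
      then show ?thesis
        using eventually_compose_filterlim[OF ev r_lim, of i j j] by simp
    qed simp
    then have "\<forall>\<^sub>F t in at_top. \<forall>j. W i j \<noteq> 0 \<longrightarrow> norm (x j (r i j t)) \<le> M * \<theta> j"
      by (rule eventually_all_finite)
    moreover have "\<forall>\<^sub>F t in at_top. norm (d i t) < \<delta> i"
      using tendstoD[OF d(1) \<delta>] by simp
    ultimately show ?thesis
    proof eventually_elim
      case (elim t)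
      then show ?case
        using M by (intro coupling_bound) auto
    qed
  qed
  then have y': "\<forall>\<^sub>F t in at_top. norm (y i t) \<le> \<rho> * M * \<theta> i + 2 * \<delta> i" for i
    by (rule relaxation_eventually[OF y C l(2)]) (use \<delta>[of i] in simp)
  show "\<forall>\<^sub>F t in at_top. norm (y i t) \<le> (1 + \<rho>) / 2 * M * \<theta> i"
    unfolding sum[symmetric] using y'[of i] by (rule eventually_mono) (use \<delta>[of i] in simp)
  show "\<forall>\<^sub>F t in at_top. norm (x i t) \<le> (1 + \<rho>) / 2 * M * \<theta> i"
    unfolding sum[symmetric]
    by (rule relaxation_eventually[OF x C l(1) y']) (use \<delta>[of i] in simp)
qed

text \<open>Iterating \<open>contraction_step\<close> from the uniform bound gives eventual bounds
  that decrease geometrically; the times from which they hold need not be controlled.\<close>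

lemma states_tendsto_0: "(x i \<longlongrightarrow> 0) at_top" "(y i \<longlongrightarrow> 0) at_top"
proof -
  obtain B where B: "B > 0" "\<And>i t. t \<ge> 0 \<Longrightarrow> norm (x i t) \<le> B * \<theta> i"
    using state_bounded by metis
  define q where "q = max 0 ((1 + \<rho>) / 2)"
  have q: "0 \<le> q" "q < 1"
    using \<rho> by (auto simp: q_def)
  \<comment> \<open>The row sums bounded by \<open>\<rho> * \<theta> i\<close> are nonnegative, so
    the \<open>max\<close> in \<open>q\<close> is never active.\<close>
  have "0 \<le> \<rho>"
  proof -
    have "0 \<le> (\<Sum>j\<in>UNIV. W i j * \<theta> j)"
      using W \<theta>(1) by (intro sum_nonneg mult_nonneg_nonneg) (auto intro: less_imp_le)
    then have "0 \<le> \<rho> * \<theta> i"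
      using \<theta>(2)[of i] by linarith
    then show ?thesis
      using \<theta>(1)[of i] by (simp add: zero_le_mult_iff)
  qed
  then have q': "(1 + \<rho>) / 2 = q" "q > 0"
    by (auto simp: q_def)
  have ev: "\<forall>\<^sub>F t in at_top. norm (x i t) \<le> (q ^ n * B) * \<theta> i" for n i
  proof (induction n arbitrary: i)
    case 0
    show ?case
      using eventually_ge_at_top[of 0] by eventually_elim (use B in simp)
  next
    case (Suc n)
    show ?case
      using contraction_step(2)[OF Suc] q' B(1) by (simp add: mult_ac)
  qed
  have small: "\<exists>n. (q ^ n * B) * \<theta> i < e" if "e > 0" for e i
  proof -
    have "(\<lambda>n. (q ^ n * B) * \<theta> i) \<longlonglongrightarrow> (0 * B) * \<theta> i"
      using q by (intro tendsto_intros LIMSEQ_realpow_zero) auto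
    then have "\<forall>\<^sub>F n in sequentially. (q ^ n * B) * \<theta> i < e"
      using that by (intro order_tendstoD(2)) auto
    then show ?thesis
      by (auto simp: eventually_sequentially)
  qed
  show "(x i \<longlongrightarrow> 0) at_top"
    unfolding tendsto_iff dist_norm
  proof (intro allI impI)
    fix e :: real assume "e > 0"
    then obtain n where "(q ^ n * B) * \<theta> i < e"
      using small by blast
    with ev[of i n] show "\<forall>\<^sub>F t in at_top. norm (x i t - 0) < e"
      by (auto elim: eventually_mono)
  qed
  show "(y i \<longlongrightarrow> 0) at_top"
    unfolding tendsto_iff dist_norm
  proof (intro allI impI)
    fix e :: real assume "e > 0"
    then obtain n where n: "(q ^ n * B) * \<theta> i < e"
      using small by blast
    have "(q * (q ^ n * B)) * \<theta> i \<le> 1 * (q ^ n * B) * \<theta> i"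
      using q q' B \<theta>(1)[of i] by (intro mult_right_mono) auto
    with n have "(1 + \<rho>) / 2 * (q ^ n * B) * \<theta> i < e"
      unfolding q' by simp
    with contraction_step(1)[OF ev, of n i] q' B(1) show "\<forall>\<^sub>F t in at_top. norm (y i t - 0) < e"
      by (auto elim: eventually_mono)
  qed
qed

end

subsection \<open>Complexification\<close>

definition cmat :: "real ^ 'n ^ 'm \<Rightarrow> complex ^ 'n::finite ^ 'm::finite" where
  "cmat A = map_matrix complex_of_real A"

definition cvec :: "real ^ 'n \<Rightarrow> complex ^ 'n::finite" where
  "cvec v = (\<chi> i. complex_of_real (v $ i))"

lemma cmat_nth: "cmat A $ i $ j = complex_of_real (A $ i $ j)"
  by (simp add: cmat_def map_matrix_def)

lemma cmat_mult_cvec: "cmat A *v cvec v = cvec (A *v v)"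
  by (simp add: vec_eq_iff matrix_vector_mult_def cmat_nth cvec_def)

lemma bounded_linear_cvec: "bounded_linear (cvec :: real ^ 'n \<Rightarrow> complex ^ 'n::finite)"
  unfolding linear_conv_bounded_linear[symmetric]
  by (auto intro!: linearI simp: cvec_def vec_eq_iff scaleR_conv_of_real[where 'a = complex])

lemma norm_cvec: "norm (cvec v) = norm v"
  by (simp add: norm_vec_def cvec_def)

lemma eigenspace_iff: "w \<in> eigenspace A z \<longleftrightarrow> cmat A *v w = z *s w"
  by (simp add: eigenspace_def cmat_def)

subsection \<open>Stable matrices\<close>

text \<open>The operator \<open>M - z I\<close>. Kept as a function, so that a product of linear
  factors is a \<open>foldr\<close>.\<close>

definition shift :: "complex ^ 'n ^ 'n \<Rightarrow> complex \<Rightarrow> complex ^ 'n \<Rightarrow> complex ^ 'n::finite" where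
  "shift M z w = M *v w - z *s w"

text \<open>Horner's scheme for the polynomial \<open>q\<close> in \<open>M\<close> applied to
  \<open>w\<close>, without forming matrix polynomials.\<close>

definition poly_action :: "complex ^ 'n ^ 'n \<Rightarrow> complex poly \<Rightarrow> complex ^ 'n \<Rightarrow> complex ^ 'n::finite" where
  "poly_action M q w = fold_coeffs (\<lambda>a v. a *s w + M *v v) q 0"

lemma poly_action_0: "poly_action M 0 w = 0"
  by (simp add: poly_action_def)

lemma poly_action_pCons: "poly_action M (pCons a q) w = a *s w + M *v poly_action M q w"
  by (cases "q = 0 \<and> a = 0") (auto simp: poly_action_def)

lemma poly_action_add: "poly_action M (p + q) w = poly_action M p w + poly_action M q w"
  by (induction p q rule: poly_induct2)
    (simp_all add: poly_action_0 poly_action_pCons vec.add vector_sadd_rdistrib algebra_simps)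

lemma poly_action_sum: "poly_action M (sum f I) w = (\<Sum>i\<in>I. poly_action M (f i) w)"
  by (induction I rule: infinite_finite_induct) (simp_all add: poly_action_0 poly_action_add)

lemma poly_action_smult: "poly_action M (smult c p) w = c *s poly_action M p w"
  by (induction p)
    (simp_all add: poly_action_0 poly_action_pCons vec.scale vec.scale_right_distrib mult.commute)

lemma poly_action_shift: "poly_action M q (shift M z w) = shift M z (poly_action M q w)"
  by (induction q)
    (simp_all add: poly_action_0 poly_action_pCons shift_def vec.scale vec.add vec.diff
      vec.scale_right_distrib vec.scale_right_diff_distrib mult.commute)

lemma poly_action_linear_factor:
  "poly_action M ([:- z, 1:] * q) w = shift M z (poly_action M q w)"
proof -
  have "[:- z, 1:] * q = smult (- z) q + pCons 0 q"
    by simp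
  then show ?thesis
    by (simp only: poly_action_add poly_action_smult poly_action_pCons shift_def) simp
qed

lemma poly_action_monom: "poly_action M (monom c k) w = c *s (((*v) M ^^ k) w)"
  by (induction k) (simp_all add: monom_Suc monom_0 poly_action_pCons poly_action_0 vec.scale)

text \<open>Split a root \<open>z\<close> off \<open>q\<close>. If \<open>z\<close> is an eigenvalue
  of \<open>M\<close>, its factor is kept and the cofactor annihilates the image of \<open>V\<close>
  under \<open>shift M z\<close>; this is why \<open>V\<close> is an arbitrary set. Otherwise
  \<open>shift M z\<close> has trivial kernel and the factor is cancelled. In the end only
  eigenvalues remain.\<close>

lemma shift_eigenfactors:
  assumes "q \<noteq> 0" "\<And>w. w \<in> V \<Longrightarrow> poly_action M q w = 0"
  shows "\<exists>zs. (\<forall>z\<in>set zs. \<exists>w. w \<noteq> 0 \<and> M *v w = z *s w) \<and> (\<forall>w\<in>V. foldr (shift M) zs w = 0)"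
  using assms
proof (induction "degree q" arbitrary: q V)
  case 0
  then obtain a where q: "q = [:a:]" "a \<noteq> 0"
    by (metis degree_eq_zeroE pCons_0_0)
  have "w = 0" if "w \<in> V" for w
    using 0(3)[OF that] q by (simp add: poly_action_pCons poly_action_0)
  then show ?case
    by (intro exI[of _ "[]"]) simp
next
  case (Suc n)
  then have "\<not> constant (poly q)"
    by (simp add: constant_degree)
  then obtain z where "poly q z = 0"
    using fundamental_theorem_of_algebra by blast
  then obtain q' where q: "q = [:- z, 1:] * q'"
    by (metis dvdE poly_eq_0_iff_dvd)
  then have q': "q' \<noteq> 0" "degree q' = n"
    using Suc(2,3) by (auto simp: degree_mult_eq simp del: mult_pCons_left)
  have ann: "shift M z (poly_action M q' w) = 0" if "w \<in> V" for w
    using Suc(4)[OF that] by (simp only: q poly_action_linear_factor)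
  show ?case
  proof (cases "\<exists>w. w \<noteq> 0 \<and> M *v w = z *s w")
    case True
    have "\<exists>zs. (\<forall>z\<in>set zs. \<exists>w. w \<noteq> 0 \<and> M *v w = z *s w) \<and>
        (\<forall>w\<in>shift M z ` V. foldr (shift M) zs w = 0)"
      by (rule Suc(1)) (use q' ann in \<open>auto simp: poly_action_shift\<close>)
    then obtain zs where "\<forall>z\<in>set zs. \<exists>w. w \<noteq> 0 \<and> M *v w = z *s w"
      "\<forall>w\<in>V. foldr (shift M) zs (shift M z w) = 0"
      by auto
    with True show ?thesis
      \<comment> \<open>\<open>foldr\<close> applies the last list element first, hence
        \<open>z\<close> is appended.\<close>
      by (intro exI[of _ "zs @ [z]"]) auto
  next
    case False
    show ?thesis
    proof (rule Suc(1))
      show "poly_action M q' w = 0" if "w \<in> V" for w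
        using ann[OF that] False by (auto simp: shift_def)
    qed (use q' in auto)
  qed
qed

text \<open>More vectors than the dimension are dependent as a set. A sequence may repeat values,
  and then the difference of two equal terms already is a relation.\<close>

lemma linear_dependence_sequence:
  fixes f :: "nat \<Rightarrow> 'a::euclidean_space"
  shows "\<exists>c. (\<exists>k\<le>DIM('a). c k \<noteq> 0) \<and> (\<Sum>k\<le>DIM('a). c k *\<^sub>R f k) = 0"
proof (cases "inj_on f {..DIM('a)}")
  case True
  then have "card (f ` {..DIM('a)}) > DIM('a)"
    by (simp add: card_image)
  then have "dependent (f ` {..DIM('a)})"
    by (intro dependent_biggerset) simp
  then obtain c v where c: "v \<in> f ` {..DIM('a)}" "c v \<noteq> 0" "(\<Sum>v\<in>f ` {..DIM('a)}. c v *\<^sub>R v) = 0"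
    by (auto simp: dependent_finite)
  then show ?thesis
    using True by (intro exI[of _ "c \<circ> f"]) (auto simp: sum.reindex)
next
  case False
  then obtain a b where ab: "a \<le> DIM('a)" "b \<le> DIM('a)" "a \<noteq> b" "f a = f b"
    by (auto simp: inj_on_def)
  let ?c = "\<lambda>k. of_bool (k = a) - of_bool (k = b) :: real"
  have "(\<Sum>k\<le>DIM('a). ?c k *\<^sub>R f k)
      = (\<Sum>k\<le>DIM('a). if k = a then f k else 0) - (\<Sum>k\<le>DIM('a). if k = b then f k else 0)"
    unfolding sum_subtractf[symmetric] by (intro sum.cong) auto
  also have "\<dots> = 0"
    using ab by simp
  finally show ?thesis
    using ab by (intro exI[of _ ?c]) auto
qed

lemma cmat_matrix_pow:
  fixes A :: "real ^ 'n ^ 'n::finite"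
  shows "cmat (matrix_pow A k) *v w = ((*v) (cmat A) ^^ k) w"
proof (induction k)
  case 0
  have "cmat (mat 1 :: real ^ 'n ^ 'n) = mat 1"
    by (simp add: vec_eq_iff cmat_nth mat_def)
  then show ?case
    by (simp add: matrix_pow_0)
next
  case (Suc k)
  have "cmat (A ** matrix_pow A k) = cmat A ** cmat (matrix_pow A k)"
    by (simp add: vec_eq_iff cmat_nth matrix_matrix_mult_def)
  then show ?case
    by (simp add: matrix_pow_Suc Suc flip: matrix_vector_mul_assoc)
qed

text \<open>The powers of \<open>A\<close> live in a finite-dimensional space, so some nonzero
  polynomial annihilates \<open>A\<close>; \<open>shift_eigenfactors\<close> then discards all of
  its roots that are not eigenvalues.\<close>

lemma eigenfactors_annihilate:
  fixes A :: "real ^ 'n ^ 'n::finite"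
  obtains zs where "\<And>z. z \<in> set zs \<Longrightarrow> is_eigenvalue A z"
    "\<And>w. foldr (shift (cmat A)) zs w = 0"
proof -
  let ?N = "DIM(real ^ 'n ^ 'n)"
  obtain c k where c: "k \<le> ?N" "c k \<noteq> 0" "(\<Sum>k\<le>?N. c k *\<^sub>R matrix_pow A k) = 0"
    using linear_dependence_sequence[of "matrix_pow A"] by blast
  define q where "q = (\<Sum>k\<le>?N. monom (complex_of_real (c k)) k)"
  have "coeff q k = complex_of_real (c k)"
    unfolding q_def coeff_sum using c(1) by (simp add: if_distrib cong: if_cong)
  with c(2) have "q \<noteq> 0"
    by auto
  have "poly_action (cmat A) q w = 0" for w
  proof -
    have "poly_action (cmat A) q w = (\<Sum>k\<le>?N. complex_of_real (c k) *s (cmat (matrix_pow A k) *v w))"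
      by (simp add: q_def poly_action_sum poly_action_monom cmat_matrix_pow)
    also have "\<dots> = cmat (\<Sum>k\<le>?N. c k *\<^sub>R matrix_pow A k) *v w"
      unfolding vec_eq_iff
    proof
      fix i
      have "(\<Sum>k\<le>?N. complex_of_real (c k) *s (cmat (matrix_pow A k) *v w)) $ i
          = (\<Sum>k\<le>?N. \<Sum>j\<in>UNIV. complex_of_real (c k * matrix_pow A k $ i $ j) * w $ j)"
        by (simp add: matrix_vector_mult_def cmat_nth sum_distrib_left mult.assoc)
      also have "\<dots> = (\<Sum>j\<in>UNIV. \<Sum>k\<le>?N. complex_of_real (c k * matrix_pow A k $ i $ j) * w $ j)"
        by (rule sum.swap)
      also have "\<dots> = (cmat (\<Sum>k\<le>?N. c k *\<^sub>R matrix_pow A k) *v w) $ i"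
        by (simp add: matrix_vector_mult_def cmat_nth sum_distrib_right)
      finally show "(\<Sum>k\<le>?N. complex_of_real (c k) *s (cmat (matrix_pow A k) *v w)) $ i
          = (cmat (\<Sum>k\<le>?N. c k *\<^sub>R matrix_pow A k) *v w) $ i" .
    qed
    also have "\<dots> = 0"
      unfolding c(3) by (simp add: vec_eq_iff matrix_vector_mult_def cmat_nth)
    finally show ?thesis .
  qed
  then have "\<exists>zs. (\<forall>z\<in>set zs. \<exists>w. w \<noteq> 0 \<and> cmat A *v w = z *s w) \<and>
      (\<forall>w\<in>UNIV. foldr (shift (cmat A)) zs w = 0)"
    by (intro shift_eigenfactors[OF \<open>q \<noteq> 0\<close>])
  then show ?thesis
    using that by (auto simp: is_eigenvalue_def Bex_def eigenspace_iff conj_commute)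
qed

lemma linear_shift: "linear (shift M z)"
  by (intro linearI) (simp_all add: shift_def vec.add vec.scale_right_distrib vec_eq_iff
      matrix_vector_mult_def sum_distrib_left sum.distrib algebra_simps
      scaleR_conv_of_real[where 'a = complex])

lemma linear_foldr_shift: "linear (foldr (shift M) zs)"
proof (induction zs)
  case (Cons z zs)
  then show ?case
    using linear_compose[OF Cons linear_shift] by (simp add: o_def)
qed (simp add: linear_iff)

lemma foldr_shift_commute: "foldr (shift M) zs (M *v w) = M *v foldr (shift M) zs w"
  by (induction zs) (simp_all add: shift_def vec.scale vec.diff)

section \<open>Decay of solutions of stable linear systems\<close>

text \<open>Rotating by \<open>cis (- (Im z * t))\<close> removes the imaginary part of
  \<open>z\<close> and preserves moduli. Each component becomes a relaxation with rate
  \<open>- Re z\<close>.\<close>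

lemma stable_mode_tendsto_0:
  fixes V g :: "real \<Rightarrow> complex ^ 'n::finite"
  assumes V: "solves_off C V (\<lambda>t. z *s V t + g t)" and C: "locally_finite_times C"
    and z: "Re z < 0" and g: "(g \<longlongrightarrow> 0) at_top"
  shows "(V \<longlongrightarrow> 0) at_top"
proof (rule vec_tendstoI)
  fix i
  define y where "y t = cis (- (Im z * t)) * V t $ i" for t
  \<comment> \<open>Division by the rate puts the forcing into the form \<open>- l (y - h)\<close>
    expected of a relaxation.\<close>
  define h where "h t = cis (- (Im z * t)) * g t $ i / of_real (- Re z)" for t
  have "((\<lambda>t. cis (- (Im z * t)) * g t $ i) \<longlongrightarrow> 0) at_top"
    using tendsto_norm_zero[OF tendsto_vec_nth[OF g, of i, simplified]]
    by - (rule tendsto_norm_zero_cancel, simp add: norm_mult)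
  from tendsto_divide[OF this tendsto_const, of "of_real (- Re z)"]
  have h: "(h \<longlongrightarrow> 0) at_top"
    using z unfolding h_def by simp
  have "solves_off C y (\<lambda>t. - (- Re z) *\<^sub>R (y t - h t))"
    unfolding solves_off_def
  proof (intro conjI allI impI)
    show "continuous_on {0..} y"
      unfolding y_def
      by (intro continuous_intros bounded_linear.continuous_on[OF bounded_linear_vec_nth]
          solves_off_continuous[OF V])
    fix t :: real assume t: "t > 0" "t \<notin> C"
    have "((\<lambda>t. exp (t *\<^sub>R (- \<i> * Im z))) has_vector_derivative
        exp (t *\<^sub>R (- \<i> * Im z)) * (- \<i> * Im z)) (at t)"
      by (rule exp_scaleR_has_vector_derivative_right)
    moreover have "exp (t *\<^sub>R (- \<i> * Im z)) = cis (- (Im z * t))" for t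
      by (simp add: cis_conv_exp scaleR_conv_of_real mult_ac)
    ultimately have "((\<lambda>t. cis (- (Im z * t))) has_vector_derivative
        cis (- (Im z * t)) * (- \<i> * Im z)) (at t)"
      by simp
    from has_vector_derivative_mult[OF this bounded_linear.has_vector_derivative[OF
          bounded_linear_vec_nth solves_off_derivative[OF V t], of i]]
    have "(y has_vector_derivative cis (- (Im z * t)) * (z *s V t + g t) $ i
        + cis (- (Im z * t)) * (- \<i> * Im z) * V t $ i) (at t)"
      by (simp add: y_def[abs_def])
    also have "cis (- (Im z * t)) * (z *s V t + g t) $ i + cis (- (Im z * t)) * (- \<i> * Im z) * V t $ i
        = (z - \<i> * Im z) * y t + cis (- (Im z * t)) * g t $ i"
      by (simp add: y_def algebra_simps)
    also have "z - \<i> * Im z = of_real (Re z)"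
      by (simp add: complex_eq_iff)
    also have "of_real (Re z) * y t + cis (- (Im z * t)) * g t $ i = - (- Re z) *\<^sub>R (y t - h t)"
      using z by (simp add: h_def scaleR_conv_of_real field_simps)
    finally show "(y has_vector_derivative - (- Re z) *\<^sub>R (y t - h t)) (at t)" .
  qed
  from relaxation_tendsto_0[OF this C _ h] z have "(y \<longlongrightarrow> 0) at_top"
    by simp
  from tendsto_norm_zero[OF this] show "((\<lambda>t. V t $ i) \<longlongrightarrow> 0 $ i) at_top"
    unfolding y_def by (simp add: norm_mult tendsto_norm_zero_iff)
qed

text \<open>The product over \<open>zs\<close> applied to \<open>U\<close> satisfies a scalar mode
  equation with eigenvalue \<open>z\<close>, forced by the product over \<open>z # zs\<close>. Decay
  thus passes from the longer product to the shorter one, down to \<open>U\<close> itself.\<close>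

lemma eigenfactor_cascade_tendsto_0:
  fixes U :: "real \<Rightarrow> complex ^ 'n::finite"
  assumes U: "solves_off C U (\<lambda>t. M *v U t)" and C: "locally_finite_times C"
    and "\<And>z. z \<in> set zs \<Longrightarrow> Re z < 0" "((\<lambda>t. foldr (shift M) zs (U t)) \<longlongrightarrow> 0) at_top"
  shows "(U \<longlongrightarrow> 0) at_top"
  using assms(3,4)
proof (induction zs)
  case (Cons z zs)
  let ?V = "\<lambda>t. foldr (shift M) zs (U t)"
  have "solves_off C ?V (\<lambda>t. foldr (shift M) zs (M *v U t))"
    using linear_foldr_shift[of M zs]
    by (intro solves_off_linear[OF U]) (simp add: linear_conv_bounded_linear)
  then have "solves_off C ?V (\<lambda>t. z *s ?V t + shift M z (?V t))"
    by (rule solves_off_cong) (simp add: foldr_shift_commute shift_def)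
  from stable_mode_tendsto_0[OF this C] Cons show ?case
    by simp
qed simp

lemma stable_solution_tendsto_0:
  assumes x: "solves_off C x (\<lambda>t. A *v x t)" and C: "locally_finite_times C"
    and A: "stable_matrix A"
  shows "(x \<longlongrightarrow> 0) at_top"
proof -
  obtain zs where zs: "\<And>z. z \<in> set zs \<Longrightarrow> is_eigenvalue A z"
    "\<And>w. foldr (shift (cmat A)) zs w = 0"
    using eigenfactors_annihilate by blast
  have "solves_off C (\<lambda>t. cvec (x t)) (\<lambda>t. cmat A *v cvec (x t))"
    using solves_off_linear[OF x bounded_linear_cvec] by (simp add: cmat_mult_cvec)
  then have "((\<lambda>t. cvec (x t)) \<longlongrightarrow> 0) at_top"
    by (rule eigenfactor_cascade_tendsto_0[OF _ C, where zs = zs])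
      (use zs A in \<open>auto simp: stable_matrix_def\<close>)
  from tendsto_norm_zero[OF this] show ?thesis
    by - (rule tendsto_norm_zero_cancel, simp add: norm_cvec)
qed

subsection \<open>Semisimple spectrum on the imaginary axis\<close>

lemma poly_det:
  fixes M :: "'a::comm_ring_1 poly ^ 'n ^ 'n::finite"
  shows "poly (det M) z = det (\<chi> i j. poly (M $ i $ j) z)"
proof -
  have "poly (of_int k) z = (of_int k :: 'a)" for k
    by (simp add: of_int_poly)
  then show ?thesis
    by (simp add: det_def poly_sum poly_prod)
qed

lemma poly_charpoly: "poly (charpoly A) z = det (mat z - cmat A)"
  unfolding charpoly_def poly_det
  by (rule arg_cong[where f = det]) (simp add: vec_eq_iff mat_def map_matrix_def cmat_nth)

lemma charpoly_root_eigenvalue: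
  assumes "poly (charpoly A) z = 0"
  shows "is_eigenvalue A z"
proof -
  have "\<not> invertible (mat z - cmat A)"
    using assms by (simp add: poly_charpoly invertible_det_nz)
  then obtain w where w: "w \<noteq> 0" "(mat z - cmat A) *v w = 0"
    by (metis invertible_left_inverse matrix_left_invertible_ker)
  have "mat z *v w = z *s w"
    by (simp add: vec_eq_iff matrix_vector_mult_def mat_def if_distrib[where f = "\<lambda>x. x * _"] cong: if_cong)
  then have "cmat A *v w = z *s w"
    using w(2) by (simp add: vec_eq_iff matrix_vector_mult_def left_diff_distrib sum_subtractf)
  then show ?thesis
    using w(1) by (auto simp: is_eigenvalue_def eigenspace_iff)
qed

text \<open>In the Leibniz expansion a permutation other than the identity meets an off-diagonal
  entry, which is constant, so its term has degree below \<open>CARD('n)\<close>; the diagonal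
  product is monic.\<close>

lemma coeff_charpoly_top:
  fixes A :: "real ^ 'n ^ 'n::finite"
  shows "coeff (charpoly A) CARD('n) = 1"
proof -
  define N where "N = mat [:0, 1:] - map_matrix (\<lambda>a. [:complex_of_real a:]) A"
  have M: "N $ i $ j = (if i = j then [:- complex_of_real (A $ i $ i), 1:] else [:- complex_of_real (A $ i $ j):])"
    for i j
    by (simp add: N_def mat_def map_matrix_def)
  have c: "coeff (of_int (sign p) * (\<Prod>i\<in>UNIV. N $ i $ p i)) CARD('n) = of_bool (p = id)"
    if p: "p permutes UNIV" for p
  proof (cases "p = id")
    case True
    have "(\<Prod>i\<in>UNIV. N $ i $ p i) = (\<Prod>i\<in>UNIV. [:- complex_of_real (A $ i $ i), 1:])"
      by (intro prod.cong) (simp_all only: M True id_apply simp_thms if_True)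
    moreover have "degree (\<Prod>i\<in>(UNIV :: 'n set). [:- complex_of_real (A $ i $ i), 1:]) = CARD('n)"
      by (subst degree_prod_sum_eq) auto
    moreover have "lead_coeff (\<Prod>i\<in>(UNIV :: 'n set). [:- complex_of_real (A $ i $ i), 1:]) = 1"
      by (simp add: lead_coeff_prod)
    ultimately show ?thesis
      using True by (simp add: sign_id)
  next
    case False
    then obtain k where k: "p k \<noteq> k"
      by (auto simp: fun_eq_iff)
    have "degree (\<Prod>i\<in>UNIV. N $ i $ p i) \<le> (\<Sum>i\<in>UNIV. degree (N $ i $ p i))"
      using degree_prod_sum_le[of UNIV "\<lambda>i. N $ i $ p i"] by (simp only: o_def finite)
    also have "\<dots> < (\<Sum>i\<in>(UNIV :: 'n set). 1)"
      by (rule sum_strict_mono_ex1) (use k in \<open>auto simp: M intro!: exI[of _ k]\<close>)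
    finally have "degree (\<Prod>i\<in>UNIV. N $ i $ p i) < CARD('n)"
      by simp
    then have "coeff (\<Prod>i\<in>UNIV. N $ i $ p i) CARD('n) = 0"
      by (rule coeff_eq_0)
    moreover have "of_int (sign p) * q = smult (of_int (sign p)) q" for q :: "complex poly"
      by (simp add: of_int_poly)
    ultimately show ?thesis
      using False by simp
  qed
  have "coeff (charpoly A) CARD('n) = (\<Sum>p | p permutes (UNIV :: 'n set). of_bool (p = id))"
    unfolding charpoly_def N_def[symmetric] det_def coeff_sum using c by (intro sum.cong) auto
  also have "\<dots> = 1"
    by (simp add: of_bool_def permutes_id finite_permutations sum.delta)
  finally show ?thesis .
qed

lemma eigenspace_subspace: "vec.subspace (eigenspace A z)"
  by (auto simp: vec.subspace_def eigenspace_iff vec.add vec.scale vec.scale_right_distrib mult.commute)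

text \<open>Applying \<open>A - a\<close> to the sum kills the term of \<open>a\<close> and
  multiplies every other term by the nonzero number \<open>z - a\<close>. The terms
  \<open>f z\<close> may be zero, so the statement expresses that the sum of eigenspaces is
  direct.\<close>

lemma eigenvectors_independent:
  assumes "finite Z" "\<And>z. z \<in> Z \<Longrightarrow> f z \<in> eigenspace A z" "(\<Sum>z\<in>Z. f z) = 0"
  shows "\<forall>z\<in>Z. f z = 0"
  using assms
proof (induction Z arbitrary: f)
  case (insert a Z)
  have "(\<Sum>z\<in>Z. (z - a) *s f z) = (\<Sum>z\<in>insert a Z. (z - a) *s f z)"
    using insert(1,2) by simp
  also have "\<dots> = (\<Sum>z\<in>insert a Z. cmat A *v f z - a *s f z)"
    using insert(4) by (intro sum.cong) (auto simp: eigenspace_iff vector_sub_rdistrib)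
  also have "\<dots> = cmat A *v (\<Sum>z\<in>insert a Z. f z) - a *s (\<Sum>z\<in>insert a Z. f z)"
    by (simp only: sum_subtractf vec.sum vec.scale_sum_right)
  also have "\<dots> = 0"
    unfolding insert(5) by simp
  finally have "\<forall>z\<in>Z. (z - a) *s f z = 0"
    using vec.subspace_scale[OF eigenspace_subspace insert(4)] by (intro insert(3)) blast+
  then have "\<forall>z\<in>Z. f z = 0"
    using insert(2) by auto
  with insert show ?case
    by simp
qed simp

lemma span_eigenspaces_decompose:
  assumes "finite Z" "w \<in> vec.span (\<Union>z\<in>Z. eigenspace A z)"
  obtains f where "\<And>z. z \<in> Z \<Longrightarrow> f z \<in> eigenspace A z" "w = (\<Sum>z\<in>Z. f z)"
proof -
  have "\<exists>f. (\<forall>z\<in>Z. f z \<in> eigenspace A z) \<and> w = (\<Sum>z\<in>Z. f z)"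
    using assms
  proof (induction Z arbitrary: w)
    case (insert a Z)
    then obtain x y where xy: "w = x + y" "x \<in> eigenspace A a" "y \<in> vec.span (\<Union>z\<in>Z. eigenspace A z)"
      using vec.span_eq_iff[THEN iffD2, OF eigenspace_subspace, of A a]
      by (auto simp: vec.span_Un)
    then obtain f where "\<forall>z\<in>Z. f z \<in> eigenspace A z" "y = (\<Sum>z\<in>Z. f z)"
      using insert(3) by blast
    moreover have "(\<Sum>z\<in>Z. f z) = (\<Sum>z\<in>Z. (f(a := x)) z)"
      using insert(2) by (intro sum.cong) auto
    ultimately show ?case
      using xy insert(1,2) by (intro exI[of _ "f(a := x)"]) auto
  qed auto
  then show ?thesis
    using that by blast
qed

lemma dim_span_eigenspaces:
  assumes "finite Z"
  shows "vec.dim (vec.span (\<Union>z\<in>Z. eigenspace A z)) = (\<Sum>z\<in>Z. vec.dim (eigenspace A z))"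
  using assms
proof (induction Z)
  case (insert a Z)
  let ?U = "vec.span (\<Union>z\<in>Z. eigenspace A z)"
  have "w = 0" if w: "w \<in> eigenspace A a" "w \<in> ?U" for w
  proof -
    obtain f where f: "\<And>z. z \<in> Z \<Longrightarrow> f z \<in> eigenspace A z" "w = (\<Sum>z\<in>Z. f z)"
      using span_eigenspaces_decompose[OF insert(1) w(2)] by metis
    \<comment> \<open>Placing \<open>- w\<close> at \<open>a\<close> makes the decomposition of
      \<open>w\<close> into a vanishing sum of eigenvectors, so directness forces
      \<open>w = 0\<close>.\<close>
    have "\<forall>z\<in>insert a Z. (f(a := - w)) z = 0"
    proof (rule eigenvectors_independent)
      have "(\<Sum>z\<in>Z. (f(a := - w)) z) = (\<Sum>z\<in>Z. f z)"
        using insert(2) by (intro sum.cong) auto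
      then show "(\<Sum>z\<in>insert a Z. (f(a := - w)) z) = 0"
        using insert(1,2) f(2) by simp
    qed (use insert f w in \<open>auto intro: vec.subspace_neg[OF eigenspace_subspace]\<close>)
    then show ?thesis
      by simp
  qed
  then have "eigenspace A a \<inter> ?U = {0}"
    using vec.subspace_0[OF eigenspace_subspace] vec.span_zero by auto
  then have "eigenspace A a \<inter> ?U \<subseteq> {0}"
    by simp
  then have dim0: "vec.dim (eigenspace A a \<inter> ?U) = 0"
    by (simp only: vec.dim_eq_0)
  have span: "vec.span (\<Union>z\<in>insert a Z. eigenspace A z) = {x + y |x y. x \<in> eigenspace A a \<and> y \<in> ?U}"
    by (simp only: UN_insert vec.span_Un vec.span_eq_iff[THEN iffD2, OF eigenspace_subspace])
  have "vec.dim {x + y |x y. x \<in> eigenspace A a \<and> y \<in> ?U} + vec.dim (eigenspace A a \<inter> ?U)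
      = vec.dim (eigenspace A a) + vec.dim ?U"
    by (rule vec.dim_sums_Int[OF eigenspace_subspace vec.subspace_span])
  then show ?case
    unfolding span sum.insert[OF insert(1,2)] using dim0 insert(3) by linarith
qed simp

text \<open>Over the complex numbers the orders of the roots add up to the degree, which is at least
  \<open>CARD('n)\<close>. By semisimplicity they are the dimensions of the eigenspaces, whose sum
  is direct and hence fills the space.\<close>

lemma semisimple_eigenvectors_span:
  fixes A :: "real ^ 'n ^ 'n::finite"
  assumes ss: "\<And>z. is_eigenvalue A z \<Longrightarrow> semisimple_eigenvalue A z"
  obtains Z where "finite Z" "\<And>z. z \<in> Z \<Longrightarrow> is_eigenvalue A z"
    "vec.span (\<Union>z\<in>Z. eigenspace A z) = UNIV"
proof
  let ?p = "charpoly A"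
  let ?Z = "{z. poly ?p z = 0}"
  have p0: "?p \<noteq> 0"
    using coeff_charpoly_top[of A] by auto
  then show Z: "finite ?Z"
    by (rule poly_roots_finite)
  show ev: "is_eigenvalue A z" if "z \<in> ?Z" for z
    using that charpoly_root_eigenvalue by simp
  have "CARD('n) \<le> degree ?p"
    using coeff_charpoly_top[of A] by (intro le_degree) simp
  also have "degree ?p = (\<Sum>z\<in>?Z. order z ?p)"
    using p0 by (simp add: size_multiset_overloaded_eq flip: size_proots_complex)
  also have "\<dots> = (\<Sum>z\<in>?Z. vec.dim (eigenspace A z))"
    using ss ev by (intro sum.cong) (auto simp: semisimple_eigenvalue_def)
  also have "\<dots> = vec.dim (vec.span (\<Union>z\<in>?Z. eigenspace A z))"
    by (rule dim_span_eigenspaces[OF Z, symmetric])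
  finally have "vec.dim (\<Union>z\<in>?Z. eigenspace A z) = CARD('n)"
    using dim_subset_UNIV_cart_gen[of "\<Union>z\<in>?Z. eigenspace A z"] by simp
  then show "vec.span (\<Union>z\<in>?Z. eigenspace A z) = UNIV"
    by (metis vec.dim_eq_full vec.span_UNIV vec_dim_card)
qed

text \<open>Expand \<open>cvec v\<close> in eigenvectors and let each evolve by its scalar factor
  \<open>exp (t *\<^sub>R z)\<close>, of modulus 1 for all real \<open>t\<close>. The real part of
  the sum solves the equation with initial value \<open>v\<close>, so it is the exponential
  flow.\<close>

lemma matrix_exp_bounded_vector:
  fixes A :: "real ^ 'n ^ 'n::finite"
  assumes "\<And>z. is_eigenvalue A z \<Longrightarrow> Re z = 0 \<and> semisimple_eigenvalue A z"
  shows "\<exists>B. \<forall>t. norm (matrix_exp (t *\<^sub>R A) *v v) \<le> B"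
proof -
  obtain Z where Z: "finite Z" "\<And>z. z \<in> Z \<Longrightarrow> is_eigenvalue A z"
    "vec.span (\<Union>z\<in>Z. eigenspace A z) = UNIV"
    using semisimple_eigenvectors_span assms by metis
  obtain f where f: "\<And>z. z \<in> Z \<Longrightarrow> f z \<in> eigenspace A z" "cvec v = (\<Sum>z\<in>Z. f z)"
    using span_eigenspaces_decompose[OF Z(1), of "cvec v" A] Z(3) by auto
  define G where "G t = (\<Sum>z\<in>Z. exp (t *\<^sub>R z) *s f z)" for t :: real
  define g where "g t = (\<chi> i. Re (G t $ i))" for t
  have "((\<lambda>t. G t $ i) has_vector_derivative (cmat A *v G t) $ i) (at t)" for t i
  proof -
    have "((\<lambda>t. \<Sum>z\<in>Z. exp (t *\<^sub>R z) * f z $ i) has_vector_derivative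
        (\<Sum>z\<in>Z. exp (t *\<^sub>R z) * z * f z $ i)) (at t)"
      by (intro has_vector_derivative_sum has_vector_derivative_mult_left
          exp_scaleR_has_vector_derivative_right)
    moreover have "(cmat A *v G t) $ i = (\<Sum>z\<in>Z. exp (t *\<^sub>R z) * z * f z $ i)"
    proof -
      have "cmat A *v G t = (\<Sum>z\<in>Z. exp (t *\<^sub>R z) *s (cmat A *v f z))"
        by (simp add: G_def vec.sum vec.scale)
      also have "\<dots> = (\<Sum>z\<in>Z. exp (t *\<^sub>R z) *s (z *s f z))"
        using f(1) by (intro sum.cong) (auto simp: eigenspace_iff)
      finally show ?thesis
        by (simp add: mult.assoc)
    qed
    ultimately show ?thesis
      by (simp add: G_def)
  qed
  then have "((\<lambda>t. Re (G t $ i)) has_vector_derivative Re ((cmat A *v G t) $ i)) (at t)" for t i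
    by (rule bounded_linear.has_vector_derivative[OF bounded_linear_Re])
  then have "(g has_vector_derivative A *v g t) (at t)" for t
    by (intro has_vector_derivative_vec_lambda)
      (simp add: g_def matrix_vector_mult_def cmat_nth)
  then have "g t = matrix_exp (t *\<^sub>R A) *v g 0" for t
    by (rule linear_ode_solution)
  moreover have "g 0 = v"
    by (simp add: g_def G_def vec_eq_iff f(2)[symmetric] cvec_def)
  moreover have "norm (g t) \<le> (\<Sum>i\<in>UNIV. \<Sum>z\<in>Z. norm (f z $ i))" for t
  proof -
    have "norm (g t) \<le> (\<Sum>i\<in>UNIV. norm (g t $ i))"
      using norm_le_l1_cart[of "g t"] by simp
    also have "\<dots> \<le> (\<Sum>i\<in>UNIV. \<Sum>z\<in>Z. norm (f z $ i))"
    proof (rule sum_mono)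
      fix i
      have "norm (g t $ i) \<le> norm (G t $ i)"
        by (simp add: g_def abs_Re_le_cmod)
      also have "\<dots> \<le> (\<Sum>z\<in>Z. norm (f z $ i))"
        unfolding G_def sum_component
        by (rule sum_norm_le) (use assms Z(2) in \<open>auto simp: norm_mult norm_exp_eq_Re\<close>)
      finally show "norm (g t $ i) \<le> (\<Sum>z\<in>Z. norm (f z $ i))" .
    qed
    finally show ?thesis .
  qed
  ultimately have "norm (matrix_exp (t *\<^sub>R A) *v v) \<le> (\<Sum>i\<in>UNIV. \<Sum>z\<in>Z. norm (f z $ i))" for t
    by metis
  then show ?thesis
    by blast
qed

lemma matrix_exp_bounded:
  fixes A :: "real ^ 'n ^ 'n::finite"
  assumes "\<And>z. is_eigenvalue A z \<Longrightarrow> Re z = 0 \<and> semisimple_eigenvalue A z"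
  obtains B where "B > 0" "\<And>t v. norm (matrix_exp (t *\<^sub>R A) *v v) \<le> B * norm v"
proof -
  have "\<forall>i. \<exists>B. \<forall>t. norm (matrix_exp (t *\<^sub>R A) *v axis i 1) \<le> B"
    by (intro allI matrix_exp_bounded_vector assms)
  then obtain B where B: "\<And>i t. norm (matrix_exp (t *\<^sub>R A) *v axis i 1) \<le> B i"
    by metis
  have "norm (matrix_exp (t *\<^sub>R A) *v v) \<le> (1 + (\<Sum>i\<in>UNIV. B i)) * norm v" for t v
  proof -
    \<comment> \<open>Expansion in the standard basis turns the bounds for the finitely many columns
      into one constant; the added 1 makes it positive.\<close>
    have "matrix_exp (t *\<^sub>R A) *v v = (\<Sum>i\<in>UNIV. v $ i *\<^sub>R (matrix_exp (t *\<^sub>R A) *v axis i 1))"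
      unfolding scalar_mult_eq_scaleR[symmetric] vec.scale[symmetric] vec.sum[symmetric]
      by (simp only: basis_expansion)
    also have "norm \<dots> \<le> (\<Sum>i\<in>UNIV. B i * norm v)"
    proof (rule sum_norm_le)
      fix i
      have "\<bar>v $ i\<bar> * norm (matrix_exp (t *\<^sub>R A) *v axis i 1) \<le> norm v * B i"
        using order_trans[OF norm_ge_zero B] by (intro mult_mono component_le_norm_cart B) auto
      then show "norm (v $ i *\<^sub>R (matrix_exp (t *\<^sub>R A) *v axis i 1)) \<le> B i * norm v"
        by (simp add: mult.commute)
    qed
    also have "\<dots> = (\<Sum>i\<in>UNIV. B i) * norm v"
      by (rule sum_distrib_right[symmetric])
    also have "\<dots> \<le> (1 + (\<Sum>i\<in>UNIV. B i)) * norm v"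
      by (simp add: distrib_right)
    finally show ?thesis .
  qed
  moreover have "(\<Sum>i\<in>UNIV. B i) \<ge> 0"
    using order_trans[OF norm_ge_zero B] by (intro sum_nonneg) auto
  ultimately show ?thesis
    using that[of "1 + (\<Sum>i\<in>UNIV. B i)"] by simp
qed

subsection \<open>The leader-follower graph\<close>

lemma sum_UNIV_Plus:
  "(\<Sum>j\<in>(UNIV :: ('f::finite + 'l::finite) set). g j) = (\<Sum>j\<in>UNIV. g (Inl j)) + (\<Sum>l\<in>UNIV. g (Inr l))"
  unfolding UNIV_Plus_UNIV[symmetric] by (simp add: sum.Plus del: UNIV_Plus_UNIV)

text \<open>The coefficients \<open>a_ij / \<kappa>_i\<close> of the averages in \<open>psi\<close>.
  In the row of a leader of a \<open>leader_follower_graph\<close> both numerator and denominator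
  vanish, and the value is 0.\<close>

definition in_weight :: "real ^ 'n ^ 'n::finite \<Rightarrow> 'n \<Rightarrow> 'n \<Rightarrow> real" where
  "in_weight A i j = A $ i $ j / (\<Sum>k\<in>UNIV. A $ i $ k)"

context
  fixes E :: "('f::finite + 'l::finite) rel" and A :: "real ^ ('f + 'l) ^ ('f + 'l)"
  assumes graph: "leader_follower_graph E A"
begin

lemma adjacency_nonneg: "A $ i $ j \<ge> 0"
  using graph unfolding leader_follower_graph_def weighted_digraph_def by (metis less_eq_real_def)

lemma adjacency_edge: "A $ i $ j \<noteq> 0 \<longleftrightarrow> (j, i) \<in> E"
  using graph unfolding leader_follower_graph_def weighted_digraph_def by (metis less_irrefl)

lemma in_degree_pos: "(\<Sum>k\<in>UNIV. A $ Inl i $ k) > 0"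
proof -
  obtain j where "(j, Inl i) \<in> E"
    using graph unfolding leader_follower_graph_def by blast
  then have "A $ Inl i $ j > 0"
    using adjacency_edge[of "Inl i" j] adjacency_nonneg[of "Inl i" j] by simp
  then show ?thesis
    using adjacency_nonneg by (intro sum_pos2[of _ j]) auto
qed

lemma in_weight_nonneg: "in_weight A i j \<ge> 0"
  unfolding in_weight_def using adjacency_nonneg by (intro divide_nonneg_nonneg sum_nonneg) auto

lemma in_weight_edge: "in_weight A (Inl i) j \<noteq> 0 \<longleftrightarrow> (j, Inl i) \<in> E"
  using adjacency_edge in_degree_pos[of i] by (simp add: in_weight_def)

lemma in_weight_sum: "(\<Sum>j\<in>UNIV. in_weight A (Inl i) j) = 1"
  using in_degree_pos[of i] by (simp add: in_weight_def flip: sum_divide_distrib)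

text \<open>With \<open>h j\<close> the distance of \<open>j\<close> from the leaders and \<open>\<epsilon>\<close> below every positive weight, the
  weighting \<open>1 - \<epsilon> ^ h j\<close> is contracted: some in-neighbour is strictly closer to the leaders, and
  its share in the average of \<open>\<epsilon> ^ h\<close> already exceeds \<open>\<epsilon> ^ h i\<close>.\<close>

lemma contraction_weights:
  assumes reachable: "\<And>i. \<exists>j. (Inr j, Inl i) \<in> E\<^sup>+"
  obtains \<theta> :: "'f \<Rightarrow> real" and \<rho> where "\<And>i. \<theta> i > 0" "\<rho> < 1"
    "\<And>i. (\<Sum>j\<in>UNIV. in_weight A (Inl i) (Inl j) * \<theta> j) \<le> \<rho> * \<theta> i"
proof -
  define h where "h a = (LEAST n. \<exists>l. (Inr l :: 'f + 'l, a) \<in> E ^^ n)" for a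
  have "\<exists>n l. (Inr l, a) \<in> E ^^ n" for a
  proof (cases a)
    case (Inl i)
    then show ?thesis
      using reachable[of i] by (auto simp: trancl_power)
  next
    case (Inr l)
    then show ?thesis
      by (intro exI[of _ 0] exI[of _ l]) simp
  qed
  then have h: "\<exists>l. (Inr l, a) \<in> E ^^ h a" for a
    unfolding h_def by (rule LeastI_ex)
  have h_le: "h a \<le> n" if "(Inr l, a) \<in> E ^^ n" for a l n
    unfolding h_def using that by (intro Least_le) blast
  have h_leader: "h (Inr l) = 0" for l
    using h_le[of l "Inr l" 0] by simp
  have closer: "\<exists>j. (j, Inl i) \<in> E \<and> Suc (h j) \<le> h (Inl i)" for i
  proof -
    obtain l where l: "(Inr l, Inl i) \<in> E ^^ h (Inl i)"
      using h by blast
    then obtain n where n: "h (Inl i) = Suc n"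
      by (cases "h (Inl i)") auto
    with l obtain j where "(Inr l, j) \<in> E ^^ n" "(j, Inl i) \<in> E"
      by auto
    then show ?thesis
      using h_le n by fastforce
  qed
  \<comment> \<open>The inserted 1 gives \<open>w \<le> 1\<close>, so that
    \<open>\<epsilon> = w / 2\<close> lies strictly between 0 and 1.\<close>
  define w where "w = Min (insert 1 {in_weight A (Inl i) j | i j. in_weight A (Inl i) j \<noteq> 0})"
  have fin: "finite {in_weight A (Inl i) j | i j. in_weight A (Inl i) j \<noteq> 0}"
    by (rule finite_subset[of _ "range (\<lambda>(i, j). in_weight A (Inl i) j)"]) auto
  have "w \<in> insert 1 {in_weight A (Inl i) j | i j. in_weight A (Inl i) j \<noteq> 0}"
    unfolding w_def using fin by (intro Min_in) auto
  then have w0: "w > 0"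
    using in_weight_nonneg by (auto simp: less_le)
  have w1: "w \<le> 1"
    unfolding w_def using fin by (intro Min_le) auto
  have w_le: "w \<le> in_weight A (Inl i) j" if "in_weight A (Inl i) j \<noteq> 0" for i j
    unfolding w_def using fin that by (intro Min_le) auto
  define \<epsilon> where "\<epsilon> = w / 2"
  have \<epsilon>: "0 < \<epsilon>" "\<epsilon> < 1" "\<epsilon> < w"
    using w0 w1 by (auto simp: \<epsilon>_def)
  define \<theta> where "\<theta> i = 1 - \<epsilon> ^ h (Inl i)" for i :: 'f
  have pos: "\<theta> i > 0" for i
  proof -
    obtain j where "Suc (h j) \<le> h (Inl i)"
      using closer by blast
    then have "\<epsilon> ^ h (Inl i) < 1"
      using power_Suc_less_one[OF \<epsilon>(1,2)] by (cases "h (Inl i)") auto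
    then show ?thesis
      by (simp add: \<theta>_def)
  qed
  have less: "(\<Sum>j\<in>UNIV. in_weight A (Inl i) (Inl j) * \<theta> j) < \<theta> i" for i
  proof -
    obtain j where j: "(j, Inl i) \<in> E" "Suc (h j) \<le> h (Inl i)"
      using closer by blast
    have "\<epsilon> ^ h (Inl i) \<le> \<epsilon> ^ Suc (h j)"
      using \<epsilon> j(2) by (intro power_decreasing) auto
    also have "\<dots> < w * \<epsilon> ^ h j"
      using \<epsilon> by simp
    also have "\<dots> \<le> in_weight A (Inl i) j * \<epsilon> ^ h j"
      using w_le[of i j] in_weight_edge j(1) \<epsilon> by (intro mult_right_mono) auto
    also have "\<dots> \<le> (\<Sum>j\<in>UNIV. in_weight A (Inl i) j * \<epsilon> ^ h j)"
      using \<epsilon> in_weight_nonneg by (intro member_le_sum) auto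
    finally have "(\<Sum>j\<in>UNIV. in_weight A (Inl i) j * (1 - \<epsilon> ^ h j)) < \<theta> i"
      by (simp add: right_diff_distrib sum_subtractf in_weight_sum \<theta>_def)
    \<comment> \<open>Leaders have distance 0, so their terms \<open>1 - \<epsilon> ^ 0\<close>
      vanish and only followers remain in the sum.\<close>
    then show ?thesis
      by (simp add: sum_UNIV_Plus h_leader \<theta>_def)
  qed
  define \<rho> where "\<rho> = Max (range (\<lambda>i. (\<Sum>j\<in>UNIV. in_weight A (Inl i) (Inl j) * \<theta> j) / \<theta> i))"
  have "\<rho> \<in> range (\<lambda>i. (\<Sum>j\<in>UNIV. in_weight A (Inl i) (Inl j) * \<theta> j) / \<theta> i)"
    unfolding \<rho>_def by (rule Max_in) auto
  then have "\<rho> < 1"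
    using less pos by auto
  moreover have "(\<Sum>j\<in>UNIV. in_weight A (Inl i) (Inl j) * \<theta> j) \<le> \<rho> * \<theta> i" for i
  proof -
    have "(\<Sum>j\<in>UNIV. in_weight A (Inl i) (Inl j) * \<theta> j) / \<theta> i \<le> \<rho>"
      unfolding \<rho>_def by (rule Max_ge) auto
    then show ?thesis
      using pos[of i] by (simp add: field_simps)
  qed
  ultimately show ?thesis
    using that pos by blast
qed

section \<open>The follower block of the Laplacian and its inverse\<close>

text \<open>This form turns linear algebra with the Laplacian into averaging: the kernel of
  \<open>lap1 A\<close> consists of the fixed points of the follower averages.\<close>

lemma lap1_mult:
  "(lap1 A *v x) $ i = (\<Sum>k\<in>UNIV. A $ Inl i $ k) * (x $ i - (\<Sum>j\<in>UNIV. in_weight A (Inl i) (Inl j) * x $ j))"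
proof -
  have diag: "A $ Inl i $ Inl i = 0"
    using graph by (simp add: leader_follower_graph_def weighted_digraph_def)
  have "(lap1 A *v x) $ i
      = (\<Sum>j\<in>UNIV. (if i = j then (\<Sum>k\<in>UNIV. A $ Inl i $ k) * x $ j else 0) - A $ Inl i $ Inl j * x $ j)"
    unfolding matrix_vector_mult_def lap1_def laplacian_def vec_lambda_beta
    by (intro sum.cong) (auto simp: diag)
  also have "\<dots> = (\<Sum>k\<in>UNIV. A $ Inl i $ k) * x $ i - (\<Sum>j\<in>UNIV. A $ Inl i $ Inl j * x $ j)"
    by (simp add: sum_subtractf)
  also have "\<dots> = (\<Sum>k\<in>UNIV. A $ Inl i $ k) * (x $ i - (\<Sum>j\<in>UNIV. in_weight A (Inl i) (Inl j) * x $ j))"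
    using in_degree_pos[of i] by (simp add: in_weight_def right_diff_distrib sum_distrib_left)
  finally show ?thesis .
qed

text \<open>A kernel vector is fixed by the averages, which strictly contract the maximum norm
  weighted by \<open>\<theta>\<close>; hence its norm \<open>m\<close> is zero.\<close>

lemma invertible_lap1:
  assumes reachable: "\<And>i. \<exists>j. (Inr j, Inl i) \<in> E\<^sup>+"
  shows "invertible (lap1 A)"
proof -
  obtain \<theta> \<rho> where \<theta>: "\<And>i :: 'f. \<theta> i > 0" and \<rho>: "\<rho> < (1 :: real)"
    and c: "\<And>i. (\<Sum>j\<in>UNIV. in_weight A (Inl i) (Inl j) * \<theta> j) \<le> \<rho> * \<theta> i"
    using contraction_weights[OF reachable] by metis
  have "x = 0" if "lap1 A *v x = 0" for x
  proof -
    have x: "x $ i = (\<Sum>j\<in>UNIV. in_weight A (Inl i) (Inl j) * x $ j)" for i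
      using lap1_mult[of x i] in_degree_pos[of i] that by simp
    define m where "m = Max (range (\<lambda>i. \<bar>x $ i\<bar> / \<theta> i))"
    have m: "\<bar>x $ i\<bar> \<le> m * \<theta> i" for i
    proof -
      have "\<bar>x $ i\<bar> / \<theta> i \<le> m"
        unfolding m_def by (rule Max_ge) auto
      then show ?thesis
        using \<theta>[of i] by (simp add: field_simps)
    qed
    have "m \<in> range (\<lambda>i. \<bar>x $ i\<bar> / \<theta> i)"
      unfolding m_def by (rule Max_in) auto
    then obtain k where k: "m = \<bar>x $ k\<bar> / \<theta> k"
      by auto
    then have m0: "m \<ge> 0"
      using \<theta>[of k] by simp
    have "m * \<theta> k = \<bar>x $ k\<bar>"
      using k \<theta>[of k] by (simp add: field_simps)
    also have "\<dots> \<le> (\<Sum>j\<in>UNIV. \<bar>in_weight A (Inl k) (Inl j) * x $ j\<bar>)"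
      by (subst x) (rule sum_abs)
    also have "\<dots> \<le> (\<Sum>j\<in>UNIV. in_weight A (Inl k) (Inl j) * (m * \<theta> j))"
      using m in_weight_nonneg by (intro sum_mono) (auto simp: abs_mult intro!: mult_left_mono)
    also have "\<dots> = m * (\<Sum>j\<in>UNIV. in_weight A (Inl k) (Inl j) * \<theta> j)"
      by (simp add: sum_distrib_left mult_ac)
    also have "\<dots> \<le> m * (\<rho> * \<theta> k)"
      using m0 c by (intro mult_left_mono)
    finally have "(1 - \<rho>) * (m * \<theta> k) \<le> 0"
      by (simp add: algebra_simps)
    with \<rho> \<theta>[of k] m0 have "m = 0"
      by (simp add: mult_le_0_iff)
    with m show "x = 0"
      by (simp add: vec_eq_iff)
  qed
  then show ?thesis
    by (metis invertible_left_inverse matrix_left_invertible_ker)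
qed

text \<open>Each column of \<open>R\<close> solves
  \<open>lap1 A *v x = - (column of lap2 A)\<close>, which by \<open>lap1_mult\<close> is the
  averaging equation with boundary value 1 at leader \<open>l\<close> and 0 at the others:
  \<open>R\<close> is the matrix of harmonic extension.\<close>

lemma containment_weights:
  assumes reachable: "\<And>i. \<exists>j. (Inr j, Inl i) \<in> E\<^sup>+"
  defines "R \<equiv> - (matrix_inv (lap1 A) ** lap2 A)"
  shows "R $ i $ l = (\<Sum>j\<in>UNIV. in_weight A (Inl i) (Inl j) * R $ j $ l) + in_weight A (Inl i) (Inr l)"
proof -
  let ?x = "\<chi> j. R $ j $ l"
  have "lap1 A ** matrix_inv (lap1 A) = mat 1"
    using someI_ex[OF invertible_lap1[OF reachable, unfolded invertible_def]]
    by (simp add: matrix_inv_def)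
  then have "lap1 A ** (matrix_inv (lap1 A) ** lap2 A) = lap2 A"
    by (simp add: matrix_mul_assoc)
  then have "(lap1 A ** (matrix_inv (lap1 A) ** lap2 A)) $ i $ l = - A $ Inl i $ Inr l"
    by (simp add: lap2_def laplacian_def)
  then have "(lap1 A *v ?x) $ i = A $ Inl i $ Inr l"
    by (simp add: R_def matrix_vector_mult_def matrix_matrix_mult_def sum_negf)
  then show ?thesis
    using lap1_mult[of ?x i] in_degree_pos[of i] by (simp add: in_weight_def field_simps)
qed

end

text \<open>The Kronecker product with the identity mixes agents but not coordinates, so the sum
  over \<open>c'\<close> collapses to \<open>c\<close>.\<close>

lemma containment_error_component:
  fixes A :: "real ^ ('f::finite + 'l::finite) ^ ('f + 'l)" and x :: "'f + 'l \<Rightarrow> real \<Rightarrow> real ^ 'd::finite"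
  shows "containment_error A x t $ (i, c) =
    (x (Inl i) t - (\<Sum>l\<in>UNIV. (- (matrix_inv (lap1 A) ** lap2 A)) $ i $ l *\<^sub>R x (Inr l) t)) $ c"
proof -
  let ?M = "matrix_inv (lap1 A) ** lap2 A"
  have "(kronecker ?M (mat 1 :: real ^ 'd ^ 'd) *v stack (\<lambda>i. x (Inr i) t)) $ (i, c)
      = (\<Sum>(l, c')\<in>UNIV \<times> UNIV. ?M $ i $ l * (mat 1 :: real ^ 'd ^ 'd) $ c $ c' * x (Inr l) t $ c')"
    unfolding UNIV_Times_UNIV
    by (simp add: matrix_vector_mult_def kronecker_def stack_def split_beta)
  also have "\<dots> = (\<Sum>l\<in>UNIV. \<Sum>c'\<in>UNIV. ?M $ i $ l * (mat 1 :: real ^ 'd ^ 'd) $ c $ c' * x (Inr l) t $ c')"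
    by (rule sum.cartesian_product[symmetric])
  also have "\<dots> = (\<Sum>l\<in>UNIV. ?M $ i $ l * x (Inr l) t $ c)"
  proof (rule sum.cong)
    fix l
    have "(\<Sum>c'\<in>UNIV. ?M $ i $ l * (mat 1 :: real ^ 'd ^ 'd) $ c $ c' * x (Inr l) t $ c')
        = (\<Sum>c'\<in>UNIV. if c = c' then ?M $ i $ l * x (Inr l) t $ c' else 0)"
      by (intro sum.cong) (auto simp: mat_def)
    then show "(\<Sum>c'\<in>UNIV. ?M $ i $ l * (mat 1 :: real ^ 'd ^ 'd) $ c $ c' * x (Inr l) t $ c')
        = ?M $ i $ l * x (Inr l) t $ c"
      by simp
  qed simp
  finally show ?thesis
    by (simp add: containment_error_def stack_def sum_negf)
qed

lemma containment_error_tendsto_0: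
  fixes A :: "real ^ ('f::finite + 'l::finite) ^ ('f + 'l)" and x :: "'f + 'l \<Rightarrow> real \<Rightarrow> real ^ 'd::finite"
  assumes "\<And>i. ((\<lambda>t. x (Inl i) t - (\<Sum>l\<in>UNIV. (- (matrix_inv (lap1 A) ** lap2 A)) $ i $ l *\<^sub>R x (Inr l) t))
    \<longlongrightarrow> 0) at_top"
  shows "(containment_error A x \<longlongrightarrow> 0) at_top"
proof (rule vec_tendstoI)
  fix ic :: "'f \<times> 'd"
  obtain i c where ic: "ic = (i, c)"
    by (cases ic)
  show "((\<lambda>t. containment_error A x t $ ic) \<longlongrightarrow> 0 $ ic) at_top"
    unfolding ic containment_error_component using tendsto_vec_nth[OF assms[of i], of c] by simp
qed

subsection \<open>Delivery of the transmitted data\<close>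

text \<open>The only times at which \<open>delivered\<close> can change. A lost transmission
  contributes nothing, its arrival being infinite.\<close>

definition delivery_times :: "nat set \<Rightarrow> (nat \<Rightarrow> real) \<Rightarrow> (nat \<Rightarrow> ereal) \<Rightarrow> real set" where
  "delivery_times Kij tsij \<tau>ij = {t. \<exists>k\<in>Kij. ereal (tsij k) + \<tau>ij k = ereal t}"

context
  fixes Kij :: "nat set" and tsij :: "nat \<Rightarrow> real" and \<tau>ij :: "nat \<Rightarrow> ereal" and T :: real
  assumes T: "T > 0" and delays: "\<And>k. k \<in> Kij \<Longrightarrow> 0 \<le> \<tau>ij k"
    and sampling: "\<And>k. k \<in> Kij \<Longrightarrow> tsij k = real k * T"
begin

text \<open>Nonnegative delays turn a statement about arrival into a bound on the index. This makes
  \<open>delivered\<close> finite, hence its \<open>Max\<close> meaningful.\<close>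

lemma sent_before_delivery:
  assumes "k \<in> Kij" "ereal (tsij k) + \<tau>ij k \<le> ereal t"
  shows "real k * T \<le> t"
proof -
  have "ereal (tsij k) \<le> ereal (tsij k) + \<tau>ij k"
    using add_left_mono[OF delays[OF assms(1)], of "ereal (tsij k)"] by simp
  with assms(2) have "ereal (tsij k) \<le> ereal t"
    by (rule order_trans[rotated])
  with sampling[OF assms(1)] show ?thesis
    by simp
qed

lemma finite_samples: "finite {k. real k * T \<le> t}"
proof (rule finite_subset)
  show "{k. real k * T \<le> t} \<subseteq> {..nat \<lceil>t / T\<rceil>}"
  proof
    fix k assume "k \<in> {k. real k * T \<le> t}"
    then have "real k \<le> t / T"
      using T by (simp add: field_simps)
    then have "real k \<le> real (nat \<lceil>t / T\<rceil>)"
      using real_nat_ceiling_ge[of "t / T"] by (rule order_trans)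
    then show "k \<in> {..nat \<lceil>t / T\<rceil>}"
      by simp
  qed
qed simp

lemma finite_delivered: "finite (delivered Kij tsij \<tau>ij t)"
  by (rule finite_subset[OF _ finite_samples[of t]])
    (auto simp: delivered_def intro: sent_before_delivery)

lemma last_instant_range:
  assumes "t \<ge> 0"
  shows "last_instant Kij tsij \<tau>ij t \<in> {0..t}"
proof (cases "delivered Kij tsij \<tau>ij t = {}")
  case False
  then have "Max (delivered Kij tsij \<tau>ij t) \<in> delivered Kij tsij \<tau>ij t"
    by (intro Max_in finite_delivered)
  then show ?thesis
    using False sent_before_delivery T by (auto simp: last_instant_def delivered_def sampling)
qed (use assms in \<open>simp add: last_instant_def\<close>)

lemma locally_finite_delivery_times: "locally_finite_times (delivery_times Kij tsij \<tau>ij)"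
  unfolding locally_finite_times_def
proof
  fix t
  have "delivery_times Kij tsij \<tau>ij \<inter> {0..t}
      \<subseteq> (\<lambda>k. real_of_ereal (ereal (tsij k) + \<tau>ij k)) ` {k. real k * T \<le> t}"
  proof
    fix s assume "s \<in> delivery_times Kij tsij \<tau>ij \<inter> {0..t}"
    then obtain k where k: "k \<in> Kij" "ereal (tsij k) + \<tau>ij k = ereal s" "s \<le> t"
      by (auto simp: delivery_times_def)
    then have "real k * T \<le> s"
      by (intro sent_before_delivery) auto
    then have "k \<in> {k. real k * T \<le> t}"
      using k(3) by simp
    moreover have "s = real_of_ereal (ereal (tsij k) + \<tau>ij k)"
      unfolding k(2) by simp
    ultimately show "s \<in> (\<lambda>k. real_of_ereal (ereal (tsij k) + \<tau>ij k)) ` {k. real k * T \<le> t}"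
      by blast
  qed
  then show "finite (delivery_times Kij tsij \<tau>ij \<inter> {0..t})"
    using finite_samples finite_subset by blast
qed

text \<open>Each comparison of an arrival time with \<open>s\<close> is locally constant at
  \<open>t\<close> unless the arrival happens at \<open>t\<close>. Near \<open>t\<close> only
  finitely many transmissions can arrive, so the neighbourhoods can be intersected.\<close>

lemma last_instant_locally_constant:
  assumes "t \<notin> delivery_times Kij tsij \<tau>ij"
  shows "\<forall>\<^sub>F s in nhds t. last_instant Kij tsij \<tau>ij s = last_instant Kij tsij \<tau>ij t"
proof -
  have ereal_ev: "\<forall>\<^sub>F s in nhds t. (a \<le> ereal s) = (a \<le> ereal t)" if "a \<noteq> ereal t" for a
  proof (cases "a < ereal t")
    case True
    have "((\<lambda>s. ereal s) \<longlongrightarrow> ereal t) (nhds t)"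
      by (simp add: filterlim_ident)
    from order_tendstoD(1)[OF this True] show ?thesis
      by (rule eventually_mono) (use True in auto)
  next
    case False
    then have a: "ereal t < a"
      using that by auto
    have "((\<lambda>s. ereal s) \<longlongrightarrow> ereal t) (nhds t)"
      by (simp add: filterlim_ident)
    from order_tendstoD(2)[OF this a] show ?thesis
      by (rule eventually_mono) (use a in auto)
  qed
  \<comment> \<open>Transmissions sent after \<open>t + 1\<close> have arrived neither by
    \<open>t\<close> nor by any \<open>s < t + 1\<close>.\<close>
  let ?F = "{k \<in> Kij. real k * T \<le> t + 1}"
  have "finite ?F"
    by (rule finite_subset[OF _ finite_samples[of "t + 1"]]) auto
  then have "\<forall>\<^sub>F s in nhds t. \<forall>k\<in>?F. (ereal (tsij k) + \<tau>ij k \<le> ereal s) = (ereal (tsij k) + \<tau>ij k \<le> ereal t)"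
    by (rule eventually_ball_finite)
      (use assms in \<open>auto intro!: ereal_ev simp: delivery_times_def\<close>)
  moreover have "\<forall>\<^sub>F s in nhds t. s < t + 1"
    by (rule order_tendstoD(2)[OF filterlim_ident]) simp
  ultimately show ?thesis
  proof eventually_elim
    case (elim s)
    have "ereal (tsij k) + \<tau>ij k \<le> ereal s \<longleftrightarrow> ereal (tsij k) + \<tau>ij k \<le> ereal t" if "k \<in> Kij" for k
    proof (cases "real k * T \<le> t + 1")
      case False
      then show ?thesis
        using sent_before_delivery[OF that, of s] sent_before_delivery[OF that, of t] elim(2) by linarith
    qed (use elim(1) that in blast)
    then have "delivered Kij tsij \<tau>ij s = delivered Kij tsij \<tau>ij t"
      by (auto simp: delivered_def)
    then show ?case
      by (simp add: last_instant_def)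
  qed
qed

text \<open>The selected subsequence contains arbitrarily late transmissions that do arrive. Once
  one has arrived, the largest delivered index stays above its index, even if older data come in
  afterwards.\<close>

lemma last_instant_at_top:
  fixes \<kappa> :: "nat \<Rightarrow> nat"
  assumes \<kappa>: "strict_mono \<kappa>" "range \<kappa> \<subseteq> Kij"
    and blackout: "\<And>l. ereal (tsij (\<kappa> (Suc l))) + \<tau>ij (\<kappa> (Suc l)) - ereal (tsij (\<kappa> l)) \<le> ereal Ts"
  shows "filterlim (last_instant Kij tsij \<tau>ij) at_top at_top"
  unfolding filterlim_at_top
proof
  fix Z :: real
  define l where "l = nat \<lceil>Z / T\<rceil>"
  have "Z / T \<le> real l"
    unfolding l_def by (rule real_nat_ceiling_ge)
  then have Z: "Z \<le> real l * T"
    using T by (simp add: field_simps)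
  let ?k = "\<kappa> (Suc l)"
  have K: "?k \<in> Kij"
    using \<kappa>(2) by auto
  have "l \<le> ?k"
    using strict_mono_imp_increasing[OF \<kappa>(1), of "Suc l"] by simp
  \<comment> \<open>The upper bound also excludes an infinite delay, so the arrival of transmission
    \<open>\<kappa> (Suc l)\<close> is a real time.\<close>
  have arrive: "ereal (tsij ?k) + \<tau>ij ?k \<le> ereal (Ts + tsij (\<kappa> l))"
    using blackout[of l] by (cases "\<tau>ij ?k") auto
  show "\<forall>\<^sub>F t in at_top. Z \<le> last_instant Kij tsij \<tau>ij t"
    using eventually_ge_at_top[of "Ts + tsij (\<kappa> l)"]
  proof eventually_elim
    case (elim t)
    have k: "?k \<in> delivered Kij tsij \<tau>ij t"
      using K arrive elim order_trans[OF arrive, of "ereal t"] by (simp add: delivered_def)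
    then have ne: "delivered Kij tsij \<tau>ij t \<noteq> {}"
      by auto
    let ?m = "Max (delivered Kij tsij \<tau>ij t)"
    have "?k \<le> ?m"
      by (rule Max_ge[OF finite_delivered k])
    with \<open>l \<le> ?k\<close> have "real l * T \<le> real ?m * T"
      using T by (intro mult_right_mono) auto
    moreover have "?m \<in> Kij"
      using Max_in[OF finite_delivered ne] by (simp add: delivered_def)
    ultimately show ?case
      using Z ne sampling[of ?m] by (simp add: last_instant_def)
  qed
qed

end

subsection \<open>Uniform boundedness\<close>

lemma uniformly_bounded_iff: "uniformly_bounded x \<longleftrightarrow> (\<exists>B. \<forall>t\<ge>0. norm (x t) \<le> B)"
  unfolding uniformly_bounded_def bounded_iff by auto

lemma uniformly_bounded_cong:
  assumes "uniformly_bounded x" "\<And>t. t \<ge> 0 \<Longrightarrow> y t = x t"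
  shows "uniformly_bounded y"
  using assms unfolding uniformly_bounded_iff by metis

lemma uniformly_bounded_linear:
  assumes "uniformly_bounded x" "bounded_linear g"
  shows "uniformly_bounded (\<lambda>t. g (x t))"
  using bounded_linear_image[OF assms(1)[unfolded uniformly_bounded_def] assms(2)]
  by (simp add: uniformly_bounded_def image_image)

lemma uniformly_bounded_const: "uniformly_bounded (\<lambda>t. c)"
  by (auto simp: uniformly_bounded_iff)

lemma uniformly_bounded_add:
  assumes "uniformly_bounded x" "uniformly_bounded y"
  shows "uniformly_bounded (\<lambda>t. x t + y t)"
  using assms unfolding uniformly_bounded_iff
  by (metis (no_types, lifting) norm_triangle_mono)

lemma uniformly_bounded_minus:
  "uniformly_bounded x \<Longrightarrow> uniformly_bounded (\<lambda>t. - x t)"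
  by (simp add: uniformly_bounded_iff)

lemma uniformly_bounded_diff:
  assumes "uniformly_bounded x" "uniformly_bounded y"
  shows "uniformly_bounded (\<lambda>t. x t - y t)"
  using uniformly_bounded_add[OF assms(1) uniformly_bounded_minus[OF assms(2)]] by simp

lemma uniformly_bounded_scaleR: "uniformly_bounded x \<Longrightarrow> uniformly_bounded (\<lambda>t. c *\<^sub>R x t)"
  by (rule uniformly_bounded_linear[OF _ bounded_linear_scaleR_right])

lemma uniformly_bounded_matrix: "uniformly_bounded x \<Longrightarrow> uniformly_bounded (\<lambda>t. M *v x t)"
  for x :: "real \<Rightarrow> real ^ 'n::finite"
  by (rule uniformly_bounded_linear[OF _ matrix_vector_mul_bounded_linear])

lemma uniformly_bounded_sum:
  "(\<And>i. i \<in> I \<Longrightarrow> uniformly_bounded (x i)) \<Longrightarrow> uniformly_bounded (\<lambda>t. \<Sum>i\<in>I. x i t)"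
  by (induction I rule: infinite_finite_induct)
    (simp_all add: uniformly_bounded_const uniformly_bounded_add)

lemmas uniformly_bounded_intros = uniformly_bounded_const uniformly_bounded_add
  uniformly_bounded_minus uniformly_bounded_diff uniformly_bounded_scaleR uniformly_bounded_matrix
  uniformly_bounded_sum

subsection \<open>Containment in the coordinates of the free flow\<close>

text \<open>\<open>l1\<close> and \<open>l2\<close> are the negated roots, later the rates of the
  two relaxations. Real roots exclude a negative discriminant, and \<open>kp > 0\<close> puts
  \<open>sqrt D\<close> strictly below \<open>kd\<close>, so both rates are positive.\<close>

lemma real_roots_factor:
  fixes kp kd :: real
  assumes gains: "kp > 0" "kd > 0"
    and real_roots: "\<And>x::complex. x\<^sup>2 + of_real kd * x + of_real kp = 0 \<Longrightarrow> x \<in> \<real>"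
  obtains l1 l2 where "l1 > 0" "l2 > 0" "l1 + l2 = kd" "l1 * l2 = kp"
proof -
  define D where "D = kd\<^sup>2 - 4 * kp"
  have "D \<ge> 0"
  proof (rule ccontr)
    assume "\<not> D \<ge> 0"
    then have D: "D < 0"
      by simp
    \<comment> \<open>The root given by the quadratic formula, with nonzero imaginary part when
      \<open>D < 0\<close>.\<close>
    define x where "x = Complex (- kd / 2) (sqrt (- D) / 2)"
    have "(sqrt (- D))\<^sup>2 = - D"
      using D by simp
    then have "x\<^sup>2 + of_real kd * x + of_real kp = 0"
      by (simp add: x_def complex_eq_iff power2_eq_square D_def field_simps)
    then have "x \<in> \<real>"
      by (rule real_roots)
    then have "sqrt (- D) = 0"
      by (simp add: x_def complex_is_Real_iff)
    with D show False
      by simp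
  qed
  have "sqrt D < kd"
    using gains by (intro real_less_lsqrt) (auto simp: D_def)
  moreover have "sqrt D \<ge> 0"
    using \<open>D \<ge> 0\<close> by simp
  moreover have "(kd + sqrt D) / 2 * ((kd - sqrt D) / 2) = kp"
  proof -
    have "sqrt D * sqrt D = D"
      using \<open>D \<ge> 0\<close> by simp
    then show ?thesis
      by (simp add: D_def field_simps power2_eq_square)
  qed
  ultimately show ?thesis
    using gains by (intro that[of "(kd + sqrt D) / 2" "(kd - sqrt D) / 2"])
      (simp_all add: add_pos_nonneg flip: add_divide_distrib)
qed

lemma solves_off_free_flow:
  assumes "solves_off C x (\<lambda>t. S *v x t + g t)"
  shows "solves_off C (\<lambda>t. matrix_exp (- t *\<^sub>R S) *v x t) (\<lambda>t. matrix_exp (- t *\<^sub>R S) *v g t)"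
  unfolding solves_off_def
proof (intro conjI allI impI)
  have "continuous_on {0..} (\<lambda>t. matrix_exp (- t *\<^sub>R S))"
    using continuous_on_compose[of "{0..}" uminus, OF _ continuous_matrix_exp]
    by (simp add: o_def continuous_on_minus)
  then show "continuous_on {0..} (\<lambda>t. matrix_exp (- t *\<^sub>R S) *v x t)"
    by (rule bounded_bilinear.continuous_on[OF bounded_bilinear_matrix_vector_mult _
          solves_off_continuous[OF assms]])
  fix t :: real assume "t > 0" "t \<notin> C"
  from matrix_exp_mult_has_vector_derivative[OF solves_off_derivative[OF assms this], of S]
  show "((\<lambda>t. matrix_exp (- t *\<^sub>R S) *v x t) has_vector_derivative matrix_exp (- t *\<^sub>R S) *v g t) (at t)"
    by simp
qed

text \<open>The core common to both algorithms. Only the block form of the follower equations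
  enters, and everything specific to an algorithm is confined to the vanishing perturbation
  \<open>\<delta>\<close>.\<close>

lemma delayed_containment:
  fixes \<xi> :: "'f::finite + 'l::finite \<Rightarrow> real \<Rightarrow> real ^ 'm::finite" and S :: "real ^ 'm ^ 'm"
    and A :: "real ^ ('f + 'l) ^ ('f + 'l)" and r :: "'f + 'l \<Rightarrow> 'f + 'l \<Rightarrow> real \<Rightarrow> real"
  assumes graph: "leader_follower_graph E A"
    and reachable: "\<And>i. \<exists>j. (Inr j, Inl i) \<in> E\<^sup>+"
    and spectrum: "\<And>z. is_eigenvalue S z \<Longrightarrow> Re z = 0 \<and> semisimple_eigenvalue S z"
    and gains: "\<And>i. kp i > 0" "\<And>i. kd i > 0"
    and real_roots: "\<And>i (x::complex). x\<^sup>2 + of_real (kd i) * x + of_real (kp i) = 0 \<Longrightarrow> x \<in> \<real>"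
    and C: "locally_finite_times C"
    and r_range: "\<And>i j t. (j, i) \<in> E \<Longrightarrow> t \<ge> 0 \<Longrightarrow> r i j t \<in> {0..t}"
    and r_lim: "\<And>i j. (j, i) \<in> E \<Longrightarrow> filterlim (r i j) at_top at_top"
    and leader: "\<And>l. solves_off C (\<xi> (Inr l)) (\<lambda>t. S *v \<xi> (Inr l) t)"
    and follower: "\<And>i. solves_off C (\<xi> (Inl i)) (\<lambda>t. S *v \<xi> (Inl i) t + \<mu> i t)"
    and input: "\<And>i. solves_off C (\<mu> i)
      (\<lambda>t. S *v \<mu> i t + (- kd i *\<^sub>R \<mu> i t - kp i *\<^sub>R (\<xi> (Inl i) t - \<psi> i t) + \<delta> i t))"
    and \<psi>: "\<And>i t. t \<ge> 0 \<Longrightarrow> \<psi> i t = (\<Sum>j\<in>UNIV. in_weight A (Inl i) j *\<^sub>R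
        (matrix_exp ((t - r (Inl i) j t) *\<^sub>R S) *v \<xi> j (r (Inl i) j t)))"
    and \<delta>: "\<And>i. (\<delta> i \<longlongrightarrow> 0) at_top" "\<And>i. uniformly_bounded (\<delta> i)"
  defines "R \<equiv> - (matrix_inv (lap1 A) ** lap2 A)"
  shows "uniformly_bounded (\<xi> j)" "uniformly_bounded (\<psi> i)" "(\<mu> i \<longlongrightarrow> 0) at_top"
    "((\<lambda>t. \<xi> (Inl i) t - (\<Sum>l\<in>UNIV. R $ i $ l *\<^sub>R \<xi> (Inr l) t)) \<longlongrightarrow> 0) at_top"
proof -
  obtain B where B: "B > 0" "\<And>t v. norm (matrix_exp (t *\<^sub>R S) *v v) \<le> B * norm v"
    using matrix_exp_bounded[OF spectrum] by metis
  \<comment> \<open>The bound \<open>B\<close> is uniform over all real times, so the flow time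
    \<open>h t\<close> may be any function, in particular \<open>t\<close> or
    \<open>- t\<close>.\<close>
  have flow_tendsto: "((\<lambda>t. matrix_exp (h t *\<^sub>R S) *v x t) \<longlongrightarrow> 0) at_top" if "(x \<longlongrightarrow> 0) at_top" for h x
  proof (rule Lim_null_comparison)
    show "\<forall>\<^sub>F t in at_top. norm (matrix_exp (h t *\<^sub>R S) *v x t) \<le> B * norm (x t)"
      using B by simp
    show "((\<lambda>t. B * norm (x t)) \<longlongrightarrow> 0) at_top"
      using tendsto_mult_left[OF tendsto_norm_zero[OF that], of B] by simp
  qed
  have flow_bounded: "uniformly_bounded (\<lambda>t. matrix_exp (h t *\<^sub>R S) *v x t)" if "uniformly_bounded x" for h x
  proof -
    obtain M where "\<And>t. t \<ge> 0 \<Longrightarrow> norm (x t) \<le> M"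
      using \<open>uniformly_bounded x\<close> unfolding uniformly_bounded_iff by blast
    then have "norm (matrix_exp (h t *\<^sub>R S) *v x t) \<le> B * M" if "t \<ge> 0" for t
      using B(2)[of "h t" "x t"] mult_left_mono[of "norm (x t)" M B] B(1) that
      by (meson less_imp_le order_trans)
    then show ?thesis
      by (auto simp: uniformly_bounded_iff)
  qed
  define z where "z j t = matrix_exp (- t *\<^sub>R S) *v \<xi> j t" for j t
  define w where "w i t = matrix_exp (- t *\<^sub>R S) *v \<mu> i t" for i t
  have \<xi>: "\<xi> j t = matrix_exp (t *\<^sub>R S) *v z j t" for j t
    unfolding z_def by (rule matrix_exp_inverse'[symmetric])
  have z_leader: "z (Inr l) t = z (Inr l) 0" if "t \<ge> 0" for l t
  proof -
    have "solves_off C (z (Inr l)) (\<lambda>t. matrix_exp (- t *\<^sub>R S) *v 0)"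
      unfolding z_def[abs_def] by (rule solves_off_free_flow) (use leader[of l] in simp)
    from solves_off_has_integral[OF this C _ that]
    have "((\<lambda>t. 0) has_integral z (Inr l) t - z (Inr l) 0) {0..t}"
      by simp
    from has_integral_unique[OF this has_integral_0] show ?thesis
      by simp
  qed
  have z_follower: "solves_off C (z (Inl i)) (w i)" for i
    unfolding z_def[abs_def] w_def[abs_def] by (rule solves_off_free_flow[OF follower])
  \<comment> \<open>The constant leader values and their harmonic extension to the followers: the
    expected limit of \<open>z\<close>.\<close>
  define c where "c j = (case j of Inl i \<Rightarrow> \<Sum>l\<in>UNIV. R $ i $ l *\<^sub>R z (Inr l) 0 | Inr l \<Rightarrow> z (Inr l) 0)" for j
  have harmonic: "c (Inl i) = (\<Sum>j\<in>UNIV. in_weight A (Inl i) j *\<^sub>R c j)" for i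
  proof -
    have "c (Inl i) = (\<Sum>l\<in>UNIV. (\<Sum>j\<in>UNIV. (in_weight A (Inl i) (Inl j) * R $ j $ l) *\<^sub>R z (Inr l) 0)
        + in_weight A (Inl i) (Inr l) *\<^sub>R z (Inr l) 0)"
      unfolding c_def R_def sum.case containment_weights[OF graph reachable, of i]
      by (simp add: scaleR_left_distrib scaleR_sum_left)
    also have "\<dots> = (\<Sum>j\<in>UNIV. \<Sum>l\<in>UNIV. (in_weight A (Inl i) (Inl j) * R $ j $ l) *\<^sub>R z (Inr l) 0)
        + (\<Sum>l\<in>UNIV. in_weight A (Inl i) (Inr l) *\<^sub>R z (Inr l) 0)"
      unfolding sum.distrib by (subst sum.swap) simp
    also have "\<dots> = (\<Sum>j\<in>UNIV. in_weight A (Inl i) j *\<^sub>R c j)"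
      by (simp add: sum_UNIV_Plus c_def scaleR_sum_right)
    finally show ?thesis .
  qed
  have "\<exists>l1 l2. l1 > 0 \<and> l2 > 0 \<and> l1 + l2 = kd i \<and> l1 * l2 = kp i" for i
    by (rule real_roots_factor[OF gains(1)[of i] gains(2)[of i] real_roots[of _ i]]) blast+
  then obtain l1 l2 where l: "\<And>i. l1 i > 0" "\<And>i. l2 i > 0"
    "\<And>i. l1 i + l2 i = kd i" "\<And>i. l1 i * l2 i = kp i"
    by metis
  obtain \<theta> \<rho> where \<theta>: "\<And>i :: 'f. \<theta> i > 0" "\<rho> < (1 :: real)"
    "\<And>i. (\<Sum>j\<in>UNIV. in_weight A (Inl i) (Inl j) * \<theta> j) \<le> \<rho> * \<theta> i"
    using contraction_weights[OF graph reachable] by metis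
  define x where "x i t = z (Inl i) t - c (Inl i)" for i t
  \<comment> \<open>Chosen so that the derivative \<open>w i\<close> of \<open>x i\<close> equals
    \<open>- l1 i *\<^sub>R (x i t - y i t)\<close>; differentiating and using
    \<open>l1 + l2 = kd\<close>, \<open>l1 * l2 = kp\<close> then leaves a relaxation of
    \<open>y\<close> with rate \<open>l2\<close>.\<close>
  define y where "y i t = x i t + (1 / l1 i) *\<^sub>R w i t" for i t
  define d where "d i t = (1 / kp i) *\<^sub>R (matrix_exp (- t *\<^sub>R S) *v \<delta> i t)" for i t
  define W where "W i j = in_weight A (Inl i) (Inl j)" for i j
  have \<psi>_flow: "matrix_exp (- t *\<^sub>R S) *v \<psi> i t - c (Inl i)
      = (\<Sum>j\<in>UNIV. W i j *\<^sub>R x j (r (Inl i) (Inl j) t))" if t: "t \<ge> 0" for i t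
  proof -
    \<comment> \<open>The extrapolation from \<open>r\<close> to \<open>t\<close> splits into flows
      to time 0 and back. The latter cancels against the outer factor, so \<open>\<psi>\<close>
      becomes an average of plain delayed samples of \<open>z\<close>.\<close>
    have "matrix_exp (- t *\<^sub>R S) *v \<psi> i t
        = (\<Sum>j\<in>UNIV. in_weight A (Inl i) j *\<^sub>R z j (r (Inl i) j t))"
      by (simp only: \<psi>[OF t] vec.sum matrix_vector_mult_scaleR matrix_exp_diff matrix_exp_inverse z_def)
    then have "matrix_exp (- t *\<^sub>R S) *v \<psi> i t - c (Inl i)
        = (\<Sum>j\<in>UNIV. in_weight A (Inl i) j *\<^sub>R (z j (r (Inl i) j t) - c j))"
      by (subst harmonic) (simp add: scaleR_right_diff_distrib sum_subtractf)
    also have "\<dots> = (\<Sum>j\<in>UNIV. W i j *\<^sub>R x j (r (Inl i) (Inl j) t))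
        + (\<Sum>l\<in>UNIV. in_weight A (Inl i) (Inr l) *\<^sub>R (z (Inr l) (r (Inl i) (Inr l) t) - z (Inr l) 0))"
      by (simp add: sum_UNIV_Plus W_def x_def) (simp add: c_def)
    \<comment> \<open>Leader samples do not depend on when they were taken, provided the instant is
      nonnegative; that is known only along edges, hence the case split on the weight.\<close>
    also have "(\<Sum>l\<in>UNIV. in_weight A (Inl i) (Inr l) *\<^sub>R (z (Inr l) (r (Inl i) (Inr l) t) - z (Inr l) 0)) = 0"
    proof (rule sum.neutral, intro ballI)
      fix l
      show "in_weight A (Inl i) (Inr l) *\<^sub>R (z (Inr l) (r (Inl i) (Inr l) t) - z (Inr l) 0) = 0"
      proof (cases "in_weight A (Inl i) (Inr l) = 0")
        case False
        then have "(Inr l, Inl i) \<in> E"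
          using in_weight_edge[OF graph] by blast
        then have "r (Inl i) (Inr l) t \<ge> 0"
          using r_range[OF _ t] by simp
        from z_leader[OF this, of l] show ?thesis
          by simp
      qed simp
    qed
    finally show ?thesis
      by simp
  qed
  have x_ode: "solves_off C (x i) (w i)" for i
    using z_follower[of i] unfolding x_def[abs_def] solves_off_def
    by (auto intro!: continuous_intros has_vector_derivative_diff_const[THEN iffD2])
  interpret delayed_contraction C x y d W "\<lambda>i j. r (Inl i) (Inl j)" \<theta> l1 l2 \<rho>
  proof
    show "locally_finite_times C"
      by (rule C)
    show "W i j \<ge> 0" for i j
      unfolding W_def by (rule in_weight_nonneg[OF graph])
    show "\<theta> i > 0" "(\<Sum>j\<in>UNIV. W i j * \<theta> j) \<le> \<rho> * \<theta> i" for i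
      unfolding W_def by (rule \<theta>)+
    show "\<rho> < 1"
      by (rule \<theta>)
    show "l1 i > 0" "l2 i > 0" for i
      by (rule l)+
    show "solves_off C (x i) (\<lambda>t. - l1 i *\<^sub>R (x i t - y i t))" for i
    proof (rule solves_off_cong[OF x_ode])
      show "w i t = - l1 i *\<^sub>R (x i t - y i t)" for t
        using l(1)[of i] by (simp add: y_def)
    qed
    show "solves_off C (y i)
        (\<lambda>t. - l2 i *\<^sub>R (y i t - ((\<Sum>j\<in>UNIV. W i j *\<^sub>R x j (r (Inl i) (Inl j) t)) + d i t)))" for i
    proof -
      let ?g = "\<lambda>t. - kd i *\<^sub>R w i t
        - kp i *\<^sub>R (z (Inl i) t - matrix_exp (- t *\<^sub>R S) *v \<psi> i t) + kp i *\<^sub>R d i t"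
      have "solves_off C (w i) ?g"
        unfolding w_def[abs_def]
        by (rule solves_off_cong[OF solves_off_free_flow[OF input]])
          (use gains(1)[of i] in \<open>simp add: z_def d_def matrix_algebra\<close>)
      from solves_off_add[OF x_ode solves_off_scaleR[OF this, of "1 / l1 i"]]
      have "solves_off C (y i) (\<lambda>t. w i t + (1 / l1 i) *\<^sub>R ?g t)"
        by (simp add: y_def[abs_def])
      then show ?thesis
      proof (rule solves_off_cong)
        fix t :: real assume "t > 0"
        then have u: "matrix_exp (- t *\<^sub>R S) *v \<psi> i t
            = c (Inl i) + (\<Sum>j\<in>UNIV. W i j *\<^sub>R x j (r (Inl i) (Inl j) t))"
          using \<psi>_flow[of t i] by (simp add: algebra_simps)
        let ?v = "\<Sum>j\<in>UNIV. W i j *\<^sub>R x j (r (Inl i) (Inl j) t)"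
        have z_eq: "z (Inl i) t - matrix_exp (- t *\<^sub>R S) *v \<psi> i t = x i t - ?v"
          unfolding u x_def by simp
        have "w i t + (1 / l1 i) *\<^sub>R ?g t = w i t + (1 / l1 i) *\<^sub>R
            (- (l1 i + l2 i) *\<^sub>R w i t - (l1 i * l2 i) *\<^sub>R (x i t - ?v) + (l1 i * l2 i) *\<^sub>R d i t)"
          by (simp only: z_eq l)
        also have "\<dots> = - l2 i *\<^sub>R (y i t - (?v + d i t))"
          using l(1)[of i] by (simp add: y_def vec_eq_iff field_simps)
        finally show "w i t + (1 / l1 i) *\<^sub>R ?g t = - l2 i *\<^sub>R (y i t - (?v + d i t))" .
      qed
    qed
    show "r (Inl i) (Inl j) t \<in> {0..t}" if "W i j \<noteq> 0" "t \<ge> 0" for i j t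
      using that r_range in_weight_edge[OF graph] by (simp add: W_def)
    show "filterlim (r (Inl i) (Inl j)) at_top at_top" if "W i j \<noteq> 0" for i j
      using that r_lim in_weight_edge[OF graph] by (simp add: W_def)
    show "(d i \<longlongrightarrow> 0) at_top" for i
      using tendsto_scaleR[OF tendsto_const[of "1 / kp i"] flow_tendsto[OF \<delta>(1)[of i], of uminus]]
      unfolding d_def[abs_def] by simp
    show "uniformly_bounded (d i)" for i
      unfolding d_def[abs_def] by (intro uniformly_bounded_scaleR flow_bounded \<delta>(2))
  qed
  show \<mu>: "(\<mu> i \<longlongrightarrow> 0) at_top" for i
  proof -
    have "w i t = l1 i *\<^sub>R (y i t - x i t)" for t
      using l(1)[of i] by (simp add: y_def)
    then have "\<mu> i t = matrix_exp (t *\<^sub>R S) *v (l1 i *\<^sub>R (y i t - x i t))" for t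
      using matrix_exp_inverse'[of t S "\<mu> i t"] by (simp add: w_def)
    then have "\<mu> i = (\<lambda>t. matrix_exp (t *\<^sub>R S) *v (l1 i *\<^sub>R (y i t - x i t)))"
      by (rule ext)
    moreover have "((\<lambda>t. l1 i *\<^sub>R (y i t - x i t)) \<longlongrightarrow> l1 i *\<^sub>R (0 - 0)) at_top"
      by (intro tendsto_intros states_tendsto_0)
    ultimately show ?thesis
      using flow_tendsto[of "\<lambda>t. l1 i *\<^sub>R (y i t - x i t)" "\<lambda>t. t"] by simp
  qed
  \<comment> \<open>The entries of \<open>R\<close> are scalars acting across agents, so harmonic
    extension commutes with the flow and the error in original coordinates is the flow applied to
    \<open>x i\<close>.\<close>
  have lim: "((\<lambda>t. \<xi> (Inl i) t - (\<Sum>l\<in>UNIV. R $ i $ l *\<^sub>R \<xi> (Inr l) t)) \<longlongrightarrow> 0) at_top" for i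
  proof (rule Lim_transform_eventually)
    show "((\<lambda>t. matrix_exp (t *\<^sub>R S) *v x i t) \<longlongrightarrow> 0) at_top"
      by (rule flow_tendsto[OF states_tendsto_0(1)])
    show "\<forall>\<^sub>F t in at_top. matrix_exp (t *\<^sub>R S) *v x i t
        = \<xi> (Inl i) t - (\<Sum>l\<in>UNIV. R $ i $ l *\<^sub>R \<xi> (Inr l) t)"
      using eventually_ge_at_top[of 0]
    proof eventually_elim
      case (elim t)
      then show ?case
        by (simp add: \<xi> x_def c_def z_leader[OF elim] matrix_algebra vec.sum)
    qed
  qed
  then show "((\<lambda>t. \<xi> (Inl i) t - (\<Sum>l\<in>UNIV. R $ i $ l *\<^sub>R \<xi> (Inr l) t)) \<longlongrightarrow> 0) at_top" .
  have leader_bounded: "uniformly_bounded (\<xi> (Inr l))" for l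
  proof (rule uniformly_bounded_cong)
    show "uniformly_bounded (\<lambda>t. matrix_exp (t *\<^sub>R S) *v z (Inr l) 0)"
      by (intro flow_bounded uniformly_bounded_const)
    show "\<xi> (Inr l) t = matrix_exp (t *\<^sub>R S) *v z (Inr l) 0" if "t \<ge> 0" for t
      using z_leader[OF that] \<xi> by metis
  qed
  have \<xi>_bounded: "uniformly_bounded (\<xi> j)" for j
  proof (cases j)
    case (Inl i)
    have "continuous_on {0..} (\<lambda>t. \<xi> (Inl i) t - (\<Sum>l\<in>UNIV. R $ i $ l *\<^sub>R \<xi> (Inr l) t))"
      by (intro continuous_intros solves_off_continuous[OF follower] solves_off_continuous[OF leader])
    then have "uniformly_bounded (\<lambda>t. \<xi> (Inl i) t - (\<Sum>l\<in>UNIV. R $ i $ l *\<^sub>R \<xi> (Inr l) t))"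
      by (rule continuous_tendsto_0_bounded[OF _ lim])
    from uniformly_bounded_add[OF this, of "\<lambda>t. \<Sum>l\<in>UNIV. R $ i $ l *\<^sub>R \<xi> (Inr l) t"]
    show ?thesis
      by (simp add: Inl uniformly_bounded_sum uniformly_bounded_scaleR leader_bounded)
  qed (simp add: leader_bounded)
  then show "uniformly_bounded (\<xi> j)" .
  show "uniformly_bounded (\<psi> i)"
  proof (rule uniformly_bounded_cong)
    show "uniformly_bounded (\<lambda>t. \<Sum>j\<in>UNIV. in_weight A (Inl i) j *\<^sub>R
        (matrix_exp ((t - r (Inl i) j t) *\<^sub>R S) *v \<xi> j (r (Inl i) j t)))"
    proof (rule uniformly_bounded_sum)
      fix j
      show "uniformly_bounded (\<lambda>t. in_weight A (Inl i) j *\<^sub>R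
        (matrix_exp ((t - r (Inl i) j t) *\<^sub>R S) *v \<xi> j (r (Inl i) j t)))"
      proof (cases "in_weight A (Inl i) j = 0")
        case False
        then have "(j, Inl i) \<in> E"
          using in_weight_edge[OF graph] by blast
        then have "uniformly_bounded (\<lambda>t. \<xi> j (r (Inl i) j t))"
          using \<xi>_bounded[of j] r_range[of j "Inl i"] unfolding uniformly_bounded_iff by fastforce
        then show ?thesis
          by (intro uniformly_bounded_scaleR flow_bounded)
      qed (simp add: uniformly_bounded_const)
    qed
  qed (rule \<psi>)
qed

subsection \<open>Block vectors\<close>

lemma upper_block_vec: "upper (block_vec x y) = x"
  by (simp add: upper_def block_vec_def)

lemma lower_block_vec: "lower (block_vec x y) = y"
  by (simp add: lower_def block_vec_def)

lemma block_vec_upper_lower: "block_vec (upper w) (lower w) = w"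
  by (auto simp: upper_def lower_def block_vec_def vec_eq_iff split: sum.split)

lemma block_vec_add: "block_vec x y + block_vec x' y' = block_vec (x + x') (y + y')"
  by (auto simp: block_vec_def vec_eq_iff split: sum.split)

lemma block_vec_diff: "block_vec x y - block_vec x' y' = block_vec (x - x') (y - y')"
  by (auto simp: block_vec_def vec_eq_iff split: sum.split)

lemma block_vec_scaleR: "c *\<^sub>R block_vec x y = block_vec (c *\<^sub>R x) (c *\<^sub>R y)"
  by (auto simp: block_vec_def vec_eq_iff split: sum.split)

lemma block_vec_0: "block_vec 0 0 = 0"
  by (auto simp: block_vec_def vec_eq_iff split: sum.split)

lemmas block_vec_simps = block_vec_add block_vec_diff block_vec_scaleR

lemma bounded_linear_upper: "bounded_linear upper"
  unfolding linear_conv_bounded_linear[symmetric]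
  by (intro linearI) (simp_all add: upper_def vec_eq_iff)

lemma bounded_linear_lower: "bounded_linear lower"
  unfolding linear_conv_bounded_linear[symmetric]
  by (intro linearI) (simp_all add: lower_def vec_eq_iff)

lemma bounded_linear_block_vec:
  "bounded_linear (\<lambda>x. block_vec x 0)" "bounded_linear (\<lambda>y. block_vec 0 y)"
  unfolding linear_conv_bounded_linear[symmetric]
  by (intro linearI; simp add: block_vec_simps)+

lemma block_vec_eq_sum: "block_vec x y = block_vec x 0 + block_vec 0 y"
  by (simp add: block_vec_simps)

lemma sys_matrix_mult: "sys_matrix S1 S2 *v block_vec x y = block_vec y (S1 *v x + S2 *v y)"
proof -
  have "(sys_matrix S1 S2 *v block_vec x y) $ k = block_vec y (S1 *v x + S2 *v y) $ k" for k
  proof (cases k)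
    case (Inl i)
    have "(\<Sum>j\<in>UNIV. mat 1 $ i $ j * y $ j) = y $ i"
      by (simp add: mat_def if_distrib[where f = "\<lambda>x. x * _"] cong: if_cong)
    then show ?thesis
      by (simp add: Inl matrix_vector_mult_def sum_UNIV_Plus sys_matrix_def block_vec_def)
  qed (simp add: matrix_vector_mult_def sum_UNIV_Plus sys_matrix_def block_vec_def)
  then show ?thesis
    by (simp add: vec_eq_iff)
qed

lemma solves_off_block_vec:
  assumes "solves_off C x f" "solves_off C y g"
  shows "solves_off C (\<lambda>t. block_vec (x t) (y t)) (\<lambda>t. block_vec (f t) (g t))"
  using solves_off_add[OF solves_off_linear[OF assms(1) bounded_linear_block_vec(1)]
      solves_off_linear[OF assms(2) bounded_linear_block_vec(2)]]
  by (simp flip: block_vec_eq_sum)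

lemma isCont_matrix_vector: "isCont f t \<Longrightarrow> isCont (\<lambda>s. M *v f s) t"
  for M :: "real ^ 'n::finite ^ 'm::finite"
  by (rule bounded_linear.isCont[OF matrix_vector_mul_bounded_linear])

lemma isCont_upper: "isCont f t \<Longrightarrow> isCont (\<lambda>s. upper (f s)) t"
  by (rule bounded_linear.isCont[OF bounded_linear_upper])

lemma isCont_lower: "isCont f t \<Longrightarrow> isCont (\<lambda>s. lower (f s)) t"
  by (rule bounded_linear.isCont[OF bounded_linear_lower])

lemma isCont_pos_time:
  fixes x :: "real \<Rightarrow> 'a::topological_space"
  assumes "continuous_on {0..} x" "t > 0"
  shows "isCont x t"
proof (rule continuous_on_interior[OF assms(1)])
  show "t \<in> interior {0..}"
    using assms(2) by simp
qed

text \<open>The algebraic relations of the closed loop hold only for nonnegative times, which form a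
  neighbourhood of every positive one.\<close>

lemma isCont_pos_time_cong:
  fixes f g :: "real \<Rightarrow> 'a::topological_space"
  assumes "isCont g t" "\<And>s. s \<ge> 0 \<Longrightarrow> f s = g s" "t > 0"
  shows "isCont f t"
proof -
  have "\<forall>\<^sub>F s in nhds t. s > 0"
    using order_tendstoD(1)[OF filterlim_ident assms(3)] .
  then have "\<forall>\<^sub>F s in nhds t. f s = g s"
    by eventually_elim (simp add: assms(2))
  then show ?thesis
    using assms(1) isCont_cong by blast
qed

subsection \<open>The closed loop\<close>

text \<open>The part of the closed loop shared by both algorithms: the follower inputs and the
  equations of \<open>\<sigma>\<close> are still open.\<close>

locale multi_agent =
  fixes E :: "('f::finite + 'l::finite) rel"
    and A :: "real ^ ('f + 'l) ^ ('f + 'l)"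
    and K :: "'f + 'l \<Rightarrow> 'f + 'l \<Rightarrow> nat set"
    and ts :: "'f + 'l \<Rightarrow> 'f + 'l \<Rightarrow> nat \<Rightarrow> real"
    and \<tau> :: "'f + 'l \<Rightarrow> 'f + 'l \<Rightarrow> nat \<Rightarrow> ereal"
    and T :: real
    and S1 S2 :: "real ^ 'd::finite ^ 'd"
    and kp kd :: "'f \<Rightarrow> real"
    and p v vh \<Gamma> :: "'f + 'l \<Rightarrow> real \<Rightarrow> real ^ 'd"
    and \<sigma> :: "'f \<Rightarrow> real \<Rightarrow> real ^ 'd"
    and \<psi> :: "'f \<Rightarrow> real \<Rightarrow> real ^ ('d + 'd)"
  assumes graph: "leader_follower_graph E A"
    and reachable: "\<And>i. \<exists>j. (Inr j, Inl i) \<in> E\<^sup>+"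
    and delays: "\<And>i j k. (j, i) \<in> E \<Longrightarrow> k \<in> K i j \<Longrightarrow> 0 \<le> \<tau> i j k"
    and blackout: "bounded_blackout E K ts \<tau>"
    and period: "T > 0"
    and sampling: "\<And>i j k. (j, i) \<in> E \<Longrightarrow> k \<in> K i j \<Longrightarrow> ts i j k = real k * T"
    and spectrum: "\<And>z. is_eigenvalue (sys_matrix S1 S2) z \<Longrightarrow>
                     Re z = 0 \<and> semisimple_eigenvalue (sys_matrix S1 S2) z"
    and gains: "\<And>i. kp i > 0" "\<And>i. kd i > 0"
    and real_roots: "\<And>i (x::complex). x\<^sup>2 + of_real (kd i) * x + of_real (kp i) = 0 \<Longrightarrow> x \<in> \<real>"
    and position: "\<And>i. caratheodory (p i) (v i)"
    and velocity: "\<And>i. caratheodory (v i) (\<lambda>t. S1 *v p i t + S2 *v v i t + \<Gamma> i t)"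
    and leader_input: "\<And>i t. t \<ge> 0 \<Longrightarrow> \<Gamma> (Inr i) t = 0"
    and leader_vh: "\<And>i t. t \<ge> 0 \<Longrightarrow> vh (Inr i) t = v (Inr i) t"
    and follower_vh:
      "\<And>i. caratheodory (vh (Inl i)) (\<lambda>t. S1 *v p (Inl i) t + S2 *v vh (Inl i) t + \<sigma> i t)"
    and psi: "\<And>i t. t \<ge> 0 \<Longrightarrow> \<psi> i t =
                psi A (sys_matrix S1 S2) (\<lambda>i j. last_instant (K i j) (ts i j) (\<tau> i j)) p vh (Inl i) t"
begin

definition r :: "'f + 'l \<Rightarrow> 'f + 'l \<Rightarrow> real \<Rightarrow> real" where
  "r i j = last_instant (K i j) (ts i j) (\<tau> i j)"

definition C :: "real set" where
  "C = (\<Union>(j, i)\<in>E. delivery_times (K i j) (ts i j) (\<tau> i j))"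

definition \<xi> :: "'f + 'l \<Rightarrow> real \<Rightarrow> real ^ ('d + 'd)" where
  "\<xi> j t = block_vec (p j t) (vh j t)"

lemma locally_finite_C: "locally_finite_times C"
proof -
  have "finite (\<Union>(j, i)\<in>E. delivery_times (K i j) (ts i j) (\<tau> i j) \<inter> {0..t})" for t
  proof (intro finite_UN_I)
    show "finite (case e of (j, i) \<Rightarrow> delivery_times (K i j) (ts i j) (\<tau> i j) \<inter> {0..t})" if "e \<in> E" for e
      using locally_finite_delivery_times[OF period delays sampling] that
      by (cases e) (auto simp: locally_finite_times_def)
  qed simp
  moreover have "C \<inter> {0..t} = (\<Union>(j, i)\<in>E. delivery_times (K i j) (ts i j) (\<tau> i j) \<inter> {0..t})" for t
    by (auto simp: C_def)
  ultimately show ?thesis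
    by (simp add: locally_finite_times_def)
qed

lemma r_range: "(j, i) \<in> E \<Longrightarrow> t \<ge> 0 \<Longrightarrow> r i j t \<in> {0..t}"
  unfolding r_def by (intro last_instant_range[OF period delays sampling]) auto

lemma r_at_top:
  assumes "(j, i) \<in> E"
  shows "filterlim (r i j) at_top at_top"
proof -
  obtain Ts \<kappa> where "strict_mono \<kappa>" "range \<kappa> \<subseteq> K i j"
    "\<And>l. ereal (ts i j (\<kappa> (Suc l))) + \<tau> i j (\<kappa> (Suc l)) - ereal (ts i j (\<kappa> l)) \<le> ereal Ts"
    using blackout assms unfolding bounded_blackout_def by metis
  from last_instant_at_top[OF period delays sampling this] assms show ?thesis
    unfolding r_def by blast
qed

lemma r_locally_constant:
  assumes "(j, i) \<in> E" "t \<notin> C"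
  shows "\<forall>\<^sub>F s in nhds t. r i j s = r i j t"
proof -
  have "t \<notin> delivery_times (K i j) (ts i j) (\<tau> i j)"
    using assms unfolding C_def by blast
  from last_instant_locally_constant[OF period delays sampling this] assms(1) show ?thesis
    unfolding r_def by blast
qed

lemma \<psi>_eq:
  assumes "t \<ge> 0"
  shows "\<psi> i t = (\<Sum>j\<in>UNIV. in_weight A (Inl i) j *\<^sub>R
    (matrix_exp ((t - r (Inl i) j t) *\<^sub>R sys_matrix S1 S2) *v \<xi> j (r (Inl i) j t)))"
  by (simp add: psi[OF assms] psi_def r_def \<xi>_def in_weight_def scaleR_sum_right)

text \<open>Off the delivery times all sampling instants are frozen near \<open>t\<close>, and
  \<open>\<psi>\<close> is locally a finite sum of exponential flows applied to fixed
  vectors.\<close>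

lemma isCont_\<psi>:
  assumes t: "t > 0" "t \<notin> C"
  shows "isCont (\<psi> i) t"
proof -
  let ?g = "\<lambda>s. \<Sum>j\<in>UNIV. in_weight A (Inl i) j *\<^sub>R
    (matrix_exp ((s - r (Inl i) j t) *\<^sub>R sys_matrix S1 S2) *v \<xi> j (r (Inl i) j t))"
  have "\<forall>\<^sub>F s in nhds t. \<forall>j. (j, Inl i) \<in> E \<longrightarrow> r (Inl i) j s = r (Inl i) j t"
  proof (rule eventually_all_finite)
    show "\<forall>\<^sub>F s in nhds t. (j, Inl i) \<in> E \<longrightarrow> r (Inl i) j s = r (Inl i) j t" for j
      using r_locally_constant[OF _ t(2), of j "Inl i"] by (cases "(j, Inl i) \<in> E") auto
  qed
  moreover have "\<forall>\<^sub>F s in nhds t. s > 0"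
    using order_tendstoD(1)[OF filterlim_ident t(1)] .
  ultimately have ev: "\<forall>\<^sub>F s in nhds t. \<psi> i s = ?g s"
  proof eventually_elim
    case (elim s)
    have eq: "in_weight A (Inl i) j *\<^sub>R
        (matrix_exp ((s - r (Inl i) j s) *\<^sub>R sys_matrix S1 S2) *v \<xi> j (r (Inl i) j s))
      = in_weight A (Inl i) j *\<^sub>R
        (matrix_exp ((s - r (Inl i) j t) *\<^sub>R sys_matrix S1 S2) *v \<xi> j (r (Inl i) j t))" for j
    proof (cases "in_weight A (Inl i) j = 0")
      case False
      then have "r (Inl i) j s = r (Inl i) j t"
        using in_weight_edge[OF graph] elim(1) by blast
      then show ?thesis
        by simp
    qed simp
    show ?case
      unfolding \<psi>_eq[OF less_imp_le[OF elim(2)]] by (rule sum.cong[OF refl eq])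
  qed
  have "isCont ?g t"
    unfolding matrix_exp_diff
    by (intro continuous_intros has_vector_derivative_continuous[OF matrix_exp_vector_derivative])
  then show ?thesis
    by (rule iffD2[OF isCont_cong[OF ev]])
qed

lemmas continuous_p = caratheodory_continuous[OF position]
  and continuous_v = caratheodory_continuous[OF velocity]
  and continuous_vh = caratheodory_continuous[OF follower_vh]

lemmas isCont_states = isCont_pos_time[OF continuous_p] isCont_pos_time[OF continuous_v]
  isCont_pos_time[OF continuous_vh]

lemma solves_p: "solves_off C (p i) (v i)"
  by (intro caratheodory_solves_off position isCont_states)

lemma solves_v:
  assumes "\<And>t. t > 0 \<Longrightarrow> t \<notin> C \<Longrightarrow> isCont (\<Gamma> i) t"
  shows "solves_off C (v i) (\<lambda>t. S1 *v p i t + S2 *v v i t + \<Gamma> i t)"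
  by (intro caratheodory_solves_off velocity continuous_intros isCont_matrix_vector isCont_states assms)

lemma solves_vh:
  assumes "continuous_on {0..} (\<sigma> i)"
  shows "solves_off C (vh (Inl i)) (\<lambda>t. S1 *v p (Inl i) t + S2 *v vh (Inl i) t + \<sigma> i t)"
  by (intro caratheodory_solves_off follower_vh continuous_intros isCont_matrix_vector isCont_states
      isCont_pos_time[OF assms])

lemma solves_leader: "solves_off C (\<xi> (Inr l)) (\<lambda>t. sys_matrix S1 S2 *v \<xi> (Inr l) t)"
proof -
  have "solves_off C (v (Inr l)) (\<lambda>t. S1 *v p (Inr l) t + S2 *v v (Inr l) t + \<Gamma> (Inr l) t)"
    by (intro solves_v isCont_pos_time_cong[OF continuous_const]) (auto simp: leader_input)
  from solves_off_block_vec[OF solves_p this]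
  have *: "solves_off C (\<lambda>t. block_vec (p (Inr l) t) (v (Inr l) t))
      (\<lambda>t. sys_matrix S1 S2 *v block_vec (p (Inr l) t) (v (Inr l) t))"
    by (rule solves_off_cong) (simp add: sys_matrix_mult leader_input)
  have eq: "\<xi> (Inr l) t = block_vec (p (Inr l) t) (v (Inr l) t)" if "t \<ge> 0" for t
    using that by (simp add: \<xi>_def leader_vh)
  show ?thesis
    unfolding solves_off_def
  proof (intro conjI allI impI)
    show "continuous_on {0..} (\<xi> (Inr l))"
      using solves_off_continuous[OF *] by (rule continuous_on_eq) (simp add: eq)
    fix t :: real assume t: "t > 0" "t \<notin> C"
    have "(\<xi> (Inr l) has_vector_derivative
        sys_matrix S1 S2 *v block_vec (p (Inr l) t) (v (Inr l) t)) (at t)"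
      by (rule has_vector_derivative_transform_within_open[OF solves_off_derivative[OF * t],
            of "{0<..}"]) (use t eq in auto)
    then show "(\<xi> (Inr l) has_vector_derivative sys_matrix S1 S2 *v \<xi> (Inr l) t) (at t)"
      using t eq by simp
  qed
qed

text \<open>Here \<open>v - \<eta>\<close> plays the role of the velocity available to the
  controller. Both algorithms are instances: \<open>\<eta> = 0\<close> when the velocity is
  measured, the observer error otherwise.\<close>

lemma closed_loop:
  fixes \<eta> :: "'f \<Rightarrow> real \<Rightarrow> real ^ 'd"
  assumes \<sigma>: "\<And>i. solves_off C (\<sigma> i) (\<lambda>t. S1 *v (v (Inl i) t - vh (Inl i) t - \<eta> i t)
      + S2 *v \<sigma> i t - kd i *\<^sub>R \<sigma> i t - kp i *\<^sub>R (vh (Inl i) t - lower (\<psi> i t)))"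
    and \<Gamma>: "\<And>i t. t \<ge> 0 \<Longrightarrow> \<Gamma> (Inl i) t =
      - ((kd i *\<^sub>R mat 1 + S2) *v (v (Inl i) t - vh (Inl i) t - \<eta> i t))
      - kp i *\<^sub>R (p (Inl i) t - upper (\<psi> i t)) + 2 *\<^sub>R \<sigma> i t"
    and \<Gamma>_cont: "\<And>i t. t > 0 \<Longrightarrow> t \<notin> C \<Longrightarrow> isCont (\<Gamma> (Inl i)) t"
    and \<eta>: "\<And>i. (\<eta> i \<longlongrightarrow> 0) at_top" "\<And>i. uniformly_bounded (\<eta> i)"
  shows "uniformly_bounded (p j)" "uniformly_bounded (v j)" "uniformly_bounded (vh (Inl i))"
    "uniformly_bounded (\<sigma> i)" "uniformly_bounded (\<psi> i)" "uniformly_bounded (\<Gamma> (Inl i))"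
    "(containment_error A v \<longlongrightarrow> 0) at_top" "(containment_error A p \<longlongrightarrow> 0) at_top"
proof -
  let ?S = "sys_matrix S1 S2"
  let ?R = "- (matrix_inv (lap1 A) ** lap2 A)"
  define \<mu> where "\<mu> i t = block_vec (v (Inl i) t - vh (Inl i) t) (\<sigma> i t)" for i t
  define \<delta> where "\<delta> i t = block_vec ((kd i *\<^sub>R mat 1 + S2) *v \<eta> i t) (- (S1 *v \<eta> i t))" for i t
  have \<delta>_linear: "\<delta> i t = block_vec ((kd i *\<^sub>R mat 1 + S2) *v \<eta> i t) 0 + block_vec 0 (- (S1 *v \<eta> i t))" for i t
    unfolding \<delta>_def by (rule block_vec_eq_sum)
  have vh: "solves_off C (vh (Inl i)) (\<lambda>t. S1 *v p (Inl i) t + S2 *v vh (Inl i) t + \<sigma> i t)" for i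
    by (rule solves_vh[OF solves_off_continuous[OF \<sigma>]])
  have v: "solves_off C (v (Inl i)) (\<lambda>t. S1 *v p (Inl i) t + S2 *v v (Inl i) t + \<Gamma> (Inl i) t)" for i
    by (rule solves_v[OF \<Gamma>_cont])
  have follower: "solves_off C (\<xi> (Inl i)) (\<lambda>t. ?S *v \<xi> (Inl i) t + \<mu> i t)" for i
    unfolding \<xi>_def[abs_def]
    by (rule solves_off_cong[OF solves_off_block_vec[OF solves_p vh]])
      (simp add: sys_matrix_mult \<mu>_def block_vec_simps)
  \<comment> \<open>In the derivative of \<open>v - vh\<close> the term \<open>- S2 (v - vh)\<close>
    of the input cancels the drift; of \<open>2 *\<^sub>R \<sigma>\<close>, one copy cancels the
    \<open>\<sigma>\<close> driving \<open>vh\<close> and the other is the upper block of the system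
    matrix applied to \<open>\<mu>\<close>. The terms in \<open>\<eta>\<close> make up
    \<open>\<delta>\<close>.\<close>
  have input: "solves_off C (\<mu> i)
      (\<lambda>t. ?S *v \<mu> i t + (- kd i *\<^sub>R \<mu> i t - kp i *\<^sub>R (\<xi> (Inl i) t - \<psi> i t) + \<delta> i t))" for i
    unfolding \<mu>_def[abs_def]
  proof (rule solves_off_cong[OF solves_off_block_vec[OF solves_off_diff[OF v vh] \<sigma>]])
    fix t :: real assume "t > 0"
    then have t: "t \<ge> 0"
      by simp
    have \<xi>\<psi>: "\<xi> (Inl i) t - \<psi> i t = block_vec (p (Inl i) t - upper (\<psi> i t)) (vh (Inl i) t - lower (\<psi> i t))"
      by (subst block_vec_upper_lower[of "\<psi> i t", symmetric]) (simp only: \<xi>_def block_vec_diff)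
    show "block_vec
        (S1 *v p (Inl i) t + S2 *v v (Inl i) t + \<Gamma> (Inl i) t
          - (S1 *v p (Inl i) t + S2 *v vh (Inl i) t + \<sigma> i t))
        (S1 *v (v (Inl i) t - vh (Inl i) t - \<eta> i t) + S2 *v \<sigma> i t - kd i *\<^sub>R \<sigma> i t
          - kp i *\<^sub>R (vh (Inl i) t - lower (\<psi> i t)))
      = ?S *v block_vec (v (Inl i) t - vh (Inl i) t) (\<sigma> i t)
        + (- kd i *\<^sub>R block_vec (v (Inl i) t - vh (Inl i) t) (\<sigma> i t)
          - kp i *\<^sub>R (\<xi> (Inl i) t - \<psi> i t) + \<delta> i t)"
      unfolding \<Gamma>[OF t] sys_matrix_mult \<xi>\<psi> \<delta>_def block_vec_simps
      by (intro arg_cong2[where f = block_vec]) (simp_all add: matrix_algebra algebra_simps scaleR_2)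
  qed
  have \<delta>_lim: "(\<delta> i \<longlongrightarrow> 0) at_top" for i
  proof -
    have "((\<lambda>t. block_vec ((kd i *\<^sub>R mat 1 + S2) *v \<eta> i t) 0 + block_vec 0 (- (S1 *v \<eta> i t)))
        \<longlongrightarrow> block_vec ((kd i *\<^sub>R mat 1 + S2) *v 0) 0 + block_vec 0 (- (S1 *v 0))) at_top"
      by (intro tendsto_intros bounded_linear.tendsto[OF bounded_linear_block_vec(1)]
          bounded_linear.tendsto[OF bounded_linear_block_vec(2)]
          bounded_linear.tendsto[OF matrix_vector_mul_bounded_linear] \<eta>(1))
    then show ?thesis
      by (simp add: \<delta>_linear[abs_def] block_vec_0)
  qed
  have \<delta>_bounded: "uniformly_bounded (\<delta> i)" for i
    unfolding \<delta>_linear[abs_def]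
    by (intro uniformly_bounded_intros uniformly_bounded_linear[OF _ bounded_linear_block_vec(1)]
        uniformly_bounded_linear[OF _ bounded_linear_block_vec(2)] \<eta>(2))
  have containment: "uniformly_bounded (\<xi> j)" "uniformly_bounded (\<psi> i)" "(\<mu> i \<longlongrightarrow> 0) at_top"
    "((\<lambda>t. \<xi> (Inl i) t - (\<Sum>l\<in>UNIV. ?R $ i $ l *\<^sub>R \<xi> (Inr l) t)) \<longlongrightarrow> 0) at_top" for i j
    by (rule delayed_containment[where E = E and S = ?S and C = C and r = r and \<xi> = \<xi> and \<mu> = \<mu>
          and \<psi> = \<psi> and \<delta> = \<delta> and kp = kp and kd = kd];
        fact graph reachable spectrum gains real_roots locally_finite_C r_range r_at_top
          solves_leader follower input \<psi>_eq \<delta>_lim \<delta>_bounded)+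
  have p_eq: "p j t = upper (\<xi> j t)" and vh_eq: "vh j t = lower (\<xi> j t)" for j t
    by (simp_all add: \<xi>_def upper_block_vec lower_block_vec)
  have e_eq: "v (Inl i) t - vh (Inl i) t = upper (\<mu> i t)" and \<sigma>_eq: "\<sigma> i t = lower (\<mu> i t)" for i t
    by (simp_all add: \<mu>_def upper_block_vec lower_block_vec)
  have \<mu>_bounded: "uniformly_bounded (\<mu> i)" for i
    by (rule continuous_tendsto_0_bounded[OF solves_off_continuous[OF input] containment(3)])
  show p_bounded: "uniformly_bounded (p j)" for j
    using uniformly_bounded_linear[OF containment(1) bounded_linear_upper, of j]
    by (simp flip: p_eq)
  have vh_bounded: "uniformly_bounded (vh j)" for j
    using uniformly_bounded_linear[OF containment(1) bounded_linear_lower, of j]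
    by (simp flip: vh_eq)
  then show "uniformly_bounded (vh (Inl i))" .
  have e_bounded: "uniformly_bounded (\<lambda>t. v (Inl i) t - vh (Inl i) t)" for i
    unfolding e_eq by (rule uniformly_bounded_linear[OF \<mu>_bounded bounded_linear_upper])
  show "uniformly_bounded (v j)"
  proof (cases j)
    case (Inl i)
    then show ?thesis
      using uniformly_bounded_add[OF e_bounded[of i] vh_bounded[of "Inl i"]] by simp
  next
    case (Inr l)
    show ?thesis
      unfolding Inr by (rule uniformly_bounded_cong[OF vh_bounded[of "Inr l"]]) (simp add: leader_vh)
  qed
  have \<sigma>_bounded: "uniformly_bounded (\<sigma> i)" for i
    using uniformly_bounded_linear[OF \<mu>_bounded bounded_linear_lower, of i] by (simp flip: \<sigma>_eq)
  then show "uniformly_bounded (\<sigma> i)" .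
  show \<psi>_bounded: "uniformly_bounded (\<psi> i)" for i
    by (rule containment(2))
  show "uniformly_bounded (\<Gamma> (Inl i))"
  proof (rule uniformly_bounded_cong)
    show "uniformly_bounded (\<lambda>t. - ((kd i *\<^sub>R mat 1 + S2) *v (v (Inl i) t - vh (Inl i) t - \<eta> i t))
        - kp i *\<^sub>R (p (Inl i) t - upper (\<psi> i t)) + 2 *\<^sub>R \<sigma> i t)"
      using uniformly_bounded_linear[OF \<psi>_bounded bounded_linear_upper]
      by (intro uniformly_bounded_add uniformly_bounded_minus uniformly_bounded_matrix
          uniformly_bounded_scaleR uniformly_bounded_diff[OF e_bounded \<eta>(2)] \<sigma>_bounded
          uniformly_bounded_diff[OF p_bounded]
          uniformly_bounded_diff[OF uniformly_bounded_minus uniformly_bounded_scaleR])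
  qed (rule \<Gamma>)
  have upper_lim: "((\<lambda>t. p (Inl i) t - (\<Sum>l\<in>UNIV. ?R $ i $ l *\<^sub>R p (Inr l) t)) \<longlongrightarrow> 0) at_top" for i
    using bounded_linear.tendsto_zero[OF bounded_linear_upper containment(4)[of i]]
    by (simp add: p_eq linear_diff[OF bounded_linear.linear[OF bounded_linear_upper]]
        linear_sum[OF bounded_linear.linear[OF bounded_linear_upper]]
        linear_scale[OF bounded_linear.linear[OF bounded_linear_upper]]
        linear_neg[OF bounded_linear.linear[OF bounded_linear_upper]])
  then show "(containment_error A p \<longlongrightarrow> 0) at_top"
    by (rule containment_error_tendsto_0)
  have lower_lim: "((\<lambda>t. vh (Inl i) t - (\<Sum>l\<in>UNIV. ?R $ i $ l *\<^sub>R vh (Inr l) t)) \<longlongrightarrow> 0) at_top" for i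
    using bounded_linear.tendsto_zero[OF bounded_linear_lower containment(4)[of i]]
    by (simp add: vh_eq linear_diff[OF bounded_linear.linear[OF bounded_linear_lower]]
        linear_sum[OF bounded_linear.linear[OF bounded_linear_lower]]
        linear_scale[OF bounded_linear.linear[OF bounded_linear_lower]]
        linear_neg[OF bounded_linear.linear[OF bounded_linear_lower]])
  show "(containment_error A v \<longlongrightarrow> 0) at_top"
  proof (rule containment_error_tendsto_0)
    fix i
    have "((\<lambda>t. v (Inl i) t - vh (Inl i) t) \<longlongrightarrow> 0) at_top"
      unfolding e_eq by (rule bounded_linear.tendsto_zero[OF bounded_linear_upper containment(3)])
    from tendsto_add[OF this lower_lim[of i]]
    have "((\<lambda>t. v (Inl i) t - (\<Sum>l\<in>UNIV. ?R $ i $ l *\<^sub>R vh (Inr l) t)) \<longlongrightarrow> 0) at_top"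
      by simp
    then show "((\<lambda>t. v (Inl i) t - (\<Sum>l\<in>UNIV. ?R $ i $ l *\<^sub>R v (Inr l) t)) \<longlongrightarrow> 0) at_top"
    proof (rule Lim_transform_eventually)
      show "\<forall>\<^sub>F t in at_top. v (Inl i) t - (\<Sum>l\<in>UNIV. ?R $ i $ l *\<^sub>R vh (Inr l) t)
          = v (Inl i) t - (\<Sum>l\<in>UNIV. ?R $ i $ l *\<^sub>R v (Inr l) t)"
        using eventually_ge_at_top[of 0] by eventually_elim (simp add: leader_vh)
    qed
  qed
qed

section \<open>The two algorithms\<close>

lemma velocity_containment:
  assumes alg: "\<And>i. velocity_algorithm S1 S2 (kp i) (kd i) (\<psi> i)
      (p (Inl i)) (v (Inl i)) (vh (Inl i)) (\<sigma> i) (\<Gamma> (Inl i))"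
  shows "uniformly_bounded (p j)" "uniformly_bounded (v j)" "uniformly_bounded (vh (Inl i))"
    "uniformly_bounded (\<sigma> i)" "uniformly_bounded (\<psi> i)" "uniformly_bounded (\<Gamma> (Inl i))"
    "(containment_error A v \<longlongrightarrow> 0) at_top" "(containment_error A p \<longlongrightarrow> 0) at_top"
proof -
  \<comment> \<open>The subtracted 0 is the observer error, written out to match
    \<open>closed_loop\<close>.\<close>
  have \<Gamma>: "\<Gamma> (Inl i) t = - ((kd i *\<^sub>R mat 1 + S2) *v (v (Inl i) t - vh (Inl i) t - 0))
      - kp i *\<^sub>R (p (Inl i) t - upper (\<psi> i t)) + 2 *\<^sub>R \<sigma> i t" if "t \<ge> 0" for i t
    using alg[of i] that unfolding velocity_algorithm_def by simp
  have \<sigma>: "caratheodory (\<sigma> i) (\<lambda>t. S1 *v (v (Inl i) t - vh (Inl i) t - 0)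
      + S2 *v \<sigma> i t - kd i *\<^sub>R \<sigma> i t - kp i *\<^sub>R (vh (Inl i) t - lower (\<psi> i t)))" for i
    using alg[of i] unfolding velocity_algorithm_def by simp
  note isCont_\<sigma> = isCont_pos_time[OF caratheodory_continuous[OF \<sigma>]]
  have \<sigma>_ode: "solves_off C (\<sigma> i) (\<lambda>t. S1 *v (v (Inl i) t - vh (Inl i) t - 0)
      + S2 *v \<sigma> i t - kd i *\<^sub>R \<sigma> i t - kp i *\<^sub>R (vh (Inl i) t - lower (\<psi> i t)))" for i
    by (intro caratheodory_solves_off \<sigma> continuous_intros isCont_matrix_vector isCont_lower
        isCont_states isCont_\<sigma> isCont_\<psi>)
  have \<Gamma>_cont: "isCont (\<Gamma> (Inl i)) t" if "t > 0" "t \<notin> C" for i t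
  proof (rule isCont_pos_time_cong[OF _ \<Gamma> that(1)])
    show "isCont (\<lambda>t. - ((kd i *\<^sub>R mat 1 + S2) *v (v (Inl i) t - vh (Inl i) t - 0))
      - kp i *\<^sub>R (p (Inl i) t - upper (\<psi> i t)) + 2 *\<^sub>R \<sigma> i t) t"
      using that by (intro continuous_intros isCont_matrix_vector isCont_upper
        isCont_states isCont_\<sigma> isCont_\<psi>)
  qed
  note loop = closed_loop[of "\<lambda>i t. 0", OF \<sigma>_ode \<Gamma> \<Gamma>_cont tendsto_const uniformly_bounded_const]
  show "uniformly_bounded (p j)" "uniformly_bounded (v j)" "uniformly_bounded (vh (Inl i))"
    "uniformly_bounded (\<sigma> i)" "uniformly_bounded (\<psi> i)" "uniformly_bounded (\<Gamma> (Inl i))"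
    "(containment_error A v \<longlongrightarrow> 0) at_top" "(containment_error A p \<longlongrightarrow> 0) at_top"
    by (rule loop; assumption)+
qed

text \<open>\<open>k\<phi> *\<^sub>R (\<phi> + p)\<close> is an observer of the velocity: in the
  derivative of its error \<open>\<eta>\<close> the terms \<open>\<Gamma>\<close> and
  \<open>S1 *v p\<close> cancel, leaving a linear equation with a stable matrix.\<close>

lemma velocity_free_containment:
  fixes \<phi> :: "'f \<Rightarrow> real \<Rightarrow> real ^ 'd" and k\<phi> :: "'f \<Rightarrow> real"
  assumes k\<phi>: "\<And>i. k\<phi> i > 0" and stable: "\<And>i. stable_matrix (- (k\<phi> i *\<^sub>R mat 1) + S2)"
    and alg: "\<And>i. velocity_free_algorithm S1 S2 (kp i) (kd i) (k\<phi> i) (\<psi> i)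
      (p (Inl i)) (vh (Inl i)) (\<sigma> i) (\<phi> i) (\<Gamma> (Inl i))"
  shows "uniformly_bounded (p j)" "uniformly_bounded (v j)" "uniformly_bounded (vh (Inl i))"
    "uniformly_bounded (\<sigma> i)" "uniformly_bounded (\<psi> i)" "uniformly_bounded (\<Gamma> (Inl i))"
    "uniformly_bounded (\<phi> i)"
    "(containment_error A v \<longlongrightarrow> 0) at_top" "(containment_error A p \<longlongrightarrow> 0) at_top"
proof -
  define \<eta> where "\<eta> i t = v (Inl i) t - k\<phi> i *\<^sub>R (\<phi> i t + p (Inl i) t)" for i t
  have est: "k\<phi> i *\<^sub>R (\<phi> i t + p (Inl i) t) - vh (Inl i) t = v (Inl i) t - vh (Inl i) t - \<eta> i t" for i t
    by (simp add: \<eta>_def)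
  have \<Gamma>: "\<Gamma> (Inl i) t = - ((kd i *\<^sub>R mat 1 + S2) *v (k\<phi> i *\<^sub>R (\<phi> i t + p (Inl i) t) - vh (Inl i) t))
      - kp i *\<^sub>R (p (Inl i) t - upper (\<psi> i t)) + 2 *\<^sub>R \<sigma> i t" if "t \<ge> 0" for i t
    using alg[of i] that unfolding velocity_free_algorithm_def by blast
  have \<sigma>: "caratheodory (\<sigma> i) (\<lambda>t. - ((kd i *\<^sub>R mat 1 - S2) *v \<sigma> i t)
      + S1 *v (k\<phi> i *\<^sub>R (\<phi> i t + p (Inl i) t) - vh (Inl i) t)
      - kp i *\<^sub>R (vh (Inl i) t - lower (\<psi> i t)))" for i
    using alg[of i] unfolding velocity_free_algorithm_def by blast
  have \<phi>: "caratheodory (\<phi> i) (\<lambda>t. - ((k\<phi> i *\<^sub>R mat 1 - S2) *v (p (Inl i) t + \<phi> i t))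
      + (1 / k\<phi> i) *\<^sub>R (\<Gamma> (Inl i) t + S1 *v p (Inl i) t))" for i
    using alg[of i] unfolding velocity_free_algorithm_def by blast
  note isCont_\<sigma> = isCont_pos_time[OF caratheodory_continuous[OF \<sigma>]]
  note isCont_\<phi> = isCont_pos_time[OF caratheodory_continuous[OF \<phi>]]
  have "solves_off C (\<sigma> i) (\<lambda>t. - ((kd i *\<^sub>R mat 1 - S2) *v \<sigma> i t)
      + S1 *v (k\<phi> i *\<^sub>R (\<phi> i t + p (Inl i) t) - vh (Inl i) t)
      - kp i *\<^sub>R (vh (Inl i) t - lower (\<psi> i t)))" for i
    by (intro caratheodory_solves_off \<sigma> continuous_intros isCont_matrix_vector isCont_lower
        isCont_states isCont_\<sigma> isCont_\<phi> isCont_\<psi>)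
  then have \<sigma>_ode: "solves_off C (\<sigma> i) (\<lambda>t. S1 *v (v (Inl i) t - vh (Inl i) t - \<eta> i t)
      + S2 *v \<sigma> i t - kd i *\<^sub>R \<sigma> i t - kp i *\<^sub>R (vh (Inl i) t - lower (\<psi> i t)))" for i
    by (rule solves_off_cong) (simp add: est matrix_algebra)
  \<comment> \<open>The input contains \<open>\<phi>\<close> and the equation of
    \<open>\<phi>\<close> contains the input. The circle is broken by continuity of
    \<open>\<phi>\<close>, which follows from its integral equation alone.\<close>
  have \<Gamma>_cont: "isCont (\<Gamma> (Inl i)) t" if "t > 0" "t \<notin> C" for i t
  proof (rule isCont_pos_time_cong[OF _ \<Gamma> that(1)])
    show "isCont (\<lambda>t. - ((kd i *\<^sub>R mat 1 + S2) *v (k\<phi> i *\<^sub>R (\<phi> i t + p (Inl i) t) - vh (Inl i) t))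
      - kp i *\<^sub>R (p (Inl i) t - upper (\<psi> i t)) + 2 *\<^sub>R \<sigma> i t) t"
      using that by (intro continuous_intros isCont_matrix_vector isCont_upper
        isCont_states isCont_\<sigma> isCont_\<phi> isCont_\<psi>)
  qed
  have \<phi>_ode: "solves_off C (\<phi> i) (\<lambda>t. - ((k\<phi> i *\<^sub>R mat 1 - S2) *v (p (Inl i) t + \<phi> i t))
      + (1 / k\<phi> i) *\<^sub>R (\<Gamma> (Inl i) t + S1 *v p (Inl i) t))" for i
    by (intro caratheodory_solves_off \<phi> continuous_intros isCont_matrix_vector
        isCont_states isCont_\<phi> \<Gamma>_cont)
  have "solves_off C (\<eta> i) (\<lambda>t. (- (k\<phi> i *\<^sub>R mat 1) + S2) *v \<eta> i t)" for i
    unfolding \<eta>_def[abs_def]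
    by (rule solves_off_cong[OF solves_off_diff[OF solves_v[OF \<Gamma>_cont]
            solves_off_scaleR[OF solves_off_add[OF \<phi>_ode solves_p]]]])
      (use k\<phi>[of i] in \<open>simp_all add: matrix_algebra algebra_simps\<close>)
  note \<eta>_ode = this
  have \<eta>_lim: "(\<eta> i \<longlongrightarrow> 0) at_top" for i
    by (rule stable_solution_tendsto_0[OF \<eta>_ode locally_finite_C stable])
  have \<eta>_bounded: "uniformly_bounded (\<eta> i)" for i
    by (rule continuous_tendsto_0_bounded[OF solves_off_continuous[OF \<eta>_ode] \<eta>_lim])
  note loop = closed_loop[of \<eta>, OF \<sigma>_ode \<Gamma>[unfolded est] \<Gamma>_cont \<eta>_lim \<eta>_bounded]
  show p_bounded: "uniformly_bounded (p j)" and v_bounded: "uniformly_bounded (v j)" for j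
    by (rule loop; assumption)+
  show "uniformly_bounded (vh (Inl i))"
    "uniformly_bounded (\<sigma> i)" "uniformly_bounded (\<psi> i)" "uniformly_bounded (\<Gamma> (Inl i))"
    "(containment_error A v \<longlongrightarrow> 0) at_top" "(containment_error A p \<longlongrightarrow> 0) at_top"
    by (rule loop; assumption)+
  \<comment> \<open>Solving the definition of \<open>\<eta>\<close> for \<open>\<phi>\<close>
    expresses it through signals already known to be bounded.\<close>
  have "\<phi> i t = (1 / k\<phi> i) *\<^sub>R (v (Inl i) t - \<eta> i t) - p (Inl i) t" for t
    using k\<phi>[of i] by (simp add: \<eta>_def algebra_simps)
  then show "uniformly_bounded (\<phi> i)"
    using uniformly_bounded_diff[OF uniformly_bounded_scaleR[OF
          uniformly_bounded_diff[OF v_bounded \<eta>_bounded]] p_bounded]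
    by (rule uniformly_bounded_cong[rotated])
qed

end

theorem theorem3:
  fixes E :: "('f::finite + 'l::finite) rel"
    and A :: "real ^ ('f + 'l) ^ ('f + 'l)"
    and K :: "'f + 'l \<Rightarrow> 'f + 'l \<Rightarrow> nat set"
    and ts :: "'f + 'l \<Rightarrow> 'f + 'l \<Rightarrow> nat \<Rightarrow> real"
    and \<tau> :: "'f + 'l \<Rightarrow> 'f + 'l \<Rightarrow> nat \<Rightarrow> ereal"
    and T :: real
    and S1 S2 :: "real ^ 'd::finite ^ 'd"
    and kp kd k\<phi> :: "'f \<Rightarrow> real"
    and p v vh \<Gamma> :: "'f + 'l \<Rightarrow> real \<Rightarrow> real ^ 'd"
    and \<sigma> \<phi> :: "'f \<Rightarrow> real \<Rightarrow> real ^ 'd"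
    and \<psi> :: "'f \<Rightarrow> real \<Rightarrow> real ^ ('d + 'd)"
  assumes graph: "leader_follower_graph E A"
    and reachable: "\<And>i. \<exists>j. (Inr j, Inl i) \<in> E\<^sup>+"
    and indices: "\<And>i j. (j, i) \<in> E \<Longrightarrow> infinite (K i j)"
    and delays: "\<And>i j k. (j, i) \<in> E \<Longrightarrow> k \<in> K i j \<Longrightarrow> 0 \<le> \<tau> i j k"
    and blackout: "bounded_blackout E K ts \<tau>"
    and period: "T > 0"
    and sampling: "\<And>i j k. (j, i) \<in> E \<Longrightarrow> k \<in> K i j \<Longrightarrow> ts i j k = real k * T"
    and spectrum: "\<And>z. is_eigenvalue (sys_matrix S1 S2) z \<Longrightarrow>
                     Re z = 0 \<and> semisimple_eigenvalue (sys_matrix S1 S2) z"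
    and gains: "\<And>i. kp i > 0" "\<And>i. kd i > 0"
    and real_roots: "\<And>i (x::complex). x\<^sup>2 + of_real (kd i) * x + of_real (kp i) = 0 \<Longrightarrow> x \<in> \<real>"
    and position: "\<And>i. caratheodory (p i) (v i)"
    and velocity: "\<And>i. caratheodory (v i) (\<lambda>t. S1 *v p i t + S2 *v v i t + \<Gamma> i t)"
    and leader_input: "\<And>i t. t \<ge> 0 \<Longrightarrow> \<Gamma> (Inr i) t = 0"
    and leader_vh: "\<And>i t. t \<ge> 0 \<Longrightarrow> vh (Inr i) t = v (Inr i) t"
    and follower_vh:
      "\<And>i. caratheodory (vh (Inl i)) (\<lambda>t. S1 *v p (Inl i) t + S2 *v vh (Inl i) t + \<sigma> i t)"
    and psi: "\<And>i t. t \<ge> 0 \<Longrightarrow> \<psi> i t =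
                psi A (sys_matrix S1 S2) (\<lambda>i j. last_instant (K i j) (ts i j) (\<tau> i j)) p vh (Inl i) t"
  shows
    "((\<forall>i. velocity_algorithm S1 S2 (kp i) (kd i) (\<psi> i)
             (p (Inl i)) (v (Inl i)) (vh (Inl i)) (\<sigma> i) (\<Gamma> (Inl i)))
      \<longrightarrow> (\<forall>i. uniformly_bounded (p i) \<and> uniformly_bounded (v i)) \<and>
          (\<forall>i. uniformly_bounded (vh (Inl i)) \<and> uniformly_bounded (\<sigma> i) \<and>
               uniformly_bounded (\<psi> i) \<and> uniformly_bounded (\<Gamma> (Inl i))) \<and>
          (containment_error A v \<longlongrightarrow> 0) at_top \<and>
          (containment_error A p \<longlongrightarrow> 0) at_top)
     \<and>
     ((\<forall>i. k\<phi> i > 0 \<and> stable_matrix (- (k\<phi> i *\<^sub>R mat 1) + S2) \<and>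
           velocity_free_algorithm S1 S2 (kp i) (kd i) (k\<phi> i) (\<psi> i)
             (p (Inl i)) (vh (Inl i)) (\<sigma> i) (\<phi> i) (\<Gamma> (Inl i)))
      \<longrightarrow> (\<forall>i. uniformly_bounded (p i) \<and> uniformly_bounded (v i)) \<and>
          (\<forall>i. uniformly_bounded (vh (Inl i)) \<and> uniformly_bounded (\<sigma> i) \<and>
               uniformly_bounded (\<psi> i) \<and> uniformly_bounded (\<Gamma> (Inl i)) \<and> uniformly_bounded (\<phi> i)) \<and>
          (containment_error A v \<longlongrightarrow> 0) at_top \<and>
          (containment_error A p \<longlongrightarrow> 0) at_top)"
proof -
  interpret multi_agent E A K ts \<tau> T S1 S2 kp kd p v vh \<Gamma> \<sigma> \<psi>
    by (rule multi_agent.intro; fact assms)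
  show ?thesis
  proof (rule conjI; rule impI)
    assume alg: "\<forall>i. velocity_algorithm S1 S2 (kp i) (kd i) (\<psi> i)
      (p (Inl i)) (v (Inl i)) (vh (Inl i)) (\<sigma> i) (\<Gamma> (Inl i))"
    show "(\<forall>i. uniformly_bounded (p i) \<and> uniformly_bounded (v i)) \<and>
          (\<forall>i. uniformly_bounded (vh (Inl i)) \<and> uniformly_bounded (\<sigma> i) \<and>
               uniformly_bounded (\<psi> i) \<and> uniformly_bounded (\<Gamma> (Inl i))) \<and>
          (containment_error A v \<longlongrightarrow> 0) at_top \<and>
          (containment_error A p \<longlongrightarrow> 0) at_top"
      using velocity_containment[OF alg[rule_format]] by blast
  next
    assume alg: "\<forall>i. k\<phi> i > 0 \<and> stable_matrix (- (k\<phi> i *\<^sub>R mat 1) + S2) \<and>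
      velocity_free_algorithm S1 S2 (kp i) (kd i) (k\<phi> i) (\<psi> i)
        (p (Inl i)) (vh (Inl i)) (\<sigma> i) (\<phi> i) (\<Gamma> (Inl i))"
    have "k\<phi> i > 0" "stable_matrix (- (k\<phi> i *\<^sub>R mat 1) + S2)"
      "velocity_free_algorithm S1 S2 (kp i) (kd i) (k\<phi> i) (\<psi> i)
        (p (Inl i)) (vh (Inl i)) (\<sigma> i) (\<phi> i) (\<Gamma> (Inl i))" for i
      using alg by blast+
    from velocity_free_containment[OF this]
    show "(\<forall>i. uniformly_bounded (p i) \<and> uniformly_bounded (v i)) \<and>
          (\<forall>i. uniformly_bounded (vh (Inl i)) \<and> uniformly_bounded (\<sigma> i) \<and>
               uniformly_bounded (\<psi> i) \<and> uniformly_bounded (\<Gamma> (Inl i)) \<and> uniformly_bounded (\<phi> i)) \<and>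
          (containment_error A v \<longlongrightarrow> 0) at_top \<and>
          (containment_error A p \<longlongrightarrow> 0) at_top"
      by blast
  qed
qed

end
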